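(* Let $n\ge 2$ and let $\lambda$ be a dominant weight of $\mathrm{SL}(n,\mathbb{C})$. Let $\iota_\lambda:\mathrm{SL}(n,\mathbb{C})/P_\lambda\hookrightarrow\mathbb{P}(V_\lambda)$ be the projective embedding determined by a choice of basis of $V_\lambda=\Gamma(\mathrm{SL}(n,\mathbb{C})/P_\lambda,L_\lambda)$ consisting of eigenvectors for the natural $T$-action. Then the Zariski closure in $\mathbb{P}(V_\lambda)$ of any $T$-orbit in $\mathrm{SL}(n,\mathbb{C})/P_\lambda\hookrightarrow\mathbb{P}(V_\lambda)$ is a projectively normal toric variety.
   Context: $T\subset G=\mathrm{SL}(n,\mathbb{C})$ is the subgroup of diagonal matrices, $B\subset G$ the subgroup of upper triangular matrices. Weights are identified with elements of $\mathbb{Z}^n/\Delta$, $\Delta=\mathbb{Z}(1,\dots,1)$, the weight $\lambda=(a_1,\dots,a_n)$ corresponding to the character $e^\lambda(\mathrm{diag}(t_1,\dots,t_n))=\prod_i t_i^{a_i}$ of $T$; $\lambda$ is dominant if $a_1\ge\cdots\ge a_n$. For $\lambda$ dominant, $P_\lambda\supseteq B$ is the largest parabolic subgroup of $G$ (possibly $G$ itself) to which $e^\lambda$ extends as a character (extension still denoted $e^\lambda$). The line bundle $L_\lambda$ on $G/P_\lambda$ is $G\times\mathbb{C}$ modulo $(g,z)\sim(gp,e^\lambda(p)z)$ for $p\in P_\lambda$. Its space of global sections $V_\lambda$ consists of $s_f(gP_\lambda)=[(g,f(g))]$ with $f:G\to\mathbb{C}$ holomorphic and $f(gp)=e^\lambda(p)f(g)$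 for all $g\in G$, $p\in P_\lambda$. The natural ("democratic") action of $T$ on $V_\lambda$ is $(t\cdot f)(g)=f(t^{-1}g)$. Given a basis $(s_1,\dots,s_N)$ of $V_\lambda$ of $T$-eigenvectors, $\iota_\lambda$ is the map $x\mapsto[s_1(x):\cdots:s_N(x)]$ in the corresponding homogeneous coordinates of $\mathbb{P}(V_\lambda)\cong\mathbb{P}^{N-1}$. $T$ acts on $G/P_\lambda$ by left multiplication. A toric variety here is an irreducible variety containing a torus as a dense open subset, whose action on itself extends to the variety (not assumed normal a priori). A closed subvariety of projective space is projectively normal if its affine cone is a normal variety, i.e. its homogeneous coordinate ring is integrally closed in its field of fractions. *)

theory Defs
  imports
    "HOL-Analysis.Analysis"
    "HOL-Algebra.Left_Coset"
    "HOL-Algebra.QuotRing"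
    "HOL-Algebra.Polynomials"
    "HOL-Library.Poly_Mapping"
    "HOL-Library.Function_Algebras"
begin

section \<open>Polynomials in several variables\<close>

type_synonym 'v cpoly = "('v \<Rightarrow>\<^sub>0 nat) \<Rightarrow>\<^sub>0 complex"

definition peval :: "'v cpoly \<Rightarrow> ('v \<Rightarrow> complex) \<Rightarrow> complex" where
  "peval p x = (\<Sum>m\<in>Poly_Mapping.keys p.
     Poly_Mapping.lookup p m * (\<Prod>v\<in>Poly_Mapping.keys m. x v ^ Poly_Mapping.lookup m v))"

text \<open>Homogeneity of degree \<open>d\<close> with respect to the variables in \<open>V\<close>; the other variables
  have degree 0. The zero polynomial is homogeneous of every degree.\<close>

definition homogeneous_in :: "'v set \<Rightarrow> nat \<Rightarrow> 'v cpoly \<Rightarrow> bool" where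
  "homogeneous_in V d p \<longleftrightarrow>
     (\<forall>m\<in>Poly_Mapping.keys p. (\<Sum>v\<in>Poly_Mapping.keys m \<inter> V. Poly_Mapping.lookup m v) = d)"

abbreviation homogeneous :: "nat \<Rightarrow> 'v cpoly \<Rightarrow> bool" where
  "homogeneous \<equiv> homogeneous_in UNIV"

definition cpoly_ring :: "'v cpoly ring" where
  "cpoly_ring = \<lparr>carrier = UNIV, mult = (*), one = 1, zero = 0, add = (+)\<rparr>"

section \<open>Fields of fractions and normal domains\<close>

text \<open>The fraction \<open>a/b\<close>, as a class of pairs (numerator, denominator).\<close>

definition fraction :: "('a, 'c) ring_scheme \<Rightarrow> 'a \<Rightarrow> 'a \<Rightarrow> ('a \<times> 'a) set" where
  "fraction R a b = {(c, d). c \<in> carrier R \<and> d \<in> carrier R - {\<zero>\<^bsub>R\<^esub>} \<and>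
     a \<otimes>\<^bsub>R\<^esub> d = c \<otimes>\<^bsub>R\<^esub> b}"

definition fraction_field :: "('a, 'c) ring_scheme \<Rightarrow> ('a \<times> 'a) set ring" where
  "fraction_field R =
    \<lparr>carrier = {fraction R a b | a b. a \<in> carrier R \<and> b \<in> carrier R - {\<zero>\<^bsub>R\<^esub>}},
     mult = (\<lambda>u w. \<Union>(a, b)\<in>u. \<Union>(c, d)\<in>w. fraction R (a \<otimes>\<^bsub>R\<^esub> c) (b \<otimes>\<^bsub>R\<^esub> d)),
     one = fraction R \<one>\<^bsub>R\<^esub> \<one>\<^bsub>R\<^esub>,
     zero = fraction R \<zero>\<^bsub>R\<^esub> \<one>\<^bsub>R\<^esub>,
     add = (\<lambda>u w. \<Union>(a, b)\<in>u. \<Union>(c, d)\<in>w.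
       fraction R (a \<otimes>\<^bsub>R\<^esub> d \<oplus>\<^bsub>R\<^esub> c \<otimes>\<^bsub>R\<^esub> b) (b \<otimes>\<^bsub>R\<^esub> d))\<rparr>"

definition integral_over :: "('a, 'c) ring_scheme \<Rightarrow> 'a set \<Rightarrow> 'a \<Rightarrow> bool" where
  "integral_over K S x \<longleftrightarrow>
     (\<exists>p. p \<noteq> [] \<and> polynomial\<^bsub>K\<^esub> S p \<and> hd p = \<one>\<^bsub>K\<^esub> \<and> ring.eval K p x = \<zero>\<^bsub>K\<^esub>)"

definition normal_domain :: "('a, 'c) ring_scheme \<Rightarrow> bool" where
  "normal_domain R \<longleftrightarrow> domain R \<and>
     (let S = (\<lambda>a. fraction R a \<one>\<^bsub>R\<^esub>) ` carrier R in
      \<forall>x\<in>carrier (fraction_field R). integral_over (fraction_field R) S x \<longrightarrow> x \<in> S)"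

section \<open>Projective space and its Zariski topology\<close>

text \<open>Points of projective space are lines through the origin; \<open>proj_point v\<close> is
  \<open>[v\<^sub>1 : \<dots> : v\<^sub>N]\<close> whenever \<open>v \<noteq> 0\<close>.\<close>

abbreviation proj_point :: "complex^'m \<Rightarrow> (complex^'m) set" where
  "proj_point v \<equiv> vec.span {v}"

definition proj_space :: "(complex^'m) set set" where
  "proj_space = {proj_point v | v. v \<noteq> 0}"

text \<open>The sets on which a given homogeneous polynomial does not vanish are a basis of the
  Zariski topology.\<close>

definition zariski :: "(complex^'m) set topology" where
  "zariski = topology_generated_by
     {{L \<in> proj_space. \<exists>v\<in>L. peval f (($) v) \<noteq> 0} | f :: 'm cpoly. \<exists>d. homogeneous d f}"

text \<open>Varieties are irreducible, in particular nonempty.\<close>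

definition closed_subvariety :: "(complex^'m) set set \<Rightarrow> bool" where
  "closed_subvariety Y \<longleftrightarrow> closedin zariski Y \<and> Y \<noteq> {} \<and>
     (\<forall>C D. closedin zariski C \<longrightarrow> closedin zariski D \<longrightarrow> Y \<subseteq> C \<union> D \<longrightarrow> Y \<subseteq> C \<or> Y \<subseteq> D)"

definition homogeneous_ideal :: "(complex^'m) set set \<Rightarrow> 'm cpoly set" where
  "homogeneous_ideal Y =
     Idl\<^bsub>cpoly_ring\<^esub> {f. (\<exists>d. homogeneous d f) \<and> (\<forall>L\<in>Y. \<forall>v\<in>L - {0}. peval f (($) v) = 0)}"

definition homogeneous_coordinate_ring :: "(complex^'m) set set \<Rightarrow> 'm cpoly set ring" where
  "homogeneous_coordinate_ring Y = cpoly_ring Quot (homogeneous_ideal Y)"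

definition projectively_normal :: "(complex^'m) set set \<Rightarrow> bool" where
  "projectively_normal Y \<longleftrightarrow>
     closed_subvariety Y \<and> normal_domain (homogeneous_coordinate_ring Y)"

section \<open>Toric varieties\<close>

text \<open>The algebraic torus of rank \<open>k\<close>, under pointwise multiplication; tuples are padded by 1.\<close>

definition alg_torus :: "nat \<Rightarrow> (nat \<Rightarrow> complex) set" where
  "alg_torus k = {t. (\<forall>i<k. t i \<noteq> 0) \<and> (\<forall>i\<ge>k. t i = 1)}"

text \<open>A morphism to projective space is given, near every point, by polynomials without common
  zero there. Multiplying these by a polynomial that cuts out the complement of the neighbourhood,
  one may take the neighbourhood to be the locus where the polynomials do not all vanish.
  Denominators are not needed, as they can be cleared.\<close>

definition torus_morphism ::
    "nat \<Rightarrow> (complex^'m) set set \<Rightarrow> ((nat \<Rightarrow> complex) \<Rightarrow> (complex^'m) set) \<Rightarrow> bool" where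
  "torus_morphism k Y \<phi> \<longleftrightarrow>
     (\<forall>t\<in>alg_torus k. \<phi> t \<in> Y) \<and>
     (\<forall>t\<^sub>0\<in>alg_torus k. \<exists>F :: 'm \<Rightarrow> nat cpoly.
        (\<exists>j. peval (F j) t\<^sub>0 \<noteq> 0) \<and>
        (\<forall>t\<in>alg_torus k. (\<exists>j. peval (F j) t \<noteq> 0) \<longrightarrow>
           \<phi> t = proj_point (\<chi> j. peval (F j) t)))"

text \<open>The same for the product of the torus with \<open>Y\<close>: the polynomials are homogeneous of one
  common degree in the projective coordinates (the variables \<open>Inr j\<close>).\<close>

definition action_morphism ::
    "nat \<Rightarrow> (complex^'m) set set \<Rightarrow>
     ((nat \<Rightarrow> complex) \<Rightarrow> (complex^'m) set \<Rightarrow> (complex^'m) set) \<Rightarrow> bool" where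
  "action_morphism k Y A \<longleftrightarrow>
     (\<forall>t\<in>alg_torus k. \<forall>x\<in>Y. A t x \<in> Y) \<and>
     (\<forall>t\<^sub>0\<in>alg_torus k. \<forall>v\<^sub>0. v\<^sub>0 \<noteq> 0 \<longrightarrow> proj_point v\<^sub>0 \<in> Y \<longrightarrow>
        (\<exists>d. \<exists>F :: 'm \<Rightarrow> (nat + 'm) cpoly.
           (\<forall>j. homogeneous_in (range Inr) d (F j)) \<and>
           (\<exists>j. peval (F j) (case_sum t\<^sub>0 (($) v\<^sub>0)) \<noteq> 0) \<and>
           (\<forall>t\<in>alg_torus k. \<forall>v. v \<noteq> 0 \<longrightarrow> proj_point v \<in> Y \<longrightarrow>
              (\<exists>j. peval (F j) (case_sum t (($) v)) \<noteq> 0) \<longrightarrow>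
              A t (proj_point v) = proj_point (\<chi> j. peval (F j) (case_sum t (($) v))))))"

definition regular_function ::
    "(complex^'m) set set \<Rightarrow> ((complex^'m) set \<Rightarrow> complex) \<Rightarrow> bool" where
  "regular_function U h \<longleftrightarrow>
     (\<forall>x\<in>U. \<exists>W. openin (subtopology zariski U) W \<and> x \<in> W \<and>
        (\<exists>d f g. homogeneous d f \<and> homogeneous d g \<and>
           (\<forall>v. v \<noteq> 0 \<longrightarrow> proj_point v \<in> W \<longrightarrow>
              peval g (($) v) \<noteq> 0 \<and> h (proj_point v) = peval f (($) v) / peval g (($) v))))"

text \<open>\<open>\<phi>\<close> is an isomorphism of varieties from the torus onto a dense open subset of \<open>Y\<close>.\<close>

definition dense_torus_embedding ::
    "nat \<Rightarrow> (complex^'m) set set \<Rightarrow> ((nat \<Rightarrow> complex) \<Rightarrow> (complex^'m) set) \<Rightarrow> bool" where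
  "dense_torus_embedding k Y \<phi> \<longleftrightarrow>
     torus_morphism k Y \<phi> \<and> inj_on \<phi> (alg_torus k) \<and>
     openin (subtopology zariski Y) (\<phi> ` alg_torus k) \<and>
     Y \<subseteq> zariski closure_of (\<phi> ` alg_torus k) \<and>
     (\<forall>i<k. regular_function (\<phi> ` alg_torus k) (\<lambda>x. inv_into (alg_torus k) \<phi> x i))"

definition toric_variety :: "(complex^'m) set set \<Rightarrow> bool" where
  "toric_variety Y \<longleftrightarrow> closed_subvariety Y \<and>
     (\<exists>k \<phi> A. dense_torus_embedding k Y \<phi> \<and> action_morphism k Y A \<and>
        (\<forall>x\<in>Y. A (\<lambda>i. 1) x = x) \<and>
        (\<forall>s\<in>alg_torus k. \<forall>t\<in>alg_torus k. \<forall>x\<in>Y. A (\<lambda>i. s i * t i) x = A s (A t x)) \<and>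
        (\<forall>s\<in>alg_torus k. \<forall>t\<in>alg_torus k. A s (\<phi> t) = \<phi> (\<lambda>i. s i * t i)))"

section \<open>The special linear group, weights and parabolic subgroups\<close>

text \<open>Rows and columns are indexed by a finite linearly ordered type \<open>'n\<close>, which plays the role
  of \<open>{1, \<dots>, n}\<close> with \<open>n = CARD('n)\<close>.\<close>

definition SL :: "(complex^'n^'n) monoid" where
  "SL = \<lparr>carrier = {A. det A = 1}, mult = (**), one = mat 1\<rparr>"

definition diag_torus :: "(complex^'n^'n) set" where
  "diag_torus = {t \<in> carrier SL. \<forall>i j. i \<noteq> j \<longrightarrow> t $ i $ j = 0}"

definition upper_borel :: "(complex^'n::{finite,linorder}^'n::{finite,linorder}) set" where
  "upper_borel = {b \<in> carrier SL. \<forall>i j. j < i \<longrightarrow> b $ i $ j = 0}"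

text \<open>A weight is given by a representative in \<open>\<int>\<^sup>n\<close>; on \<open>diag_torus\<close> the character depends only
  on its class modulo \<open>\<int>(1, \<dots>, 1)\<close>.\<close>

definition weight_char :: "int^'n \<Rightarrow> complex^'n^'n \<Rightarrow> complex" where
  "weight_char lam t = (\<Prod>i\<in>UNIV. t $ i $ i powi lam $ i)"

lemma weight_char_shift:
  fixes t :: "complex^'n^'n" and lam :: "int^'n"
  assumes "t \<in> diag_torus"
  shows "weight_char (\<chi> i. lam $ i + c) t = weight_char lam t"
proof -
  have "det t = (\<Prod>i\<in>UNIV. t $ i $ i)"
    using assms by (intro det_diagonal) (auto simp: diag_torus_def)
  then have *: "(\<Prod>i\<in>UNIV. t $ i $ i) = 1"
    using assms by (simp add: diag_torus_def SL_def)
  then have nz: "t $ i $ i \<noteq> 0" for i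
    by (metis UNIV_I finite prod_zero_iff zero_neq_one)
  have "weight_char (\<chi> i. lam $ i + c) t = weight_char lam t * (\<Prod>i\<in>UNIV. t $ i $ i powi c)"
    by (simp add: weight_char_def power_int_add nz prod.distrib)
  also have "(\<Prod>i\<in>A. t $ i $ i powi c) = (\<Prod>i\<in>A. t $ i $ i) powi c" for A :: "'n set"
    by (induction A rule: infinite_finite_induct) (simp_all add: power_int_mult_distrib)
  finally show ?thesis by (simp add: *)
qed

definition dominant :: "int^'n::{finite,linorder} \<Rightarrow> bool" where
  "dominant lam \<longleftrightarrow> (\<forall>i j. i \<le> j \<longrightarrow> lam $ j \<le> lam $ i)"

abbreviation entries :: "complex^'n^'n \<Rightarrow> 'n \<times> 'n \<Rightarrow> complex" where
  "entries g \<equiv> \<lambda>(i, j). g $ i $ j"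

definition zariski_closed_in_SL :: "(complex^'n^'n) set \<Rightarrow> bool" where
  "zariski_closed_in_SL P \<longleftrightarrow>
     (\<exists>S :: ('n \<times> 'n) cpoly set. P = {g \<in> carrier SL. \<forall>p\<in>S. peval p (entries g) = 0})"

text \<open>A parabolic subgroup is a closed subgroup containing a Borel subgroup, and the Borel
  subgroups are the conjugates of \<open>upper_borel\<close>.\<close>

definition parabolic :: "(complex^'n::{finite,linorder}^'n::{finite,linorder}) set \<Rightarrow> bool" where
  "parabolic P \<longleftrightarrow> subgroup P SL \<and> zariski_closed_in_SL P \<and>
     (\<exists>g\<in>carrier SL. \<forall>b\<in>upper_borel. g \<otimes>\<^bsub>SL\<^esub> b \<otimes>\<^bsub>SL\<^esub> inv\<^bsub>SL\<^esub> g \<in> P)"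

definition algebraic_character ::
    "(complex^'n^'n) set \<Rightarrow> (complex^'n^'n \<Rightarrow> complex) \<Rightarrow> bool" where
  "algebraic_character P \<psi> \<longleftrightarrow>
     (\<forall>g\<in>P. \<psi> g \<noteq> 0) \<and> (\<forall>g\<in>P. \<forall>h\<in>P. \<psi> (g \<otimes>\<^bsub>SL\<^esub> h) = \<psi> g * \<psi> h) \<and>
     (\<exists>p :: ('n \<times> 'n) cpoly. \<forall>g\<in>P. \<psi> g = peval p (entries g))"

definition extends_weight ::
    "int^'n \<Rightarrow> (complex^'n^'n) set \<Rightarrow> (complex^'n^'n \<Rightarrow> complex) \<Rightarrow> bool" where
  "extends_weight lam P \<psi> \<longleftrightarrow>
     algebraic_character P \<psi> \<and> (\<forall>t\<in>diag_torus. \<psi> t = weight_char lam t)"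

definition parabolic_of :: "int^'n::{finite,linorder} \<Rightarrow> (complex^'n::{finite,linorder}^'n::{finite,linorder}) set" where
  "parabolic_of lam =
     (GREATEST P. parabolic P \<and> upper_borel \<subseteq> P \<and> (\<exists>\<psi>. extends_weight lam P \<psi>))"

text \<open>The extension is unique on \<open>parabolic_of lam\<close>; its values elsewhere are irrelevant.\<close>

definition extended_char :: "int^'n::{finite,linorder} \<Rightarrow> complex^'n::{finite,linorder}^'n::{finite,linorder} \<Rightarrow> complex" where
  "extended_char lam = (SOME \<psi>. extends_weight lam (parabolic_of lam) \<psi>)"

section \<open>Sections of the line bundle and the projective embedding\<close>

text \<open>A function is holomorphic at a point of the ambient space of matrices if it is real
  differentiable near it with complex linear derivatives; a function on the closed submanifold
  \<open>carrier SL\<close> is holomorphic if it locally extends to a holomorphic function on the ambient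
  space.\<close>

definition complex_differentiable_at ::
    "(complex^'n^'n \<Rightarrow> complex) \<Rightarrow> complex^'n^'n \<Rightarrow> bool" where
  "complex_differentiable_at F x \<longleftrightarrow>
     (\<exists>D. (F has_derivative D) (at x) \<and> (\<forall>c v. D (\<chi> i j. c * v $ i $ j) = c * D v))"

definition holomorphic_on_SL :: "(complex^'n^'n \<Rightarrow> complex) \<Rightarrow> bool" where
  "holomorphic_on_SL f \<longleftrightarrow>
     (\<forall>g\<in>carrier SL. \<exists>U F. open U \<and> g \<in> U \<and>
        (\<forall>x\<in>U. complex_differentiable_at F x) \<and> (\<forall>x\<in>U \<inter> carrier SL. F x = f x))"

text \<open>The section \<open>s\<^sub>f\<close> of the line bundle is identified with \<open>f\<close>. Functions on the group are
  extended by 0 to all matrices, so that they are determined by their values on the group.\<close>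

definition sections :: "int^'n::{finite,linorder} \<Rightarrow> (complex^'n::{finite,linorder}^'n::{finite,linorder} \<Rightarrow> complex) set" where
  "sections lam = {f. holomorphic_on_SL f \<and> (\<forall>g. g \<notin> carrier SL \<longrightarrow> f g = 0) \<and>
     (\<forall>g\<in>carrier SL. \<forall>p\<in>parabolic_of lam. f (g \<otimes>\<^bsub>SL\<^esub> p) = extended_char lam p * f g)}"

interpretation fun_space: vector_space "\<lambda>(c::complex) (f :: 'a \<Rightarrow> complex) x. c * f x"
  by unfold_locales (auto simp: fun_eq_iff algebra_simps)

definition torus_eigenvector :: "(complex^'n^'n \<Rightarrow> complex) \<Rightarrow> bool" where
  "torus_eigenvector f \<longleftrightarrow> f \<noteq> (\<lambda>g. 0) \<and>
     (\<forall>t\<in>diag_torus. \<exists>c. \<forall>g\<in>carrier SL. f (inv\<^bsub>SL\<^esub> t \<otimes>\<^bsub>SL\<^esub> g) = c * f g)"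

definition torus_eigenbasis ::
    "int^'n::{finite,linorder} \<Rightarrow> ('m::finite \<Rightarrow> complex^'n::{finite,linorder}^'n::{finite,linorder} \<Rightarrow> complex) \<Rightarrow> bool" where
  "torus_eigenbasis lam s \<longleftrightarrow> inj s \<and> fun_space.independent (range s) \<and>
     fun_space.span (range s) = sections lam \<and> (\<forall>j. torus_eigenvector (s j))"

text \<open>\<open>x \<mapsto> [s\<^sub>1(x) : \<dots> : s\<^sub>N(x)]\<close>. By equivariance the point does not depend on the chosen
  representative of the coset \<open>x\<close>.\<close>

definition projective_embedding ::
    "('m::finite \<Rightarrow> complex^'n^'n \<Rightarrow> complex) \<Rightarrow> (complex^'n^'n) set \<Rightarrow> (complex^'m) set" where
  "projective_embedding s x = (let g = (SOME g. g \<in> x) in proj_point (\<chi> j. s j g))"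

definition torus_orbit :: "(complex^'n^'n) set \<Rightarrow> (complex^'n^'n) set set" where
  "torus_orbit x = (\<lambda>t. t <#\<^bsub>SL\<^esub> x) ` diag_torus"

end

theory Submission
  imports Defs "HOL-Complex_Analysis.Complex_Analysis"
begin

text \<open>Let \<open>g\<close> represent a coset. A section that is an eigenvector of the torus restricts to a multiple
  of a monomial on the orbit of \<open>g\<close>, so the closure of the orbit is the closure of the image of a
  monomial map. The exponents are confined to a polytope: as the unimodular group is compact modulo
  its upper triangular subgroup, sections grow at most like products of minors, and testing this on
  one-parameter subgroups bounds the partial sums of the exponent by ranks of submatrices of \<open>g\<close>.
  These ranks are submodular, so the polytope is a sum of matroid base polytopes and has the integer
  decomposition property: an integral point of a dilated polytope is a sum of weights of products of
  minors that do not vanish at \<open>g\<close>. Products of minors are sections, so these weights occur among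
  the exponents of the monomial map. Hence the exponents generate the monoid of all integral points
  in a cone, which is saturated. The homogeneous coordinate ring is the algebra of this monoid, and
  division with respect to leading monomials shows that it is completely integrally closed.\<close>

text \<open>The diagonal torus sees weights only modulo constant vectors, while a projective
  coordinate ring is graded. Both are reconciled by representing the weight by a vector
  \<open>l\<close> with positive entries: the weights of sections then have nonnegative
  representatives of one total \<open>L > 0\<close>, scalars multiply all coordinates by a common
  factor, and the diagonal torus can be exchanged for the torus of all vectors without zero entries,
  on which distinct monomials are linearly independent.

  \<open>parabolic_of\<close> and \<open>extended_char\<close> are given by maximality and by
  choice, so at the start neither has a formula. The growth bound resolves this too: applied to a
  character on any admissible parabolic subgroup instead of a section, it forces the subgroup to be
  block triangular, and together with the maximum modulus principle it identifies the character as a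
  product of principal minors.

  Sections are only holomorphic, so analysis has to supply integrality of their weights: the
  exponent of a one-parameter subgroup is an integer by periodicity, and the total degree is pinned
  down by the scalar matrices in the group.\<close>

no_notation fps_nth (infixl \<open>$\<close> 75)

section \<open>Integral polymatroids\<close>

definition submodular_on :: "'a set \<Rightarrow> ('a set \<Rightarrow> int) \<Rightarrow> bool" where
  "submodular_on E f \<longleftrightarrow> (\<forall>A Y. A \<subseteq> E \<longrightarrow> Y \<subseteq> E \<longrightarrow> f (A \<union> Y) + f (A \<inter> Y) \<le> f A + f Y)"

lemma submodular_onD:
  "submodular_on E f \<Longrightarrow> A \<subseteq> E \<Longrightarrow> Y \<subseteq> E \<Longrightarrow> f (A \<union> Y) + f (A \<inter> Y) \<le> f A + f Y"
  by (auto simp: submodular_on_def)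

text \<open>With the value at \<open>e\<close> fixed to be \<open>c\<close>, a set \<open>A\<close>
  of other elements is bounded by \<open>f A\<close> directly and by
  \<open>f (insert e A) - c\<close> through the larger set. The four instances of submodularity
  match the four ways in which the minima for \<open>A\<close> and \<open>Y\<close> are
  attained.\<close>

lemma submodular_on_projection:
  assumes "submodular_on (insert e E) f" "e \<notin> E"
  shows "submodular_on E (\<lambda>A. min (f A) (f (insert e A) - c))"
  unfolding submodular_on_def
proof (intro allI impI)
  fix A Y assume A: "A \<subseteq> E" and Y: "Y \<subseteq> E"
  have e: "e \<notin> A" "e \<notin> Y" using assms A Y by auto
  have *: "f (C \<union> D) + f (C \<inter> D) \<le> f C + f D" if "C \<subseteq> insert e E" "D \<subseteq> insert e E" for C D
    using assms that by (auto simp: submodular_on_def)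
  have 1: "f (A \<union> Y) + f (A \<inter> Y) \<le> f A + f Y" using *[of A Y] A Y by auto
  have 2: "f (insert e (A \<union> Y)) + f (insert e (A \<inter> Y)) \<le> f (insert e A) + f (insert e Y)"
    using *[of "insert e A" "insert e Y"] A Y by auto
  have 3: "f (insert e (A \<union> Y)) + f (A \<inter> Y) \<le> f (insert e A) + f Y"
    using *[of "insert e A" Y] A Y e by (auto simp: Int_insert_left)
  have 4: "f (insert e (A \<union> Y)) + f (A \<inter> Y) \<le> f A + f (insert e Y)"
    using *[of A "insert e Y"] A Y e by (auto simp: Int_insert_right)
  show "min (f (A \<union> Y)) (f (insert e (A \<union> Y)) - c) + min (f (A \<inter> Y)) (f (insert e (A \<inter> Y)) - c)
    \<le> min (f A) (f (insert e A) - c) + min (f Y) (f (insert e Y) - c)"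
    using 1 2 3 4 by linarith
qed

text \<open>The value of the modular function at a new element \<open>e\<close> can be chosen first: the lower and
  the upper bounds for it are compatible by submodularity, and the bounds that remain on the other
  elements are again super- and submodular, being partial optima.\<close>

lemma discrete_sandwich:
  fixes f g :: "'a set \<Rightarrow> int"
  assumes "finite E" "submodular_on E f" "submodular_on E (\<lambda>A. - g A)" "f {} = 0" "g {} = 0"
    "\<And>A. A \<subseteq> E \<Longrightarrow> g A \<le> f A"
  shows "\<exists>m. \<forall>A\<subseteq>E. g A \<le> sum m A \<and> sum m A \<le> f A"
  using assms
proof (induction E arbitrary: f g rule: finite_induct)
  case empty
  then show ?case by auto
next
  case (insert e E)
  \<comment> \<open>The sum over \<open>Y\<close> must be at least \<open>g Y\<close>, so the bound
    on \<open>insert e Y\<close> leaves at most \<open>f (insert e Y) - g Y\<close> for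
    \<open>e\<close>. The largest value allowed by all \<open>Y\<close> is taken.\<close>
  let ?U = "(\<lambda>Y. f (insert e Y) - g Y) ` Pow E"
  define c where "c = Min ?U"
  have fin: "finite ?U" "?U \<noteq> {}" using insert by auto
  have up: "c \<le> f (insert e Y) - g Y" if "Y \<subseteq> E" for Y
    unfolding c_def using fin that by (intro Min_le) auto
  obtain Y0 where Y0: "Y0 \<subseteq> E" "c = f (insert e Y0) - g Y0"
    using Min_in[OF fin] unfolding c_def by auto
  have low: "g (insert e A) - f A \<le> c" if A: "A \<subseteq> E" for A
  proof -
    have e: "e \<notin> A" "e \<notin> Y0" using insert A Y0 by auto
    have "g (insert e A) + g Y0 \<le> g (insert e (A \<union> Y0)) + g (A \<inter> Y0)"
      using submodular_onD[OF insert.prems(2), of "insert e A" Y0] A Y0 e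
      by (simp add: Int_insert_left subset_insertI2)
    also have "\<dots> \<le> f (insert e (A \<union> Y0)) + f (A \<inter> Y0)"
      using A Y0 by (intro add_mono insert.prems) auto
    also have "\<dots> \<le> f A + f (insert e Y0)"
      using submodular_onD[OF insert.prems(1), of A "insert e Y0"] A Y0 e
      by (simp add: Int_insert_right subset_insertI2)
    finally show ?thesis using Y0 by simp
  qed
  let ?f = "\<lambda>A. min (f A) (f (insert e A) - c)"
  \<comment> \<open>This is the maximum of \<open>g A\<close> and \<open>g (insert e A) - c\<close>,
    written with negatives so that \<open>submodular_on_projection\<close> applies to
    \<open>- g\<close>.\<close>
  let ?g = "\<lambda>A. - min (- g A) (- g (insert e A) - (- c))"
  have "\<exists>m. \<forall>A\<subseteq>E. ?g A \<le> sum m A \<and> sum m A \<le> ?f A"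
  proof (rule insert.IH)
    show "submodular_on E ?f" using insert by (intro submodular_on_projection)
    show "submodular_on E (\<lambda>A. - ?g A)"
      using submodular_on_projection[OF insert.prems(2) insert.hyps(2), of "-c"] by simp
    show "?f {} = 0" using up[of "{}"] insert.prems by simp
    show "?g {} = 0" using low[of "{}"] insert.prems by simp
    show "?g A \<le> ?f A" if "A \<subseteq> E" for A
    proof -
      have "g A \<le> f A" "g (insert e A) \<le> f (insert e A)"
        using that by (auto intro!: insert.prems)
      with up[OF that] low[OF that] show ?thesis by linarith
    qed
  qed
  then obtain m where m: "\<And>A. A \<subseteq> E \<Longrightarrow> ?g A \<le> sum m A \<and> sum m A \<le> ?f A" by blast
  let ?m = "m(e := c)"
  have "g A \<le> sum ?m A \<and> sum ?m A \<le> f A" if A: "A \<subseteq> insert e E" for A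
  proof (cases "e \<in> A")
    case True
    let ?A = "A - {e}"
    have XE: "?A \<subseteq> E" using A by auto
    have "finite A" using A insert.hyps(1) by (meson finite.insertI finite_subset)
    then have "sum ?m A = c + sum ?m ?A" using True by (simp add: sum.remove)
    also have "sum ?m ?A = sum m ?A" by (intro sum.cong) auto
    finally show ?thesis using m[OF XE] True by (simp add: insert_absorb) linarith
  next
    case False
    then have XE: "A \<subseteq> E" using A by auto
    have "sum ?m A = sum m A" using False by (intro sum.cong) auto
    then show ?thesis using m[OF XE] by simp linarith
  qed
  then show ?case by blast
qed

lemma submodular_on_sum:
  assumes "\<And>q. q \<in> Q \<Longrightarrow> submodular_on E (f q)"
  shows "submodular_on E (\<lambda>A. \<Sum>q\<in>Q. f q A)"
  using assms by (auto simp: submodular_on_def sum.distrib[symmetric] intro!: sum_mono)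

text \<open>One summand is split off at a time: what \<open>\<mu>\<close> demands beyond the
  remaining functions is supermodular and lies below \<open>f q\<close>, so an integral modular
  function fits in between. Equality of the totals makes both bounds tight on
  \<open>E\<close>.\<close>

lemma integral_polymatroid_sum:
  fixes f :: "'q \<Rightarrow> 'a set \<Rightarrow> int" and \<mu> :: "'a \<Rightarrow> int"
  assumes "finite Q" "finite E" "\<And>q. q \<in> Q \<Longrightarrow> submodular_on E (f q)" "\<And>q. q \<in> Q \<Longrightarrow> f q {} = 0"
    "\<And>A. A \<subseteq> E \<Longrightarrow> sum \<mu> A \<le> (\<Sum>q\<in>Q. f q A)" "sum \<mu> E = (\<Sum>q\<in>Q. f q E)"
  shows "\<exists>\<nu>. (\<forall>q\<in>Q. (\<forall>A\<subseteq>E. sum (\<nu> q) A \<le> f q A) \<and> sum (\<nu> q) E = f q E) \<and>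
    (\<forall>i\<in>E. \<mu> i = (\<Sum>q\<in>Q. \<nu> q i))"
  using assms
proof (induction Q arbitrary: \<mu> rule: finite_induct)
  case empty
  have "\<mu> i = 0" if i: "i \<in> E" for i
  proof -
    have "sum \<mu> E = \<mu> i + sum \<mu> (E - {i})" using i empty by (simp add: sum.remove)
    moreover have "\<mu> i \<le> 0" using empty(4)[of "{i}"] i by simp
    moreover have "sum \<mu> (E - {i}) \<le> 0" using empty(4)[of "E - {i}"] by auto
    moreover have "sum \<mu> E = 0" using empty by simp
    ultimately show ?thesis by linarith
  qed
  then show ?case by simp
next
  case (insert q Q)
  let ?h = "\<lambda>A. \<Sum>q\<in>Q. f q A"
  let ?g = "\<lambda>A. sum \<mu> A - ?h A"
  have finX: "finite A" if "A \<subseteq> E" for A using that \<open>finite E\<close> finite_subset by blast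
  have "\<exists>m. \<forall>A\<subseteq>E. ?g A \<le> sum m A \<and> sum m A \<le> f q A"
  proof (rule discrete_sandwich)
    have h: "submodular_on E ?h" using insert by (intro submodular_on_sum) auto
    show "submodular_on E (\<lambda>A. - ?g A)"
      unfolding submodular_on_def
    proof (intro allI impI)
      fix A Y assume A: "A \<subseteq> E" and Y: "Y \<subseteq> E"
      have "sum \<mu> (A \<union> Y) + sum \<mu> (A \<inter> Y) = sum \<mu> A + sum \<mu> Y"
        using finX A Y by (intro sum.union_inter) auto
      then show "- ?g (A \<union> Y) + - ?g (A \<inter> Y) \<le> - ?g A + - ?g Y"
        using submodular_onD[OF h A Y] by linarith
    qed
    show "?g {} = 0" using insert by simp
    show "?g A \<le> f q A" if "A \<subseteq> E" for A
      using insert.prems(4)[OF that] insert.hyps by simp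
  qed (use insert in auto)
  then obtain m where m: "\<And>A. A \<subseteq> E \<Longrightarrow> ?g A \<le> sum m A" "\<And>A. A \<subseteq> E \<Longrightarrow> sum m A \<le> f q A"
    by blast
  have mE: "sum m E = f q E"
    using m[of E] insert.prems(5) insert.hyps by simp
  let ?\<mu> = "\<lambda>i. \<mu> i - m i"
  have "\<exists>\<nu>. (\<forall>q\<in>Q. (\<forall>A\<subseteq>E. sum (\<nu> q) A \<le> f q A) \<and> sum (\<nu> q) E = f q E) \<and>
    (\<forall>i\<in>E. ?\<mu> i = (\<Sum>q\<in>Q. \<nu> q i))"
  proof (rule insert.IH)
    show "sum ?\<mu> A \<le> ?h A" if "A \<subseteq> E" for A using m(1)[OF that] by (simp add: sum_subtractf)
    show "sum ?\<mu> E = ?h E" using mE insert.prems(5) insert.hyps by (simp add: sum_subtractf)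
  qed (use insert in auto)
  then obtain \<nu> where \<nu>: "\<forall>q\<in>Q. (\<forall>A\<subseteq>E. sum (\<nu> q) A \<le> f q A) \<and> sum (\<nu> q) E = f q E"
    "\<forall>i\<in>E. ?\<mu> i = (\<Sum>q\<in>Q. \<nu> q i)" by blast
  have "(\<Sum>p\<in>Q. (\<nu>(q := m)) p i) = (\<Sum>p\<in>Q. \<nu> p i)" for i
    using insert.hyps by (intro sum.cong) auto
  then have sums: "\<mu> i = (\<Sum>p\<in>insert q Q. (\<nu>(q := m)) p i)" if "i \<in> E" for i
    using \<nu>(2) that insert.hyps by (simp add: algebra_simps)
  show ?case
    by (rule exI[of _ "\<nu>(q := m)"]) (use \<nu>(1) m(2) mE sums in auto)
qed

section \<open>Almost integral fractions\<close>

context domain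
begin

lemma m_rcancel_iff: "a \<in> carrier R \<Longrightarrow> b \<in> carrier R \<Longrightarrow> c \<in> carrier R \<Longrightarrow> c \<noteq> \<zero> \<Longrightarrow> a \<otimes> c = b \<otimes> c \<longleftrightarrow> a = b"
  using m_rcancel by blast

lemma fraction_memI: "a \<in> carrier R \<Longrightarrow> b \<in> carrier R \<Longrightarrow> b \<noteq> \<zero> \<Longrightarrow> (a, b) \<in> fraction R a b"
  by (simp add: fraction_def)

lemma fraction_subset:
  assumes "a \<in> carrier R" "b \<in> carrier R" "b \<noteq> \<zero>" "c \<in> carrier R" "d \<in> carrier R" "d \<noteq> \<zero>"
    and "a \<otimes> d = c \<otimes> b"
  shows "fraction R a b \<subseteq> fraction R c d"
proof -
  have "c \<otimes> y = x \<otimes> d" if x: "x \<in> carrier R" and y: "y \<in> carrier R" and e: "a \<otimes> y = x \<otimes> b" for x y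
  proof -
    have "(c \<otimes> y) \<otimes> b = (c \<otimes> b) \<otimes> y" using assms(1-6) x y by (simp add: m_ac)
    also have "\<dots> = (a \<otimes> d) \<otimes> y" using assms(7) by simp
    also have "\<dots> = (a \<otimes> y) \<otimes> d" using assms(1-6) x y by (simp add: m_ac)
    also have "\<dots> = (x \<otimes> b) \<otimes> d" by (simp only: e)
    also have "\<dots> = (x \<otimes> d) \<otimes> b" using assms x y by (simp add: m_ac)
    finally show ?thesis using m_rcancel_iff[of "c \<otimes> y" "x \<otimes> d" b] assms x y by simp
  qed
  then show ?thesis by (auto simp: fraction_def)
qed

lemma fraction_eq_iff:
  assumes "a \<in> carrier R" "b \<in> carrier R" "b \<noteq> \<zero>" "c \<in> carrier R" "d \<in> carrier R" "d \<noteq> \<zero>"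
  shows "fraction R a b = fraction R c d \<longleftrightarrow> a \<otimes> d = c \<otimes> b"
proof
  assume "fraction R a b = fraction R c d"
  then have "(c, d) \<in> fraction R a b" using fraction_memI assms by blast
  then show "a \<otimes> d = c \<otimes> b" by (simp add: fraction_def)
next
  assume "a \<otimes> d = c \<otimes> b"
  then show "fraction R a b = fraction R c d"
    using fraction_subset[OF assms] fraction_subset[OF assms(4-6,1-3)] by simp
qed

lemma fraction_eq_if_mem:
  assumes "(x, y) \<in> fraction R a b" "a \<in> carrier R" "b \<in> carrier R" "b \<noteq> \<zero>"
  shows "x \<in> carrier R" "y \<in> carrier R" "y \<noteq> \<zero>" "a \<otimes> y = x \<otimes> b"
  using assms by (auto simp: fraction_def)

lemma fraction_mult:
  assumes "a \<in> carrier R" "b \<in> carrier R" "b \<noteq> \<zero>" "c \<in> carrier R" "d \<in> carrier R" "d \<noteq> \<zero>"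
  shows "fraction R a b \<otimes>\<^bsub>fraction_field R\<^esub> fraction R c d = fraction R (a \<otimes> c) (b \<otimes> d)"
proof -
  have *: "fraction R (x \<otimes> z) (y \<otimes> w) = fraction R (a \<otimes> c) (b \<otimes> d)"
    if "(x, y) \<in> fraction R a b" "(z, w) \<in> fraction R c d" for x y z w
  proof -
    note 1 = fraction_eq_if_mem[OF that(1) assms(1-3)] and 2 = fraction_eq_if_mem[OF that(2) assms(4-6)]
    have "(x \<otimes> z) \<otimes> (b \<otimes> d) = (x \<otimes> b) \<otimes> (z \<otimes> d)" using assms 1(1-3) 2(1-3) by (simp add: m_ac)
    also have "\<dots> = (a \<otimes> y) \<otimes> (c \<otimes> w)" by (simp only: 1(4) 2(4))
    also have "\<dots> = (a \<otimes> c) \<otimes> (y \<otimes> w)" using assms 1(1-3) 2(1-3) by (simp add: m_ac)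
    finally show ?thesis using assms 1 2 by (subst fraction_eq_iff) (auto simp: integral_iff)
  qed
  have "(\<Union>(x, y)\<in>fraction R a b. \<Union>(z, w)\<in>fraction R c d. fraction R (x \<otimes> z) (y \<otimes> w))
     = fraction R (a \<otimes> c) (b \<otimes> d)"
    using fraction_memI[OF assms(1-3)] fraction_memI[OF assms(4-6)] * by blast
  then show ?thesis by (simp add: fraction_field_def)
qed

lemma fraction_add:
  assumes "a \<in> carrier R" "b \<in> carrier R" "b \<noteq> \<zero>" "c \<in> carrier R" "d \<in> carrier R" "d \<noteq> \<zero>"
  shows "fraction R a b \<oplus>\<^bsub>fraction_field R\<^esub> fraction R c d = fraction R (a \<otimes> d \<oplus> c \<otimes> b) (b \<otimes> d)"
proof -
  have *: "fraction R (x \<otimes> w \<oplus> z \<otimes> y) (y \<otimes> w) = fraction R (a \<otimes> d \<oplus> c \<otimes> b) (b \<otimes> d)"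
    if "(x, y) \<in> fraction R a b" "(z, w) \<in> fraction R c d" for x y z w
  proof -
    note 1 = fraction_eq_if_mem[OF that(1) assms(1-3)] and 2 = fraction_eq_if_mem[OF that(2) assms(4-6)]
    have "(x \<otimes> w \<oplus> z \<otimes> y) \<otimes> (b \<otimes> d) = (x \<otimes> b) \<otimes> (w \<otimes> d) \<oplus> (z \<otimes> d) \<otimes> (y \<otimes> b)"
      using assms 1(1-3) 2(1-3) by (simp add: m_ac l_distr r_distr)
    also have "\<dots> = (a \<otimes> y) \<otimes> (w \<otimes> d) \<oplus> (c \<otimes> w) \<otimes> (y \<otimes> b)" by (simp only: 1(4) 2(4))
    also have "\<dots> = (a \<otimes> d \<oplus> c \<otimes> b) \<otimes> (y \<otimes> w)" using assms 1(1-3) 2(1-3) by (simp add: m_ac l_distr r_distr)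
    finally show ?thesis using assms 1 2 by (subst fraction_eq_iff) (auto simp: integral_iff)
  qed
  have "(\<Union>(x, y)\<in>fraction R a b. \<Union>(z, w)\<in>fraction R c d. fraction R (x \<otimes> w \<oplus> z \<otimes> y) (y \<otimes> w))
     = fraction R (a \<otimes> d \<oplus> c \<otimes> b) (b \<otimes> d)"
    using fraction_memI[OF assms(1-3)] fraction_memI[OF assms(4-6)] * by blast
  then show ?thesis by (simp add: fraction_field_def)
qed

lemma fraction_field_carrierE:
  assumes "x \<in> carrier (fraction_field R)"
  obtains a b where "x = fraction R a b" "a \<in> carrier R" "b \<in> carrier R" "b \<noteq> \<zero>"
  using assms by (auto simp: fraction_field_def)

lemma fraction_in_carrier:
  "a \<in> carrier R \<Longrightarrow> b \<in> carrier R \<Longrightarrow> b \<noteq> \<zero> \<Longrightarrow> fraction R a b \<in> carrier (fraction_field R)"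
  by (auto simp: fraction_field_def)

lemma fraction_field_zero: "\<zero>\<^bsub>fraction_field R\<^esub> = fraction R \<zero> \<one>"
  and fraction_field_one: "\<one>\<^bsub>fraction_field R\<^esub> = fraction R \<one> \<one>"
  by (simp_all add: fraction_field_def)

lemmas fraction_simps = fraction_mult fraction_add fraction_eq_iff fraction_in_carrier
  fraction_field_zero fraction_field_one

lemma cring_fraction_field: "cring (fraction_field R)"
proof (rule cringI)
  have *: "a \<otimes> b \<noteq> \<zero>" if "a \<in> carrier R" "b \<in> carrier R" "a \<noteq> \<zero>" "b \<noteq> \<zero>" for a b
    using that integral_iff by auto
  note s = fraction_simps * l_distr r_distr
  show "abelian_group (fraction_field R)"
  proof (rule abelian_groupI)
    fix x y z
    assume x: "x \<in> carrier (fraction_field R)" and y: "y \<in> carrier (fraction_field R)"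
    obtain a b where 1: "x = fraction R a b" "a \<in> carrier R" "b \<in> carrier R" "b \<noteq> \<zero>"
      using fraction_field_carrierE[OF x] .
    obtain c d where 2: "y = fraction R c d" "c \<in> carrier R" "d \<in> carrier R" "d \<noteq> \<zero>"
      using fraction_field_carrierE[OF y] .
    show "x \<oplus>\<^bsub>fraction_field R\<^esub> y \<in> carrier (fraction_field R)" using 1 2 by (simp add: s)
    show "x \<oplus>\<^bsub>fraction_field R\<^esub> y = y \<oplus>\<^bsub>fraction_field R\<^esub> x"
      using 1 2 by (simp add: s m_ac a_ac)
    assume z: "z \<in> carrier (fraction_field R)"
    obtain e f where 3: "z = fraction R e f" "e \<in> carrier R" "f \<in> carrier R" "f \<noteq> \<zero>"
      using fraction_field_carrierE[OF z] .
    show "x \<oplus>\<^bsub>fraction_field R\<^esub> y \<oplus>\<^bsub>fraction_field R\<^esub> z = x \<oplus>\<^bsub>fraction_field R\<^esub> (y \<oplus>\<^bsub>fraction_field R\<^esub> z)"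
      using 1 2 3 by (simp add: s m_ac a_ac)
  next
    fix x assume x: "x \<in> carrier (fraction_field R)"
    obtain a b where 1: "x = fraction R a b" "a \<in> carrier R" "b \<in> carrier R" "b \<noteq> \<zero>"
      using fraction_field_carrierE[OF x] .
    show "\<zero>\<^bsub>fraction_field R\<^esub> \<oplus>\<^bsub>fraction_field R\<^esub> x = x" using 1 by (simp add: s)
    show "\<exists>y\<in>carrier (fraction_field R). y \<oplus>\<^bsub>fraction_field R\<^esub> x = \<zero>\<^bsub>fraction_field R\<^esub>"
      by (rule bexI[of _ "fraction R (\<ominus> a) b"]) (use 1 in \<open>simp_all add: s l_minus l_neg\<close>)
  qed (simp add: s)
  show "comm_monoid (fraction_field R)"
  proof (rule comm_monoidI)
    fix x y z
    assume x: "x \<in> carrier (fraction_field R)" and y: "y \<in> carrier (fraction_field R)"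
    obtain a b where 1: "x = fraction R a b" "a \<in> carrier R" "b \<in> carrier R" "b \<noteq> \<zero>"
      using fraction_field_carrierE[OF x] .
    obtain c d where 2: "y = fraction R c d" "c \<in> carrier R" "d \<in> carrier R" "d \<noteq> \<zero>"
      using fraction_field_carrierE[OF y] .
    show "x \<otimes>\<^bsub>fraction_field R\<^esub> y \<in> carrier (fraction_field R)" using 1 2 by (simp add: s)
    show "x \<otimes>\<^bsub>fraction_field R\<^esub> y = y \<otimes>\<^bsub>fraction_field R\<^esub> x"
      using 1 2 by (simp add: s m_ac)
    show "\<one>\<^bsub>fraction_field R\<^esub> \<otimes>\<^bsub>fraction_field R\<^esub> x = x" using 1 by (simp add: s)
    assume z: "z \<in> carrier (fraction_field R)"
    obtain e f where 3: "z = fraction R e f" "e \<in> carrier R" "f \<in> carrier R" "f \<noteq> \<zero>"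
      using fraction_field_carrierE[OF z] .
    show "x \<otimes>\<^bsub>fraction_field R\<^esub> y \<otimes>\<^bsub>fraction_field R\<^esub> z = x \<otimes>\<^bsub>fraction_field R\<^esub> (y \<otimes>\<^bsub>fraction_field R\<^esub> z)"
      using 1 2 3 by (simp add: s m_ac)
  qed (simp add: s)
  fix x y z
  assume x: "x \<in> carrier (fraction_field R)" and y: "y \<in> carrier (fraction_field R)"
    and z: "z \<in> carrier (fraction_field R)"
  obtain a b where 1: "x = fraction R a b" "a \<in> carrier R" "b \<in> carrier R" "b \<noteq> \<zero>"
    using fraction_field_carrierE[OF x] .
  obtain c d where 2: "y = fraction R c d" "c \<in> carrier R" "d \<in> carrier R" "d \<noteq> \<zero>"
    using fraction_field_carrierE[OF y] .
  obtain e f where 3: "z = fraction R e f" "e \<in> carrier R" "f \<in> carrier R" "f \<noteq> \<zero>"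
    using fraction_field_carrierE[OF z] .
  show "(x \<oplus>\<^bsub>fraction_field R\<^esub> y) \<otimes>\<^bsub>fraction_field R\<^esub> z =
      x \<otimes>\<^bsub>fraction_field R\<^esub> z \<oplus>\<^bsub>fraction_field R\<^esub> y \<otimes>\<^bsub>fraction_field R\<^esub> z"
    using 1 2 3 by (simp add: s m_ac)
qed

lemma fraction_pow:
  assumes "a \<in> carrier R" "b \<in> carrier R" "b \<noteq> \<zero>"
  shows "fraction R a b [^]\<^bsub>fraction_field R\<^esub> (n::nat) = fraction R (a [^] n) (b [^] n)"
proof -
  interpret K: cring "fraction_field R" by (rule cring_fraction_field)
  have "b [^] n \<noteq> \<zero>" for n :: nat using assms by (induction n) (auto simp: integral_iff)
  then show ?thesis using assms by (induction n) (simp_all add: fraction_simps)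
qed

section \<open>Integral and almost integral elements\<close>

lemma pow_nonzero: "b \<in> carrier R \<Longrightarrow> b \<noteq> \<zero> \<Longrightarrow> b [^] (n::nat) \<noteq> \<zero>"
  by (induction n) (auto simp: integral_iff)

text \<open>The coefficients lie in the ring, so a factor that clears the denominators of the powers
  of \<open>x\<close> also clears that of the polynomial value.\<close>

lemma eval_multiple_mem:
  fixes S defines "S \<equiv> (\<lambda>a. fraction R a \<one>) ` carrier R"
  assumes "set p \<subseteq> S" "x \<in> carrier (fraction_field R)" "y \<in> carrier (fraction_field R)"
    and "\<And>i. i < length p \<Longrightarrow> y \<otimes>\<^bsub>fraction_field R\<^esub> x [^]\<^bsub>fraction_field R\<^esub> i \<in> S"
  shows "y \<otimes>\<^bsub>fraction_field R\<^esub> ring.eval (fraction_field R) p x \<in> S"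
  using assms(2-5)
proof (induction p)
  interpret K: cring "fraction_field R" by (rule cring_fraction_field)
  case Nil
  have "\<zero>\<^bsub>fraction_field R\<^esub> \<in> S" by (auto simp: fraction_field_zero S_def)
  then show ?case using Nil by simp
next
  interpret K: cring "fraction_field R" by (rule cring_fraction_field)
  case (Cons u p)
  have SK: "S \<subseteq> carrier (fraction_field R)" by (auto simp: S_def fraction_in_carrier)
  have Sm: "s \<otimes>\<^bsub>fraction_field R\<^esub> t \<in> S" if "s \<in> S" "t \<in> S" for s t
    using that by (auto simp: S_def fraction_simps)
  have Sa: "s \<oplus>\<^bsub>fraction_field R\<^esub> t \<in> S" if "s \<in> S" "t \<in> S" for s t
    using that by (auto simp: S_def fraction_simps)
  have u: "u \<in> S" "u \<in> carrier (fraction_field R)" using Cons SK by auto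
  have e: "K.eval p x \<in> carrier (fraction_field R)"
    using Cons SK by (intro K.eval_in_carrier) auto
  have "y \<otimes>\<^bsub>fraction_field R\<^esub> K.eval (u # p) x
    = u \<otimes>\<^bsub>fraction_field R\<^esub> (y \<otimes>\<^bsub>fraction_field R\<^esub> x [^]\<^bsub>fraction_field R\<^esub> length p)
      \<oplus>\<^bsub>fraction_field R\<^esub> y \<otimes>\<^bsub>fraction_field R\<^esub> K.eval p x"
    using Cons.prems u e by (simp add: K.r_distr K.m_ac)
  also have "\<dots> \<in> S"
    using Cons.prems u Cons.IH by (intro Sa Sm[OF u(1)]) auto
  finally show ?case .
qed

text \<open>Integral elements are almost integral: if \<open>x = a / b\<close> satisfies a monic equation of degree
  \<open>m\<close>, then \<open>b\<^sup>m x\<^sup>k\<close> lies in the ring for all \<open>k\<close>.\<close>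

lemma integral_over_almost_integral:
  assumes "integral_over (fraction_field R) ((\<lambda>a. fraction R a \<one>) ` carrier R) (fraction R a b)"
    and ab: "a \<in> carrier R" "b \<in> carrier R" "b \<noteq> \<zero>"
  obtains d where "d \<in> carrier R" "d \<noteq> \<zero>"
    "\<And>k::nat. \<exists>c\<in>carrier R. d \<otimes> a [^] k = c \<otimes> b [^] k"
proof -
  interpret K: cring "fraction_field R" by (rule cring_fraction_field)
  define S where "S = (\<lambda>a. fraction R a \<one>) ` carrier R"
  define x where "x = fraction R a b"
  have xK: "x \<in> carrier (fraction_field R)" using ab by (simp add: x_def fraction_in_carrier)
  from assms(1) obtain p0 where p0: "p0 \<noteq> []" "polynomial\<^bsub>fraction_field R\<^esub> S p0"
    "hd p0 = \<one>\<^bsub>fraction_field R\<^esub>" "ring.eval (fraction_field R) p0 x = \<zero>\<^bsub>fraction_field R\<^esub>"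
    by (auto simp: integral_over_def S_def x_def)
  \<comment> \<open>Coefficient lists begin with the leading coefficient, so \<open>p\<close> holds
    the terms below the leading one and its length is the degree of the equation.\<close>
  then obtain p where p: "p0 = \<one>\<^bsub>fraction_field R\<^esub> # p" by (cases p0) auto
  have pS: "set p \<subseteq> S" using p0 p by (auto simp: polynomial_def)
  have SK: "S \<subseteq> carrier (fraction_field R)" by (auto simp: S_def fraction_in_carrier)
  have eK: "K.eval p x \<in> carrier (fraction_field R)"
    using pS SK xK by (intro K.eval_in_carrier) auto
  define m where "m = length p"
  define y where "y = fraction R (b [^] m) \<one>"
  have bn: "b [^] k \<in> carrier R" "b [^] k \<noteq> \<zero>" for k :: nat using ab pow_nonzero by auto
  have yK: "y \<in> carrier (fraction_field R)" using bn by (simp add: y_def fraction_in_carrier)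
  have eq0: "x [^]\<^bsub>fraction_field R\<^esub> m \<oplus>\<^bsub>fraction_field R\<^esub> K.eval p x = \<zero>\<^bsub>fraction_field R\<^esub>"
    using p0(4) xK by (simp add: p m_def)
  have Sneg: "s \<in> S" if "s \<in> carrier (fraction_field R)" "t \<in> S" "s \<oplus>\<^bsub>fraction_field R\<^esub> t = \<zero>\<^bsub>fraction_field R\<^esub>" for s t
  proof -
    from that obtain c where c: "c \<in> carrier R" "t = fraction R c \<one>" by (auto simp: S_def)
    have "t \<oplus>\<^bsub>fraction_field R\<^esub> fraction R (\<ominus> c) \<one> = \<zero>\<^bsub>fraction_field R\<^esub>"
      using c by (simp add: fraction_simps r_neg)
    moreover have cK: "fraction R (\<ominus> c) \<one> \<in> carrier (fraction_field R)" "t \<in> carrier (fraction_field R)"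
      using c by (simp_all add: fraction_in_carrier)
    ultimately have "s = s \<oplus>\<^bsub>fraction_field R\<^esub> (t \<oplus>\<^bsub>fraction_field R\<^esub> fraction R (\<ominus> c) \<one>)"
      using that(1) by simp
    also have "\<dots> = fraction R (\<ominus> c) \<one>"
      using that(1) cK by (simp add: K.a_assoc[symmetric] that(3))
    finally have "s = fraction R (\<ominus> c) \<one>" .
    then show ?thesis using c by (auto simp: S_def)
  qed
  have main: "y \<otimes>\<^bsub>fraction_field R\<^esub> x [^]\<^bsub>fraction_field R\<^esub> k \<in> S" for k :: nat
  proof (induction k rule: less_induct)
    case (less k)
    show ?case
    proof (cases "k < m")
      case True
      then obtain j where j: "m = k + j" by (metis less_imp_add_positive)
      have "y \<otimes>\<^bsub>fraction_field R\<^esub> x [^]\<^bsub>fraction_field R\<^esub> k = fraction R (b [^] j \<otimes> a [^] k) \<one>"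
        using ab bn by (simp add: y_def x_def fraction_pow fraction_simps j nat_pow_mult[symmetric] m_ac)
      then show ?thesis using ab bn by (auto simp: S_def)
    next
      case False
      \<comment> \<open>The equation turns the factor \<open>x^m\<close> of \<open>x^k\<close> into
        minus the value of \<open>p\<close>, so only the powers \<open>x^(j + i)\<close> with
        \<open>i < m\<close> arise, all of them below \<open>x^k\<close>.\<close>
      then obtain j where j: "k = m + j" by (metis le_iff_add not_less)
      let ?z = "y \<otimes>\<^bsub>fraction_field R\<^esub> x [^]\<^bsub>fraction_field R\<^esub> j"
      have zK: "?z \<in> carrier (fraction_field R)" using yK xK by simp
      have "?z \<otimes>\<^bsub>fraction_field R\<^esub> K.eval p x \<in> S"
        unfolding S_def
      proof (rule eval_multiple_mem)
        fix i assume i: "i < length p"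
        have "?z \<otimes>\<^bsub>fraction_field R\<^esub> x [^]\<^bsub>fraction_field R\<^esub> i = y \<otimes>\<^bsub>fraction_field R\<^esub> x [^]\<^bsub>fraction_field R\<^esub> (j + i)"
          using yK xK by (simp add: K.nat_pow_mult[symmetric] K.m_ac)
        then show "?z \<otimes>\<^bsub>fraction_field R\<^esub> x [^]\<^bsub>fraction_field R\<^esub> i \<in> (\<lambda>a. fraction R a \<one>) ` carrier R"
          using less.IH[of "j + i"] i j by (simp add: m_def S_def)
      qed (use pS xK zK in \<open>auto simp: S_def\<close>)
      moreover have "y \<otimes>\<^bsub>fraction_field R\<^esub> x [^]\<^bsub>fraction_field R\<^esub> k \<oplus>\<^bsub>fraction_field R\<^esub> ?z \<otimes>\<^bsub>fraction_field R\<^esub> K.eval p x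
        = ?z \<otimes>\<^bsub>fraction_field R\<^esub> (x [^]\<^bsub>fraction_field R\<^esub> m \<oplus>\<^bsub>fraction_field R\<^esub> K.eval p x)"
        using yK xK eK by (simp add: j K.nat_pow_mult[symmetric] K.m_ac K.r_distr)
      moreover have "y \<otimes>\<^bsub>fraction_field R\<^esub> x [^]\<^bsub>fraction_field R\<^esub> k \<in> carrier (fraction_field R)"
        using yK xK by simp
      ultimately show ?thesis by (rule_tac Sneg) (simp_all add: eq0 zK)
    qed
  qed
  show thesis
  proof (rule that)
    show "b [^] m \<in> carrier R" "b [^] m \<noteq> \<zero>" using bn by auto
    fix k :: nat
    from main[of k] obtain c where "c \<in> carrier R" "y \<otimes>\<^bsub>fraction_field R\<^esub> x [^]\<^bsub>fraction_field R\<^esub> k = fraction R c \<one>"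
      by (auto simp: S_def)
    then have "c \<in> carrier R" "b [^] m \<otimes> a [^] k = c \<otimes> b [^] k"
      using ab bn by (simp_all add: y_def x_def fraction_pow fraction_simps)
    then show "\<exists>c\<in>carrier R. b [^] m \<otimes> a [^] k = c \<otimes> b [^] k" by blast
  qed
qed

text \<open>Leaves the field of fractions behind: almost integrality of \<open>a / b\<close> and
  membership of \<open>a / b\<close> in the ring are both expressed by products in the ring, which
  is the form that division by leading monomials can handle.\<close>

lemma normal_domain_if_completely_integrally_closed:
  assumes "\<And>a b d. a \<in> carrier R \<Longrightarrow> b \<in> carrier R \<Longrightarrow> d \<in> carrier R \<Longrightarrow> b \<noteq> \<zero> \<Longrightarrow> d \<noteq> \<zero> \<Longrightarrow>
    (\<And>k::nat. \<exists>c\<in>carrier R. d \<otimes> a [^] k = c \<otimes> b [^] k) \<Longrightarrow> \<exists>c\<in>carrier R. a = c \<otimes> b"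
  shows "normal_domain R"
  unfolding normal_domain_def Let_def
proof (intro conjI ballI impI)
  show "domain R" by (rule domain_axioms)
  fix x assume x: "x \<in> carrier (fraction_field R)"
    and int: "integral_over (fraction_field R) ((\<lambda>a. fraction R a \<one>) ` carrier R) x"
  obtain a b where ab: "x = fraction R a b" "a \<in> carrier R" "b \<in> carrier R" "b \<noteq> \<zero>"
    using fraction_field_carrierE[OF x] .
  obtain d where "d \<in> carrier R" "d \<noteq> \<zero>"
    "\<And>k::nat. \<exists>c\<in>carrier R. d \<otimes> a [^] k = c \<otimes> b [^] k"
    using integral_over_almost_integral int ab by metis
  then obtain c where "c \<in> carrier R" "a = c \<otimes> b"
    using assms[of a b d] ab by blast
  then have "x = fraction R c \<one>" using ab by (simp add: fraction_eq_iff)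
  then show "x \<in> (\<lambda>a. fraction R a \<one>) ` carrier R" using \<open>c \<in> carrier R\<close> by blast
qed

end

section \<open>Monoid algebras\<close>

abbreviation keys where "keys \<equiv> Poly_Mapping.keys"
abbreviation lookup where "lookup \<equiv> Poly_Mapping.lookup"

text \<open>The values lie in an arbitrary commutative monoid because monomials are evaluated both
  at complex points and at polynomials, the latter for substitution.\<close>

definition mono_eval :: "('v \<Rightarrow> 'r::comm_monoid_mult) \<Rightarrow> ('v \<Rightarrow>\<^sub>0 nat) \<Rightarrow> 'r" where
  "mono_eval x m = (\<Prod>v\<in>keys m. x v ^ lookup m v)"

lemma mono_eval_superset:
  "finite V \<Longrightarrow> keys m \<subseteq> V \<Longrightarrow> mono_eval x m = (\<Prod>v\<in>V. x v ^ lookup m v)"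
  unfolding mono_eval_def by (rule prod.mono_neutral_left) (auto simp: in_keys_iff)

lemma mono_eval_UNIV: "mono_eval x (m :: 'v::finite \<Rightarrow>\<^sub>0 nat) = (\<Prod>v\<in>UNIV. x v ^ lookup m v)"
  by (rule mono_eval_superset) auto

lemma mono_eval_0 [simp]: "mono_eval x 0 = 1"
  by (simp add: mono_eval_def)

lemma mono_eval_add: "mono_eval x (m + m') = mono_eval x m * mono_eval x m'"
proof -
  let ?V = "keys m \<union> keys m'"
  have "mono_eval x (m + m') = (\<Prod>v\<in>?V. x v ^ lookup (m + m') v)"
    using keys_add[of m m'] by (intro mono_eval_superset) auto
  then show ?thesis
    by (simp add: lookup_add power_add prod.distrib mono_eval_superset[of ?V])
qed

lemma mono_eval_single [simp]: "mono_eval x (Poly_Mapping.single v k) = x v ^ k"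
  by (cases "k = 0") (simp_all add: mono_eval_def)

text \<open>A ring homomorphism out of a monoid algebra is given by a ring homomorphism \<open>\<kappa>\<close> on the
  coefficients and a monoid homomorphism \<open>E\<close> on the exponents.\<close>

locale monoid_algebra_hom =
  fixes \<kappa> :: "'c::comm_ring_1 \<Rightarrow> 'r::comm_ring_1" and E :: "'k::comm_monoid_add \<Rightarrow> 'r"
  assumes kappa: "\<kappa> 0 = 0" "\<kappa> 1 = 1" "\<kappa> (a + b) = \<kappa> a + \<kappa> b" "\<kappa> (a * b) = \<kappa> a * \<kappa> b"
    and E: "E 0 = 1" "E (m + m') = E m * E m'"
begin

definition hom :: "('k \<Rightarrow>\<^sub>0 'c) \<Rightarrow> 'r" where
  "hom p = (\<Sum>m\<in>keys p. \<kappa> (lookup p m) * E m)"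

lemma hom_superset:
  "finite M \<Longrightarrow> keys p \<subseteq> M \<Longrightarrow> hom p = (\<Sum>m\<in>M. \<kappa> (lookup p m) * E m)"
  unfolding hom_def by (rule sum.mono_neutral_left) (auto simp: in_keys_iff kappa)

lemma hom_0 [simp]: "hom 0 = 0"
  by (simp add: hom_def)

lemma hom_single [simp]: "hom (Poly_Mapping.single m c) = \<kappa> c * E m"
  by (cases "c = 0") (simp_all add: hom_def kappa)

lemma hom_1 [simp]: "hom 1 = 1"
  using hom_single[of 0 1] by (simp add: E kappa)

lemma hom_add [simp]: "hom (p + q) = hom p + hom q"
proof -
  let ?M = "keys p \<union> keys q"
  have "hom (p + q) = (\<Sum>m\<in>?M. \<kappa> (lookup (p + q) m) * E m)"
    using keys_add[of p q] by (intro hom_superset) auto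
  then show ?thesis
    by (simp add: lookup_add kappa distrib_right sum.distrib hom_superset[of ?M])
qed

lemma hom_sum [simp]: "hom (\<Sum>i\<in>I. p i) = (\<Sum>i\<in>I. hom (p i))"
  by (induction I rule: infinite_finite_induct) auto

lemma sum_monomials: "(\<Sum>m\<in>keys p. Poly_Mapping.single m (lookup p m)) = p"
  by (rule poly_mapping_eqI)
    (simp add: lookup_sum lookup_single when_def in_keys_iff if_distrib cong: if_cong)

lemma hom_mult [simp]: "hom (p * q) = hom p * hom q"
proof -
  have "p * q = (\<Sum>m\<in>keys p. Poly_Mapping.single m (lookup p m)) * (\<Sum>m\<in>keys q. Poly_Mapping.single m (lookup q m))"
    by (simp only: sum_monomials)
  also have "hom \<dots> = hom p * hom q"
    unfolding hom_def[of p] hom_def[of q] by (simp add: sum_product mult_single kappa E mult_ac)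
  finally show ?thesis .
qed

lemma hom_uminus [simp]: "hom (- p) = - hom p"
  using hom_add[of p "- p"] by (simp add: add_eq_0_iff)

lemma hom_diff [simp]: "hom (p - q) = hom p - hom q"
  using hom_add[of p "- q"] by simp

lemma hom_prod [simp]: "hom (\<Prod>i\<in>I. p i) = (\<Prod>i\<in>I. hom (p i))"
  by (induction I rule: infinite_finite_induct) auto

lemma hom_power [simp]: "hom (p ^ n) = hom p ^ n"
  by (induction n) auto

end

section \<open>Evaluation and substitution of complex polynomials\<close>

interpretation peval: monoid_algebra_hom "\<lambda>c :: complex. c" "mono_eval x"
  rewrites "monoid_algebra_hom.hom (\<lambda>c. c) (mono_eval x) = (\<lambda>p. peval p x)"
  for x :: "'v \<Rightarrow> complex"
proof -
  show *: "monoid_algebra_hom (\<lambda>c :: complex. c) (mono_eval x)"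
    by unfold_locales (auto simp: mono_eval_add)
  show "monoid_algebra_hom.hom (\<lambda>c. c) (mono_eval x) = (\<lambda>p. peval p x)"
    by (intro ext) (simp add: monoid_algebra_hom.hom_def[OF *] peval_def mono_eval_def)
qed

lemma peval_eq_sum: "peval p x = (\<Sum>m\<in>keys p. lookup p m * mono_eval x m)"
  by (simp add: peval_def mono_eval_def)

abbreviation pvar :: "'v \<Rightarrow> 'v cpoly" where
  "pvar v \<equiv> Poly_Mapping.single (Poly_Mapping.single v 1) 1"

abbreviation pconst :: "complex \<Rightarrow> 'v cpoly" where
  "pconst c \<equiv> Poly_Mapping.single 0 c"

interpretation msubst: monoid_algebra_hom "pconst :: complex \<Rightarrow> 'w cpoly" "mono_eval y"
  for y :: "'v \<Rightarrow> 'w cpoly"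
  by unfold_locales (auto simp: mono_eval_add single_add mult_single)

abbreviation msubst :: "('v \<Rightarrow> 'w cpoly) \<Rightarrow> 'v cpoly \<Rightarrow> 'w cpoly" where
  "msubst y \<equiv> monoid_algebra_hom.hom pconst (mono_eval y)"

lemma peval_mono_eval: "peval (mono_eval y m) x = mono_eval (\<lambda>v. peval (y v) x) m"
  by (simp add: mono_eval_def)

lemma peval_msubst: "peval (msubst y p) x = peval p (\<lambda>v. peval (y v) x)"
  by (simp add: msubst.hom_def peval_eq_sum[of p] peval_mono_eval)

text \<open>Dedekind's argument: translating a relation by \<open>s\<close> and subtracting
  \<open>\<xi> k s\<close> times the original eliminates the character \<open>k\<close>. The shorter
  relation has coefficients \<open>a i * (\<xi> i s - \<xi> k s)\<close>, and a suitable
  \<open>s\<close> makes the second factor nonzero.\<close>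

lemma independence_of_characters:
  fixes \<xi> :: "'i \<Rightarrow> 'g \<Rightarrow> 'f::field"
  assumes "finite I"
    and "\<And>i s t. i \<in> I \<Longrightarrow> s \<in> G \<Longrightarrow> t \<in> G \<Longrightarrow> \<xi> i (tm s t) = \<xi> i s * \<xi> i t"
    and "\<And>s t. s \<in> G \<Longrightarrow> t \<in> G \<Longrightarrow> tm s t \<in> G"
    and "\<And>i. i \<in> I \<Longrightarrow> \<exists>t\<in>G. \<xi> i t \<noteq> 0"
    and "\<And>i j. i \<in> I \<Longrightarrow> j \<in> I \<Longrightarrow> i \<noteq> j \<Longrightarrow> \<exists>t\<in>G. \<xi> i t \<noteq> \<xi> j t"
    and "\<And>t. t \<in> G \<Longrightarrow> (\<Sum>i\<in>I. a i * \<xi> i t) = 0"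
  shows "\<forall>i\<in>I. a i = 0"
  using assms
proof (induction I arbitrary: a rule: finite_induct)
  case empty
  then show ?case by simp
next
  case (insert k I)
  have *: "\<forall>i\<in>I. a i * (\<xi> i s - \<xi> k s) = 0" if s: "s \<in> G" for s
  proof (rule insert.IH)
    fix t assume t: "t \<in> G"
    have "(\<Sum>i\<in>I. a i * (\<xi> i s - \<xi> k s) * \<xi> i t)
      = (\<Sum>i\<in>insert k I. a i * (\<xi> i s - \<xi> k s) * \<xi> i t)"
      using insert.hyps by simp
    also have "\<dots> = (\<Sum>i\<in>insert k I. a i * \<xi> i (tm s t)) - \<xi> k s * (\<Sum>i\<in>insert k I. a i * \<xi> i t)"
      by (simp add: sum_distrib_left sum_subtractf[symmetric] insert.prems(1) s t algebra_simps
          del: sum.insert cong: sum.cong_simp)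
    also have "\<dots> = 0" using insert.prems(5) insert.prems(2)[OF s t] t by simp
    finally show "(\<Sum>i\<in>I. a i * (\<xi> i s - \<xi> k s) * \<xi> i t) = 0" .
  qed (use insert.prems in auto)
  have I0: "a i = 0" if i: "i \<in> I" for i
  proof -
    obtain s where "s \<in> G" "\<xi> i s \<noteq> \<xi> k s" using insert.prems(4)[of i k] insert.hyps i by auto
    then show ?thesis using * i by auto
  qed
  obtain t where "t \<in> G" "\<xi> k t \<noteq> 0" using insert.prems(3) by auto
  then have "a k = 0" using insert.prems(5)[of t] insert.hyps I0 by simp
  then show ?case using I0 by auto
qed

text \<open>Monomials are pairwise distinct characters of the torus of points without zero entries:
  a point with one entry 2 and all others 1 separates two of them.\<close>

lemma peval_eq_0_imp_eq_0:
  fixes p :: "'v::finite cpoly"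
  assumes "\<And>t. (\<And>v. t v \<noteq> 0) \<Longrightarrow> peval p t = 0"
  shows "p = 0"
proof -
  have "\<forall>m\<in>keys p. lookup p m = 0"
  proof (rule independence_of_characters[where I = "keys p" and a = "lookup p" and G = "{t. \<forall>v. t v \<noteq> 0}" and
        tm = "\<lambda>s t v. s v * t v" and \<xi> = "\<lambda>m t. mono_eval t m"])
    fix m m' :: "'v \<Rightarrow>\<^sub>0 nat" assume "m \<noteq> m'"
    then obtain v where v: "lookup m v \<noteq> lookup m' v" using poly_mapping_eqI[of m m'] by metis
    let ?t = "\<lambda>w. if w = v then 2 else 1 :: complex"
    have e: "mono_eval ?t n = 2 ^ lookup n v" for n :: "'v \<Rightarrow>\<^sub>0 nat"
      unfolding mono_eval_UNIV by (subst prod.remove[of _ v]) auto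
    have "(2::complex) ^ lookup m v \<noteq> 2 ^ lookup m' v"
    proof
      assume "(2::complex) ^ lookup m v = 2 ^ lookup m' v"
      then have "norm ((2::complex) ^ lookup m v) = norm ((2::complex) ^ lookup m' v)" by simp
      then show False using v by (simp add: norm_power)
    qed
    then show "\<exists>t\<in>{t. \<forall>v. t v \<noteq> 0}. mono_eval t m \<noteq> (mono_eval t m' :: complex)"
      by (intro bexI[of _ ?t]) (auto simp: e)
  next
    fix m :: "'v \<Rightarrow>\<^sub>0 nat"
    show "\<exists>t\<in>{t. \<forall>v. t v \<noteq> 0}. mono_eval t m \<noteq> (0 :: complex)"
      by (intro bexI[of _ "\<lambda>_. 1"]) (auto simp: mono_eval_UNIV)
  next
    fix t :: "'v \<Rightarrow> complex" assume "t \<in> {t. \<forall>v. t v \<noteq> 0}"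
    then show "(\<Sum>m\<in>keys p. lookup p m * mono_eval t m) = 0"
      using assms[of t] by (simp add: peval_eq_sum)
  qed (simp_all add: mono_eval_UNIV power_mult_distrib prod.distrib)
  then show ?thesis by (intro poly_mapping_eqI) (metis in_keys_iff lookup_zero)
qed

text \<open>The order compares exponents at the smallest variable where they differ. Listing the
  finitely many variables in increasing order embeds it into the lexicographic order on lists of one
  fixed length, which is well-founded.\<close>

lemma wf_lex_monomials: "wf {(m, m' :: 'v::{finite,linorder} \<Rightarrow>\<^sub>0 nat). m < m'}"
proof -
  define xs where "xs = sorted_list_of_set (UNIV :: 'v set)"
  have xs: "sorted xs" "distinct xs" "set xs = UNIV" by (simp_all add: xs_def)
  have "(map (lookup m) xs, map (lookup m') xs) \<in> lexn less_than (length xs)" if "m < m'" for m m' :: "'v \<Rightarrow>\<^sub>0 nat"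
  proof -
    from that obtain k where k: "lookup m k < lookup m' k" "\<And>k'. k' < k \<Longrightarrow> lookup m k' = lookup m' k'"
      by (auto simp: less_poly_mapping.rep_eq less_fun_def)
    obtain ys zs where s: "xs = ys @ k # zs" using xs(3) split_list[of k xs] by auto
    have "y < k" if "y \<in> set ys" for y
      using xs(1,2) that unfolding s by (auto simp: sorted_append order_less_le)
    then have "map (lookup m) ys = map (lookup m') ys" using k(2) by auto
    then have "\<exists>xys x y xs' ys'. map (lookup m) xs = xys @ x # xs' \<and> map (lookup m') xs = xys @ y # ys' \<and> (x, y) \<in> less_than"
      using k(1) s by (intro exI[of _ "map (lookup m') ys"] exI[of _ "lookup m k"] exI[of _ "lookup m' k"]
          exI[of _ "map (lookup m) zs"] exI[of _ "map (lookup m') zs"]) simp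
    then show ?thesis by (simp add: lexn_conv)
  qed
  then show ?thesis
    by (intro wf_if_convertible_to_wf[OF wf_lexn[OF wf_less_than, of "length xs"], where f = "\<lambda>m. map (lookup m) xs"]) auto
qed

section \<open>Leading monomials\<close>

definition lead_mono :: "'v::{finite,linorder} cpoly \<Rightarrow> 'v \<Rightarrow>\<^sub>0 nat" where
  "lead_mono p = Max (keys p)"

lemma lead_mono_in: "p \<noteq> 0 \<Longrightarrow> lead_mono p \<in> keys p"
  unfolding lead_mono_def by (rule Max_in) auto

lemma lead_mono_ge: "m \<in> keys p \<Longrightarrow> m \<le> lead_mono p"
  unfolding lead_mono_def by (rule Max_ge) auto

lemma lead_mono_eqI: "m \<in> keys p \<Longrightarrow> (\<And>m'. m' \<in> keys p \<Longrightarrow> m' \<le> m) \<Longrightarrow> lead_mono p = m"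
  unfolding lead_mono_def by (rule Max_eqI) auto

text \<open>The order is compatible with addition, so no other pair of monomials adds up to the sum
  of the leading ones, and the coefficient there is a product of two nonzero numbers.\<close>

lemma lead_mono_mult:
  assumes "p \<noteq> 0" "q \<noteq> 0"
  shows "lead_mono (p * q) = lead_mono p + lead_mono q"
proof (rule lead_mono_eqI)
  let ?M = "lead_mono p" and ?N = "lead_mono q"
  have k: "m \<le> ?M + ?N" if "m \<in> keys (p * q)" for m
    using that keys_mult[of p q] by (auto intro!: add_mono lead_mono_ge)
  then show "m \<in> keys (p * q) \<Longrightarrow> m \<le> ?M + ?N" for m .
  define p' where "p' = p - Poly_Mapping.single ?M (lookup p ?M)"
  define q' where "q' = q - Poly_Mapping.single ?N (lookup q ?N)"
  have p': "m < ?M" if "m \<in> keys p'" for m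
  proof -
    have "m \<noteq> ?M" "m \<in> keys p"
      using that by (auto simp: p'_def in_keys_iff lookup_minus lookup_single when_def split: if_splits)
    then show ?thesis using lead_mono_ge by (simp add: order_less_le)
  qed
  have q': "m < ?N" if "m \<in> keys q'" for m
  proof -
    have "m \<noteq> ?N" "m \<in> keys q"
      using that by (auto simp: q'_def in_keys_iff lookup_minus lookup_single when_def split: if_splits)
    then show ?thesis using lead_mono_ge by (simp add: order_less_le)
  qed
  have "p * q = (Poly_Mapping.single ?M (lookup p ?M) + p') * q"
    by (simp add: p'_def)
  also have "\<dots> = Poly_Mapping.single ?M (lookup p ?M) * (Poly_Mapping.single ?N (lookup q ?N) + q') + p' * q"
    unfolding distrib_right by (simp add: q'_def)
  also have "\<dots> = Poly_Mapping.single (?M + ?N) (lookup p ?M * lookup q ?N)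
    + (p' * q + Poly_Mapping.single ?M (lookup p ?M) * q')"
    by (simp only: distrib_left mult_single add_ac)
  finally have "p * q = Poly_Mapping.single (?M + ?N) (lookup p ?M * lookup q ?N)
    + (p' * q + Poly_Mapping.single ?M (lookup p ?M) * q')" .
  moreover have "?M + ?N \<notin> keys (p' * q)"
  proof
    assume "?M + ?N \<in> keys (p' * q)"
    then obtain m n where "m \<in> keys p'" "n \<in> keys q" "?M + ?N = m + n"
      using keys_mult[of p' q] by blast
    then show False using add_less_le_mono[OF p'[of m] lead_mono_ge[of n q]] by simp
  qed
  moreover have "?M + ?N \<notin> keys (Poly_Mapping.single ?M (lookup p ?M) * q')"
  proof
    assume "?M + ?N \<in> keys (Poly_Mapping.single ?M (lookup p ?M) * q')"
    then obtain m n where "m \<in> keys (Poly_Mapping.single ?M (lookup p ?M))" "n \<in> keys q'" "?M + ?N = m + n"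
      using keys_mult[of "Poly_Mapping.single ?M (lookup p ?M)" q'] by blast
    then show False using q'[of n] by (auto split: if_splits)
  qed
  ultimately have "lookup (p * q) (?M + ?N) = lookup p ?M * lookup q ?N"
    by (simp add: lookup_add in_keys_iff)
  then show "?M + ?N \<in> keys (p * q)"
    using lead_mono_in[OF assms(1)] lead_mono_in[OF assms(2)] by (simp add: in_keys_iff)
qed

lemma lead_mono_power: "p \<noteq> 0 \<Longrightarrow> lead_mono (p ^ k) = (\<Sum>i<k. lead_mono p)"
proof (induction k)
  case 0
  then show ?case by (intro lead_mono_eqI) auto
qed (simp add: lead_mono_mult add.commute)

text \<open>The last axiom is complete integral closedness written without differences: the
  equations say that \<open>\<alpha> - \<beta>\<close> is almost integral over \<open>S\<close>, and
  the conclusion that it lies in \<open>S\<close>. Constant sums stand for multiples.\<close>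

locale saturated_monoid =
  fixes S :: "('v::{finite,linorder} \<Rightarrow>\<^sub>0 nat) set"
  assumes zero: "0 \<in> S" and add: "\<alpha> \<in> S \<Longrightarrow> \<beta> \<in> S \<Longrightarrow> \<alpha> + \<beta> \<in> S"
    and saturated: "\<alpha> \<in> S \<Longrightarrow> \<beta> \<in> S \<Longrightarrow> \<epsilon> \<in> S \<Longrightarrow>
      (\<And>k. \<exists>\<sigma>\<in>S. \<epsilon> + (\<Sum>i<k::nat. \<alpha>) = \<sigma> + (\<Sum>i<k. \<beta>)) \<Longrightarrow> \<exists>\<sigma>\<in>S. \<alpha> = \<sigma> + \<beta>"
begin

definition A :: "'v cpoly set" where "A = {p. keys p \<subseteq> S}"

lemma A_add: "p \<in> A \<Longrightarrow> q \<in> A \<Longrightarrow> p + q \<in> A"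
  using keys_add[of p q] by (auto simp: A_def)

lemma A_uminus: "p \<in> A \<Longrightarrow> - p \<in> A"
  by (auto simp: A_def in_keys_iff)

lemma A_mult: "p \<in> A \<Longrightarrow> q \<in> A \<Longrightarrow> p * q \<in> A"
  using keys_mult[of p q] by (force simp: A_def intro: add)

lemma A_single: "m \<in> S \<Longrightarrow> Poly_Mapping.single m c \<in> A"
  by (auto simp: A_def)

lemma A_of_nat: "of_nat n \<in> A"
  using A_single[OF zero, of "of_nat n"] by simp

lemma A_power: "p \<in> A \<Longrightarrow> p ^ n \<in> A"
  by (induction n) (use A_of_nat[of 1] in \<open>auto intro: A_mult\<close>)

lemma A_sum: "(\<And>i. i \<in> I \<Longrightarrow> p i \<in> A) \<Longrightarrow> (\<Sum>i\<in>I. p i) \<in> A"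
  by (induction I rule: infinite_finite_induct) (use A_of_nat[of 0] in \<open>auto intro: A_add\<close>)

text \<open>Almost integrality of \<open>a / b\<close> passes to leading monomials, and it is preserved when a term of
  the quotient is split off. So division by \<open>b\<close> with respect to the leading monomials succeeds.\<close>

lemma completely_integrally_closed:
  assumes "a \<in> A" "b \<in> A" "d \<in> A" "b \<noteq> 0" "d \<noteq> 0"
    and "\<And>k::nat. \<exists>c\<in>A. d * a ^ k = c * b ^ k"
  shows "\<exists>c\<in>A. a = c * b"
  using assms(1,6)
proof (induction "lead_mono a" arbitrary: a rule: wf_induct_rule[OF wf_lex_monomials])
  case (1 a)
  show ?case
  proof (cases "a = 0")
    case True
    then show ?thesis using A_of_nat[of 0] by (intro bexI[of _ 0]) auto
  next
    case False
    have "\<exists>\<sigma>\<in>S. lead_mono a = \<sigma> + lead_mono b"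
    proof (rule saturated)
      show "lead_mono a \<in> S" "lead_mono b \<in> S" "lead_mono d \<in> S"
        using lead_mono_in[OF False] lead_mono_in[OF assms(4)] lead_mono_in[OF assms(5)] 1(2) assms
        by (auto simp: A_def)
      fix k
      obtain c where c: "c \<in> A" "d * a ^ k = c * b ^ k" using 1(3) by blast
      have "c \<noteq> 0" using c(2) assms(5) False by auto
      then have "lead_mono d + (\<Sum>i<k. lead_mono a) = lead_mono c + (\<Sum>i<k. lead_mono b)"
        using arg_cong[OF c(2), of lead_mono] False assms(4,5)
        by (simp add: lead_mono_mult lead_mono_power del: sum_constant)
      moreover have "lead_mono c \<in> S" using lead_mono_in[OF \<open>c \<noteq> 0\<close>] c(1) by (auto simp: A_def)
      ultimately show "\<exists>\<sigma>\<in>S. lead_mono d + (\<Sum>i<k. lead_mono a) = \<sigma> + (\<Sum>i<k. lead_mono b)"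
        by blast
    qed
    then obtain \<sigma> where \<sigma>: "\<sigma> \<in> S" "lead_mono a = \<sigma> + lead_mono b" by blast
    define q where "q = Poly_Mapping.single \<sigma> (lookup a (lead_mono a) / lookup b (lead_mono b))"
    define a' where "a' = a - q * b"
    have qA: "q \<in> A" using \<sigma> by (auto simp: q_def intro: A_single)
    then have a'A: "a' \<in> A"
      using 1(2) assms(2) A_add[OF _ A_uminus[OF A_mult]] by (simp add: a'_def diff_conv_add_uminus del: add_uminus_conv_diff)
    have lb: "lookup b (lead_mono b) \<noteq> 0" using lead_mono_in[OF assms(4)] by (simp add: in_keys_iff)
    have la: "lookup a (lead_mono a) \<noteq> 0" using lead_mono_in[OF False] by (simp add: in_keys_iff)
    have q0: "q \<noteq> 0" "lead_mono q = \<sigma>"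
      using la lb by (auto simp: q_def intro!: lead_mono_eqI dest: arg_cong[of _ 0 "\<lambda>p. lookup p \<sigma>"])
    have lqb: "lead_mono (q * b) = lead_mono a" using q0 assms(4) \<sigma> by (simp add: lead_mono_mult)
    have "lookup (q * b) (lead_mono a) = lookup a (lead_mono a)"
    proof -
      have "q * b = Poly_Mapping.single (lead_mono a) (lookup a (lead_mono a)) + q * (b - Poly_Mapping.single (lead_mono b) (lookup b (lead_mono b)))"
      proof -
        have "q * Poly_Mapping.single (lead_mono b) (lookup b (lead_mono b)) = Poly_Mapping.single (lead_mono a) (lookup a (lead_mono a))"
          using lb by (simp add: q_def mult_single \<sigma>(2))
        moreover have "q * b = q * (S + (b - S))" for S by simp
        ultimately show ?thesis by (metis distrib_left)
      qed
      moreover have "lead_mono a \<notin> keys (q * (b - Poly_Mapping.single (lead_mono b) (lookup b (lead_mono b))))"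
      proof
        assume "lead_mono a \<in> keys (q * (b - Poly_Mapping.single (lead_mono b) (lookup b (lead_mono b))))"
        then obtain m where "m \<in> keys (b - Poly_Mapping.single (lead_mono b) (lookup b (lead_mono b)))"
          "lead_mono a = \<sigma> + m"
          using keys_mult[of q "b - Poly_Mapping.single (lead_mono b) (lookup b (lead_mono b))"]
          by (auto simp: q_def split: if_splits)
        then show False using \<sigma>(2) by (auto simp: in_keys_iff lookup_minus)
      qed
      ultimately show ?thesis by (simp add: lookup_add in_keys_iff)
    qed
    then have nk: "lead_mono a \<notin> keys a'" by (simp add: a'_def in_keys_iff lookup_minus)
    have le: "m \<le> lead_mono a" if "m \<in> keys a'" for m
    proof -
      have "m \<in> keys a \<or> m \<in> keys (q * b)"
        using that by (auto simp: a'_def in_keys_iff lookup_minus)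
      then show ?thesis using lead_mono_ge[of m a] lead_mono_ge[of m "q * b"] lqb by auto
    qed
    \<comment> \<open>In the binomial expansion of \<open>(a - q * b) ^ k\<close> the factor
      \<open>d * a ^ i\<close> supplies \<open>b ^ i\<close>, and the power of \<open>q * b\<close>
      supplies the missing \<open>b ^ (k - i)\<close>.\<close>
    have CI: "\<exists>c\<in>A. d * a' ^ k = c * b ^ k" for k
    proof -
      obtain c where c: "\<And>i. c i \<in> A" "\<And>i. d * a ^ i = c i * b ^ i" using 1(3) by metis
      have "d * a' ^ k = (\<Sum>i\<le>k. of_nat (k choose i) * (d * a ^ i) * (- (q * b)) ^ (k - i))"
        using binomial_ring[of a "- (q * b)" k] by (simp add: a'_def sum_distrib_left mult_ac)
      also have "\<dots> = (\<Sum>i\<le>k. of_nat (k choose i) * c i * (- q) ^ (k - i) * b ^ k)"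
      proof (rule sum.cong)
        fix i assume "i \<in> {..k}"
        then have "b ^ k = b ^ i * b ^ (k - i)" by (simp add: power_add[symmetric])
        moreover have "(- (q * b)) ^ (k - i) = (- q) ^ (k - i) * b ^ (k - i)"
          by (metis minus_mult_left power_mult_distrib)
        ultimately show "of_nat (k choose i) * (d * a ^ i) * (- (q * b)) ^ (k - i) =
          of_nat (k choose i) * c i * (- q) ^ (k - i) * b ^ k"
          by (simp add: c mult_ac)
      qed simp
      also have "\<dots> = (\<Sum>i\<le>k. of_nat (k choose i) * c i * (- q) ^ (k - i)) * b ^ k"
        by (simp add: sum_distrib_right)
      finally show ?thesis
        using c(1) qA by (intro bexI[of _ "\<Sum>i\<le>k. of_nat (k choose i) * c i * (- q) ^ (k - i)"])
          (auto intro!: A_sum A_mult A_of_nat A_power A_uminus)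
    qed
    have "\<exists>c\<in>A. a' = c * b"
    proof (cases "a' = 0")
      case True
      then show ?thesis using A_of_nat[of 0] by (intro bexI[of _ 0]) auto
    next
      case False
      then have "lead_mono a' < lead_mono a"
        using le[OF lead_mono_in[OF False]] lead_mono_in[OF False] nk by (auto simp: order_less_le)
      then show ?thesis using a'A CI by (intro 1(1)) auto
    qed
    then obtain c where "c \<in> A" "a' = c * b" by blast
    then have "a = (c + q) * b" "c + q \<in> A" using qA by (auto simp: a'_def algebra_simps intro: A_add)
    then show ?thesis by blast
  qed
qed

end

section \<open>Images of monomial maps in projective space\<close>

lemma nth_vec_lambda [simp]: "($) (vec_lambda f) = f"
  by (rule ext) simp

section \<open>Degrees and homogeneous polynomials\<close>

definition tdeg :: "('v \<Rightarrow>\<^sub>0 nat) \<Rightarrow> nat" where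
  "tdeg m = (\<Sum>v\<in>keys m. lookup m v)"

lemma tdeg_superset: "finite V \<Longrightarrow> keys m \<subseteq> V \<Longrightarrow> tdeg m = (\<Sum>v\<in>V. lookup m v)"
  unfolding tdeg_def by (rule sum.mono_neutral_left) (auto simp: in_keys_iff)

lemma tdeg_UNIV: "tdeg (m :: 'v::finite \<Rightarrow>\<^sub>0 nat) = (\<Sum>v\<in>UNIV. lookup m v)"
  by (rule tdeg_superset) auto

lemma tdeg_0 [simp]: "tdeg 0 = 0"
  by (simp add: tdeg_def)

lemma tdeg_single [simp]: "tdeg (Poly_Mapping.single v k) = k"
  by (cases "k = 0") (simp_all add: tdeg_def)

lemma tdeg_add [simp]: "tdeg (m + m') = tdeg m + tdeg m'"
proof -
  let ?V = "keys m \<union> keys m'"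
  have "tdeg (m + m') = (\<Sum>v\<in>?V. lookup (m + m') v)"
    using keys_add[of m m'] by (intro tdeg_superset) auto
  then show ?thesis by (simp add: lookup_add sum.distrib tdeg_superset[of ?V])
qed

lemma tdeg_sum [simp]: "tdeg (\<Sum>i\<in>I. f i) = (\<Sum>i\<in>I. tdeg (f i))"
  by (induction I rule: infinite_finite_induct) auto

lemma homogeneous_iff: "homogeneous d p \<longleftrightarrow> (\<forall>m\<in>keys p. tdeg m = d)"
  by (simp add: homogeneous_in_def tdeg_def)

lemma homogeneous_mult: "homogeneous d p \<Longrightarrow> homogeneous d' q \<Longrightarrow> homogeneous (d + d') (p * q)"
  using keys_mult[of p q] by (force simp: homogeneous_iff)

lemma homogeneous_diff: "homogeneous d p \<Longrightarrow> homogeneous d q \<Longrightarrow> homogeneous d (p - q)"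
  using keys_diff[of p q] by (auto simp: homogeneous_iff)

lemma homogeneous_single: "tdeg m = d \<Longrightarrow> homogeneous d (Poly_Mapping.single m c)"
  by (simp add: homogeneous_iff)

lemma homogeneous_1: "homogeneous 0 1"
  by (simp add: homogeneous_iff)

lemma homogeneous_pvar: "homogeneous 1 (pvar v)"
  by (simp add: homogeneous_iff)

lemma homogeneous_prod_pvar: "homogeneous (card V) (\<Prod>v\<in>V. pvar v)"
proof (induction V rule: infinite_finite_induct)
  case (insert v V)
  then show ?case using homogeneous_mult[OF homogeneous_pvar[of v] insert.IH] by simp
qed (auto simp: homogeneous_1)

lemma mono_eval_scale: "mono_eval (\<lambda>v. c * x v) m = (c :: complex) ^ tdeg m * mono_eval x m"
  by (simp add: mono_eval_def tdeg_def power_mult_distrib prod.distrib power_sum)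

lemma peval_scale:
  assumes "homogeneous d p"
  shows "peval p (\<lambda>v. c * x v) = c ^ d * peval p x"
  using assms by (simp add: peval_eq_sum mono_eval_scale homogeneous_iff sum_distrib_left mult_ac)

section \<open>Projective points and the Zariski topology\<close>

lemma proj_point_iff: "w \<in> proj_point v \<longleftrightarrow> (\<exists>c. w = c *s v)"
  by (auto simp: vec.span_singleton)

lemma proj_point_eqI: "c \<noteq> 0 \<Longrightarrow> w = c *s v \<Longrightarrow> proj_point w = proj_point v"
proof -
  assume c: "c \<noteq> 0" and w: "w = c *s v"
  then have "v = (1 / c) *s w" by (simp add: vector_smult_assoc)
  then have "w \<in> proj_point v" "v \<in> proj_point w" using w proj_point_iff by blast+
  then show ?thesis by (intro subset_antisym vec.span_minimal) auto
qed

lemma proj_point_eqD: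
  assumes "proj_point w = proj_point v" "w \<noteq> 0"
  obtains c where "c \<noteq> 0" "w = c *s v"
proof -
  have "w \<in> proj_point v" using assms proj_point_iff[of w w] by (metis vector_smult_lid)
  then obtain c where "w = c *s v" by (auto simp: proj_point_iff)
  then show ?thesis using assms(2) that by auto
qed

definition basic_open :: "'m cpoly \<Rightarrow> (complex^'m) set set" where
  "basic_open f = {L \<in> proj_space. \<exists>v\<in>L. peval f (($) v) \<noteq> 0}"

lemma proj_point_in_basic_open:
  assumes "homogeneous d f" "v \<noteq> 0"
  shows "proj_point v \<in> basic_open f \<longleftrightarrow> peval f (($) v) \<noteq> 0"
proof -
  have "peval f (($) (c *s v)) = c ^ d * peval f (($) v)" for c
    using peval_scale[OF assms(1), of c "($) v"] by (simp add: vector_scalar_mult_def)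
  then have "(\<exists>w\<in>proj_point v. peval f (($) w) \<noteq> 0) \<longleftrightarrow> peval f (($) v) \<noteq> 0"
    using vec.span_base[of v "{v}"] by (metis mult_eq_0_iff proj_point_iff singletonI)
  then show ?thesis
    using assms(2) by (auto simp: basic_open_def proj_space_def)
qed

lemma basic_open_mult:
  assumes "homogeneous d f" "homogeneous d' g"
  shows "basic_open (f * g) = basic_open f \<inter> basic_open g"
proof -
  have "L \<in> basic_open (f * g) \<longleftrightarrow> L \<in> basic_open f \<inter> basic_open g" if "L \<in> proj_space" for L
    using that proj_point_in_basic_open[OF homogeneous_mult[OF assms]]
      proj_point_in_basic_open[OF assms(1)] proj_point_in_basic_open[OF assms(2)]
    by (auto simp: proj_space_def)
  then show ?thesis by (auto simp: basic_open_def)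
qed

lemma basic_open_1: "basic_open 1 = (proj_space :: (complex^'m) set set)"
  using proj_point_in_basic_open[OF homogeneous_1] by (auto simp: basic_open_def proj_space_def)

lemma zariski_alt: "zariski = topology_generated_by {basic_open f | f. \<exists>d. homogeneous d f}"
  by (simp add: zariski_def basic_open_def)

lemma openin_basic_open: "homogeneous d f \<Longrightarrow> openin zariski (basic_open f)"
  unfolding zariski_alt by (rule topology_generated_by_Basis) auto

lemma topspace_zariski: "topspace zariski = (proj_space :: (complex^'m) set set)"
  unfolding zariski_alt topology_generated_by_topspace
proof
  have "(proj_space :: (complex^'m) set set) \<in> {basic_open f | f. \<exists>d. homogeneous d f}"
    using homogeneous_1 basic_open_1 by blast
  then show "proj_space \<subseteq> \<Union> {basic_open f | f. \<exists>d. homogeneous d (f :: 'm cpoly)}" by blast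
qed (auto simp: basic_open_def)

text \<open>The generating sets form a basis, not merely a subbasis, because products of homogeneous
  polynomials realise finite intersections.\<close>

lemma openin_zariskiD:
  assumes "openin zariski U" "L \<in> U"
  shows "\<exists>d f. homogeneous d f \<and> L \<in> basic_open f \<and> basic_open f \<subseteq> U"
proof -
  have "generate_topology_on {basic_open f | f. \<exists>d. homogeneous d f} U"
    using assms(1) unfolding zariski_alt by (simp add: openin_topology_generated_by_iff)
  then show ?thesis using assms(2)
  proof (induction arbitrary: L)
    case (Int U V)
    obtain d f where f: "homogeneous d f" "L \<in> basic_open f" "basic_open f \<subseteq> U"
      using Int.IH(1)[of L] Int.prems by auto
    obtain d' g where g: "homogeneous d' g" "L \<in> basic_open g" "basic_open g \<subseteq> V"
      using Int.IH(2)[of L] Int.prems by auto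
    show ?case
      using f g homogeneous_mult[OF f(1) g(1)] basic_open_mult[OF f(1) g(1)] by blast
  next
    case (UN K)
    then show ?case by (meson Sup_upper UnionE order_trans)
  qed blast+
qed

lemma in_zariski_closure:
  assumes "S \<subseteq> proj_space"
  shows "L \<in> zariski closure_of S \<longleftrightarrow> L \<in> proj_space \<and>
    (\<forall>d f. homogeneous d f \<longrightarrow> S \<inter> basic_open f = {} \<longrightarrow> L \<notin> basic_open f)"
proof
  assume L: "L \<in> zariski closure_of S"
  then show "L \<in> proj_space \<and> (\<forall>d f. homogeneous d f \<longrightarrow> S \<inter> basic_open f = {} \<longrightarrow> L \<notin> basic_open f)"
    using openin_basic_open by (fastforce simp: in_closure_of topspace_zariski)
next
  assume L: "L \<in> proj_space \<and> (\<forall>d f. homogeneous d f \<longrightarrow> S \<inter> basic_open f = {} \<longrightarrow> L \<notin> basic_open f)"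
  show "L \<in> zariski closure_of S"
    unfolding in_closure_of topspace_zariski
  proof (intro conjI allI impI)
    fix U assume "L \<in> U \<and> openin zariski U"
    then obtain d f where "homogeneous d f" "L \<in> basic_open f" "basic_open f \<subseteq> U"
      using openin_zariskiD by blast
    then show "\<exists>M. M \<in> S \<and> M \<in> U" using L by blast
  qed (use L in simp)
qed

lemma power_single: "Poly_Mapping.single \<alpha> a ^ k = Poly_Mapping.single (\<Sum>i<k::nat. \<alpha>) (a ^ k :: complex)"
  by (induction k) (simp_all add: mult_single add.commute)

lemma prod_single:
  "(\<Prod>i\<in>I. Poly_Mapping.single (f i) (g i)) = Poly_Mapping.single (\<Sum>i\<in>I. f i) (\<Prod>i\<in>I. g i :: complex)"
  by (induction I rule: infinite_finite_induct) (simp_all add: mult_single)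

text \<open>Terms with equal exponent cancel among themselves, so any function \<open>h\<close> may
  replace the monomials, not only evaluation at a point. \<open>emb_in_Y\<close> substitutes
  characters of the abstract torus in this way.\<close>

lemma sum_single_eq_0:
  assumes "(\<Sum>m\<in>F. Poly_Mapping.single (\<alpha> m) (a m :: complex)) = 0" "finite F"
  shows "(\<Sum>m\<in>F. a m * h (\<alpha> m)) = 0"
proof -
  have "(\<Sum>m\<in>F. a m * h (\<alpha> m)) = (\<Sum>\<beta>\<in>\<alpha> ` F. \<Sum>m\<in>{m\<in>F. \<alpha> m = \<beta>}. a m * h (\<alpha> m))"
    by (rule sum.image_gen) fact
  also have "\<dots> = (\<Sum>\<beta>\<in>\<alpha> ` F. (\<Sum>m\<in>{m\<in>F. \<alpha> m = \<beta>}. a m) * h \<beta>)"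
    by (intro sum.cong refl) (auto simp: sum_distrib_right)
  also have "\<dots> = (\<Sum>\<beta>\<in>\<alpha> ` F. lookup (\<Sum>m\<in>F. Poly_Mapping.single (\<alpha> m) (a m)) \<beta> * h \<beta>)"
    using assms(2) by (simp add: lookup_sum lookup_single when_def sum.inter_filter)
  finally show ?thesis by (simp add: assms(1))
qed

interpretation cpoly_ring: cring "cpoly_ring :: 'v cpoly ring"
  by (intro cringI abelian_groupI comm_monoidI)
    (auto simp: cpoly_ring_def algebra_simps intro: exI[of _ "- x" for x])

lemma cpoly_ring_simps [simp]:
  "carrier cpoly_ring = UNIV" "\<zero>\<^bsub>cpoly_ring\<^esub> = 0" "\<one>\<^bsub>cpoly_ring\<^esub> = 1"
  "p \<oplus>\<^bsub>cpoly_ring\<^esub> q = p + q" "p \<otimes>\<^bsub>cpoly_ring\<^esub> q = p * q"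
  by (simp_all add: cpoly_ring_def)

text \<open>Data of a (not necessarily normal) projective toric variety: coordinate \<open>j\<close> is \<open>c j\<close> times the
  monomial with exponent \<open>e j\<close>. All monomials have the same positive degree, so that the scalars
  are contained in the image of the torus of all vectors without zero entries.\<close>

locale toric_data =
  fixes c :: "'m::finite \<Rightarrow> complex" and e :: "'m \<Rightarrow> ('n::{finite,linorder} \<Rightarrow>\<^sub>0 nat)" and D :: nat
  assumes D: "0 < D" and tdeg_e: "tdeg (e j) = D" and nontrivial: "\<exists>j. c j \<noteq> 0"
begin

definition pt :: "('n \<Rightarrow> complex) \<Rightarrow> complex^'m" where
  "pt t = (\<chi> j. c j * mono_eval t (e j))"

definition torus_points :: "(complex^'m) set set" where
  "torus_points = {proj_point (pt t) | t. \<forall>i. t i \<noteq> 0}"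

definition Y :: "(complex^'m) set set" where
  "Y = zariski closure_of torus_points"

text \<open>Pull-back of polynomials along \<open>pt\<close>. Its kernel turns out to be the
  homogeneous ideal of \<open>Y\<close>, so that its image is a model of the coordinate
  ring.\<close>

abbreviation Phi :: "'m cpoly \<Rightarrow> 'n cpoly" where
  "Phi \<equiv> msubst (\<lambda>j. Poly_Mapping.single (e j) (c j))"

definition expo :: "('m \<Rightarrow>\<^sub>0 nat) \<Rightarrow> ('n \<Rightarrow>\<^sub>0 nat)" where
  "expo m = (\<Sum>j\<in>UNIV. \<Sum>i<lookup m j. e j)"

lemma expo_add: "expo (m + m') = expo m + expo m'"
proof -
  have "(\<Sum>i<a + b. x) = (\<Sum>i<a. x) + (\<Sum>i<b. x)" for a b :: nat and x :: "'n \<Rightarrow>\<^sub>0 nat"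
    by (induction b) (simp_all add: add_ac)
  then show ?thesis by (simp add: expo_def lookup_add sum.distrib)
qed

lemma expo_0 [simp]: "expo 0 = 0"
  by (simp add: expo_def)

lemma expo_single [simp]: "expo (Poly_Mapping.single j 1) = e j"
proof -
  have "expo (Poly_Mapping.single j 1) = (\<Sum>j'\<in>UNIV. if j' = j then e j else 0)"
    unfolding expo_def by (intro sum.cong) (auto simp: lookup_single when_def)
  then show ?thesis by simp
qed

lemma lookup_expo: "lookup (expo m) v = (\<Sum>j\<in>UNIV. lookup m j * lookup (e j) v)"
  by (simp add: expo_def lookup_sum)

lemma tdeg_expo: "tdeg (expo m) = tdeg m * D"
  by (simp add: expo_def tdeg_e tdeg_UNIV[of m] sum_distrib_right)

lemma mono_eval_Phi:
  "mono_eval (\<lambda>j. Poly_Mapping.single (e j) (c j)) m = Poly_Mapping.single (expo m) (mono_eval c m)"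
  by (simp add: mono_eval_UNIV power_single prod_single expo_def)

lemma Phi_eq: "Phi p = (\<Sum>m\<in>keys p. Poly_Mapping.single (expo m) (lookup p m * mono_eval c m))"
  by (simp add: msubst.hom_def mono_eval_Phi mult_single)

lemma peval_Phi: "peval (Phi p) t = peval p (($) (pt t))"
  by (simp add: peval_msubst pt_def)

lemma Phi_eq_0_iff: "Phi p = 0 \<longleftrightarrow> (\<forall>t. (\<forall>i. t i \<noteq> 0) \<longrightarrow> peval p (($) (pt t)) = 0)"
  using peval_eq_0_imp_eq_0[of "Phi p"] by (auto simp: peval_Phi[symmetric])

lemma pt_nonzero: "(\<And>i. t i \<noteq> 0) \<Longrightarrow> pt t \<noteq> 0"
  using nontrivial by (auto simp: pt_def vec_eq_iff mono_eval_UNIV)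

lemma torus_points_subset: "torus_points \<subseteq> proj_space"
  using pt_nonzero by (auto simp: torus_points_def proj_space_def)

lemma torus_points_disjoint_iff:
  assumes "homogeneous d f"
  shows "torus_points \<inter> basic_open f = {} \<longleftrightarrow> Phi f = 0"
  unfolding Phi_eq_0_iff using proj_point_in_basic_open[OF assms pt_nonzero]
  by (auto simp: torus_points_def)

lemma in_Y_iff:
  assumes "v \<noteq> 0"
  shows "proj_point v \<in> Y \<longleftrightarrow> (\<forall>d f. homogeneous d f \<longrightarrow> Phi f = 0 \<longrightarrow> peval f (($) v) = 0)"
proof -
  have "proj_point v \<in> proj_space" using assms by (auto simp: proj_space_def)
  moreover have "(torus_points \<inter> basic_open f = {} \<longrightarrow> proj_point v \<notin> basic_open f) \<longleftrightarrow> (Phi f = 0 \<longrightarrow> peval f (($) v) = 0)"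
    if "homogeneous d f" for d f
    using torus_points_disjoint_iff[OF that] proj_point_in_basic_open[OF that assms] by simp
  ultimately show ?thesis
    unfolding Y_def in_zariski_closure[OF torus_points_subset] by blast
qed

lemma Y_subset: "Y \<subseteq> proj_space"
  unfolding Y_def by (metis closure_of_subset_topspace topspace_zariski)

lemma torus_points_subset_Y: "torus_points \<subseteq> Y"
  unfolding Y_def using torus_points_subset by (intro closure_of_subset) (simp add: topspace_zariski)

lemma torus_points_nonempty: "torus_points \<noteq> {}"
  unfolding torus_points_def by (auto intro: exI[of _ "\<lambda>_. 1"])

text \<open>Irreducibility comes from the target of \<open>Phi\<close> being a domain: polynomials
  that witness \<open>\<not> Y \<subseteq> C\<close> and \<open>\<not> Y \<subseteq> C'\<close> have
  a product with nonzero image, hence a torus point outside both sets.\<close>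

lemma closed_subvariety_Y: "closed_subvariety Y"
  unfolding closed_subvariety_def
proof (intro conjI allI impI)
  show "closedin zariski Y" by (simp add: Y_def)
  show "Y \<noteq> {}" using torus_points_subset_Y torus_points_nonempty by auto
  fix C C' assume C: "closedin zariski C" and C': "closedin zariski C'" and sub: "Y \<subseteq> C \<union> C'"
  have *: "\<exists>d f. homogeneous d f \<and> Phi f \<noteq> 0 \<and> basic_open f \<inter> K = {}" if K: "closedin zariski K" "\<not> Y \<subseteq> K" for K
  proof -
    obtain L where L: "L \<in> Y" "L \<notin> K" using K by auto
    have op: "openin zariski (topspace zariski - K)" using K by (simp add: closedin_def)
    have "L \<in> topspace zariski - K" using L Y_subset by (auto simp: topspace_zariski)
    then obtain d f where f: "homogeneous d f" "L \<in> basic_open f" "basic_open f \<subseteq> topspace zariski - K"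
      using openin_zariskiD[OF op] by blast
    have "Phi f \<noteq> 0"
      using f(2) L(1) in_zariski_closure[OF torus_points_subset, of L] torus_points_disjoint_iff[OF f(1)] f(1)
      unfolding Y_def by metis
    moreover have "basic_open f \<inter> K = {}" using f(3) by auto
    ultimately show ?thesis using f(1) by metis
  qed
  show "Y \<subseteq> C \<or> Y \<subseteq> C'"
  proof (rule ccontr)
    assume "\<not> (Y \<subseteq> C \<or> Y \<subseteq> C')"
    then have "\<not> Y \<subseteq> C" "\<not> Y \<subseteq> C'" by auto
    obtain d f where f: "homogeneous d f" "Phi f \<noteq> 0" "basic_open f \<inter> C = {}"
      using *[OF C \<open>\<not> Y \<subseteq> C\<close>] by auto
    obtain d' f' where f': "homogeneous d' f'" "Phi f' \<noteq> 0" "basic_open f' \<inter> C' = {}"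
      using *[OF C' \<open>\<not> Y \<subseteq> C'\<close>] by auto
    have "Phi (f * f') \<noteq> 0" using f f' by simp
    then have "torus_points \<inter> basic_open (f * f') \<noteq> {}"
      using torus_points_disjoint_iff[OF homogeneous_mult[OF f(1) f'(1)]] by blast
    then obtain L where "L \<in> torus_points" "L \<in> basic_open f" "L \<in> basic_open f'"
      using basic_open_mult[OF f(1) f'(1)] by blast
    then show False using sub torus_points_subset_Y f(3) f'(3) by blast
  qed
qed

section \<open>The homogeneous ideal and the coordinate ring\<close>

definition hcomp :: "nat \<Rightarrow> 'm cpoly \<Rightarrow> 'm cpoly" where
  "hcomp d f = (\<Sum>m\<in>{m\<in>keys f. tdeg m = d}. Poly_Mapping.single m (lookup f m))"

lemma lookup_hcomp: "lookup (hcomp d f) m = (if tdeg m = d then lookup f m else 0)"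
  by (simp add: hcomp_def lookup_sum lookup_single when_def in_keys_iff)

lemma homogeneous_hcomp: "homogeneous d (hcomp d f)"
  by (auto simp: homogeneous_iff in_keys_iff lookup_hcomp split: if_splits)

lemma sum_hcomp: "(\<Sum>d\<in>tdeg ` keys f. hcomp d f) = f"
  by (rule poly_mapping_eqI) (auto simp: lookup_sum lookup_hcomp in_keys_iff)

text \<open>\<open>Phi\<close> multiplies degrees by \<open>D > 0\<close>, so the images of
  different homogeneous components live in different degrees and cannot cancel each other.\<close>

lemma Phi_hcomp_eq_0:
  assumes "Phi f = 0"
  shows "Phi (hcomp d f) = 0"
proof (rule poly_mapping_eqI)
  fix \<alpha>
  have *: "lookup (Phi p) \<alpha> = (\<Sum>m\<in>keys p. if expo m = \<alpha> then lookup p m * mono_eval c m else 0)" for p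
    by (simp add: Phi_eq lookup_sum lookup_single when_def)
  show "lookup (Phi (hcomp d f)) \<alpha> = lookup 0 \<alpha>"
  proof (cases "tdeg \<alpha> = d * D")
    case True
    have "lookup (Phi (hcomp d f)) \<alpha> = (\<Sum>m\<in>keys f. if expo m = \<alpha> then lookup (hcomp d f) m * mono_eval c m else 0)"
      unfolding * by (rule sum.mono_neutral_left) (auto simp: in_keys_iff lookup_hcomp split: if_splits)
    also have "\<dots> = lookup (Phi f) \<alpha>"
      unfolding * using True D by (intro sum.cong) (auto simp: lookup_hcomp tdeg_expo)
    finally show ?thesis by (simp add: assms)
  next
    case False
    then show ?thesis
      unfolding * by (auto simp: tdeg_expo in_keys_iff lookup_hcomp intro!: sum.neutral)
  qed
qed

lemma ideal_kernel: "ideal {f. Phi f = 0} cpoly_ring"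
proof (rule idealI)
  show "ring (cpoly_ring :: 'm cpoly ring)" by (rule cpoly_ring.ring_axioms)
  show "subgroup {f. Phi f = 0} (add_monoid (cpoly_ring :: 'm cpoly ring))"
  proof (rule group.subgroupI)
    show "group (add_monoid (cpoly_ring :: 'm cpoly ring))" by (rule cpoly_ring.a_group)
    fix a assume a: "a \<in> {f. Phi f = 0}"
    have "inv\<^bsub>add_monoid cpoly_ring\<^esub> a = - a"
      using cpoly_ring.minus_equality[of "- a" a] by (simp add: a_inv_def)
    then show "inv\<^bsub>add_monoid cpoly_ring\<^esub> a \<in> {f. Phi f = 0}" using a by simp
  qed (auto simp: cpoly_ring_def intro: exI[of _ 0])
qed (auto simp: cpoly_ring_def)

text \<open>A homogeneous polynomial vanishes on the closure exactly if it vanishes on the torus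
  points, that is, lies in the kernel of \<open>Phi\<close>. Every element of the kernel is the sum
  of its components, which are again in the kernel.\<close>

lemma homogeneous_ideal_Y: "homogeneous_ideal Y = {f. Phi f = 0}"
proof
  let ?G = "{f. (\<exists>d. homogeneous d f) \<and> (\<forall>L\<in>Y. \<forall>v\<in>L - {0}. peval f (($) v) = 0)} :: 'm cpoly set"
  have G: "f \<in> ?G \<longleftrightarrow> Phi f = 0" if f: "homogeneous d f" for d f
  proof
    assume "f \<in> ?G"
    moreover have "proj_point (pt t) \<in> Y" "pt t \<in> proj_point (pt t) - {0}" if "\<forall>i. t i \<noteq> 0" for t
      using that torus_points_subset_Y pt_nonzero by (auto simp: torus_points_def vec.span_base)
    ultimately show "Phi f = 0" unfolding Phi_eq_0_iff by blast
  next
    assume f0: "Phi f = 0"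
    have "peval f (($) w) = 0" if L: "L \<in> Y" "w \<in> L - {0}" for L w
    proof -
      obtain v where v: "L = proj_point v" "v \<noteq> 0" using Y_subset L by (auto simp: proj_space_def)
      obtain a where "w = a *s v" using L v by (auto simp: proj_point_iff)
      then have "proj_point w = proj_point v" using L by (intro proj_point_eqI[of a]) auto
      then show ?thesis using in_Y_iff[of w] L v f f0 by auto
    qed
    then show "f \<in> ?G" using f by blast
  qed
  show "homogeneous_ideal Y \<subseteq> {f. Phi f = 0}"
    unfolding homogeneous_ideal_def using ideal_kernel G
    by (intro cpoly_ring.genideal_minimal) auto
  have id: "ideal (homogeneous_ideal Y) cpoly_ring"
    unfolding homogeneous_ideal_def by (rule cpoly_ring.genideal_ideal) simp
  have sub: "?G \<subseteq> homogeneous_ideal Y"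
    unfolding homogeneous_ideal_def by (rule cpoly_ring.genideal_self) simp
  show "{f. Phi f = 0} \<subseteq> homogeneous_ideal Y"
  proof
    fix f assume "f \<in> {f. Phi f = 0}"
    then have "hcomp d f \<in> homogeneous_ideal Y" for d
      using G[OF homogeneous_hcomp] Phi_hcomp_eq_0 sub by blast
    then have "(\<Sum>d\<in>T. hcomp d f) \<in> homogeneous_ideal Y" for T
      using additive_subgroup.a_closed[OF ideal.axioms(1)[OF id]] additive_subgroup.zero_closed[OF ideal.axioms(1)[OF id]]
      by (induction T rule: infinite_finite_induct) auto
    from this[of "tdeg ` keys f"] show "f \<in> homogeneous_ideal Y" by (simp add: sum_hcomp)
  qed
qed

text \<open>\<open>Phi\<close> identifies the quotient ring with the algebra of \<open>S\<close>:
  monomials involving a coordinate with \<open>c j = 0\<close> are sent to 0, and for the others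
  \<open>mono_eval c m\<close> can be divided out. Only equations are transported, between cosets
  and their images under \<open>Phi\<close>.\<close>

lemma normal_coordinate_ring:
  assumes S: "saturated_monoid S"
    and gen: "S = {expo m | m. \<forall>j\<in>keys m. c j \<noteq> 0}"
  shows "normal_domain (homogeneous_coordinate_ring Y)"
proof -
  interpret S: saturated_monoid S by fact
  define I where "I = {f. Phi f = 0}"
  have Imem: "f \<in> I \<longleftrightarrow> Phi f = 0" for f by (simp add: I_def)
  let ?R = "cpoly_ring :: 'm cpoly ring" and ?Q = "cpoly_ring Quot I"
  interpret I: ideal I ?R unfolding I_def by (rule ideal_kernel)
  interpret prime: primeideal I ?R
  proof (rule primeidealI)
    show "carrier ?R \<noteq> I" using msubst.hom_1 Imem[of 1] by auto
    fix a b assume "a \<otimes>\<^bsub>?R\<^esub> b \<in> I"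
    then show "a \<in> I \<or> b \<in> I" by (simp add: Imem)
  qed (unfold_locales)
  interpret Q: domain ?Q by (rule prime.quotient_is_domain)
  have Phi_in: "Phi p \<in> S.A" for p
    unfolding Phi_eq
  proof (rule S.A_sum)
    fix m
    show "Poly_Mapping.single (expo m) (lookup p m * mono_eval c m) \<in> S.A"
    proof (cases "\<forall>j\<in>keys m. c j \<noteq> 0")
      case True
      then show ?thesis by (intro S.A_single) (auto simp: gen)
    next
      case False
      then have "mono_eval c m = 0" by (auto simp: mono_eval_def in_keys_iff)
      then show ?thesis using S.A_of_nat[of 0] by simp
    qed
  qed
  have Phi_onto: "\<exists>p. Phi p = q" if "q \<in> S.A" for q
  proof -
    have "\<exists>p. Phi p = Poly_Mapping.single \<alpha> (lookup q \<alpha>)" if al: "\<alpha> \<in> keys q" for \<alpha>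
    proof -
      have "\<alpha> \<in> S" using al \<open>q \<in> S.A\<close> by (auto simp: S.A_def)
      then obtain m where m: "\<alpha> = expo m" "\<forall>j\<in>keys m. c j \<noteq> 0" using gen by auto
      then have "mono_eval c m \<noteq> 0" by (auto simp: mono_eval_def)
      then have "Phi (Poly_Mapping.single m (lookup q \<alpha> / mono_eval c m)) = Poly_Mapping.single \<alpha> (lookup q \<alpha>)"
        by (simp add: mono_eval_Phi mult_single m(1))
      then show ?thesis by blast
    qed
    then obtain P where P: "\<And>\<alpha>. \<alpha> \<in> keys q \<Longrightarrow> Phi (P \<alpha>) = Poly_Mapping.single \<alpha> (lookup q \<alpha>)" by metis
    have "Phi (\<Sum>\<alpha>\<in>keys q. P \<alpha>) = (\<Sum>\<alpha>\<in>keys q. Poly_Mapping.single \<alpha> (lookup q \<alpha>))"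
      by (simp add: P)
    also have "\<dots> = q" by (rule peval.sum_monomials)
    finally show ?thesis by blast
  qed
  define cls where "cls = (\<lambda>a. I +>\<^bsub>?R\<^esub> a)"
  have hom: "cls \<in> ring_hom ?R ?Q" unfolding cls_def by (rule I.rcos_ring_hom)
  have car: "carrier ?Q = range cls"
    by (auto simp: FactRing_def cls_def A_RCOSETS_def')
  have cls_eq: "cls a = cls b \<longleftrightarrow> Phi a = Phi b" for a b
  proof -
    have "cls a = cls b \<longleftrightarrow> a \<ominus>\<^bsub>?R\<^esub> b \<in> I"
      unfolding cls_def by (subst cpoly_ring.quotient_eq_iff_same_a_r_cos) (simp_all add: I.ideal_axioms)
    also have "a \<ominus>\<^bsub>?R\<^esub> b = a - b"
      using cpoly_ring.minus_equality[of "- b" b] by (simp add: a_minus_def)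
    finally show ?thesis by (simp add: Imem)
  qed
  have cls_mult: "cls a \<otimes>\<^bsub>?Q\<^esub> cls b = cls (a * b)" for a b
    using ring_hom_mult[OF hom, of a b] by simp
  have cls_pow: "cls a [^]\<^bsub>?Q\<^esub> k = cls (a ^ k)" for a and k :: nat
    by (induction k) (use ring_hom_one[OF hom] in \<open>simp_all add: cls_mult mult.commute\<close>)
  have cls_0: "\<zero>\<^bsub>?Q\<^esub> = cls 0"
    using ring_hom_zero[OF hom cpoly_ring.ring_axioms] Q.ring_axioms by simp
  have "normal_domain ?Q"
  proof (rule Q.normal_domain_if_completely_integrally_closed)
    fix a' b' d'
    assume "a' \<in> carrier ?Q" "b' \<in> carrier ?Q" "d' \<in> carrier ?Q"
    then obtain a b d where abd: "a' = cls a" "b' = cls b" "d' = cls d" by (auto simp: car)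
    assume "b' \<noteq> \<zero>\<^bsub>?Q\<^esub>" "d' \<noteq> \<zero>\<^bsub>?Q\<^esub>"
      and *: "\<And>k::nat. \<exists>x\<in>carrier ?Q. d' \<otimes>\<^bsub>?Q\<^esub> a' [^]\<^bsub>?Q\<^esub> k = x \<otimes>\<^bsub>?Q\<^esub> b' [^]\<^bsub>?Q\<^esub> k"
    have "\<exists>q\<in>S.A. Phi a = q * Phi b"
    proof (rule S.completely_integrally_closed)
      show "Phi b \<noteq> 0" "Phi d \<noteq> 0"
        using \<open>b' \<noteq> _\<close> \<open>d' \<noteq> _\<close> by (auto simp: abd cls_0 cls_eq)
      fix k :: nat
      obtain x where "cls d \<otimes>\<^bsub>?Q\<^esub> cls a [^]\<^bsub>?Q\<^esub> k = cls x \<otimes>\<^bsub>?Q\<^esub> cls b [^]\<^bsub>?Q\<^esub> k"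
        using *[of k] by (auto simp: abd car)
      then have "Phi d * Phi a ^ k = Phi x * Phi b ^ k" by (simp add: cls_pow cls_mult cls_eq)
      then show "\<exists>q\<in>S.A. Phi d * Phi a ^ k = q * Phi b ^ k" using Phi_in by blast
    qed (use Phi_in in auto)
    then obtain q where "q \<in> S.A" "Phi a = q * Phi b" by blast
    then obtain x where "Phi a = Phi (x * b)" using Phi_onto by force
    then show "\<exists>x\<in>carrier ?Q. a' = x \<otimes>\<^bsub>?Q\<^esub> b'"
      by (auto simp: abd car cls_mult cls_eq)
  qed
  then show ?thesis
    by (simp add: homogeneous_coordinate_ring_def homogeneous_ideal_Y I_def)
qed

end

section \<open>The dense torus\<close>

lemma int_scale_mem:
  fixes L :: "('a \<Rightarrow> int) set"
  assumes zero: "(\<lambda>_. 0) \<in> L" and diff: "\<And>x y. x \<in> L \<Longrightarrow> y \<in> L \<Longrightarrow> (\<lambda>v. x v - y v) \<in> L"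
    and "x \<in> L"
  shows "(\<lambda>v. n * x v) \<in> L"
proof -
  have nonneg: "(\<lambda>v. int k * x v) \<in> L" for k
  proof (induction k)
    case 0
    then show ?case using zero by simp
  next
    case (Suc k)
    have "(\<lambda>v. (0 - x v)) \<in> L" using diff[OF zero \<open>x \<in> L\<close>] by simp
    then have "(\<lambda>v. int k * x v - (0 - x v)) \<in> L" using diff[OF Suc] by blast
    then show ?case by (simp add: algebra_simps)
  qed
  show ?thesis
  proof (cases "n \<ge> 0")
    case True
    then show ?thesis using nonneg[of "nat n"] by simp
  next
    case False
    then show ?thesis using diff[OF zero nonneg[of "nat (- n)"]] by simp
  qed
qed

text \<open>Elimination of one coordinate \<open>p\<close> at a time: the least positive value
  \<open>d\<close> taken at \<open>p\<close> divides all values there, by division with remainder. A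
  vector \<open>w\<close> with this value completes a basis of the vectors vanishing at
  \<open>p\<close>.\<close>

lemma lattice_basis:
  fixes L :: "('a \<Rightarrow> int) set"
  assumes "finite F" "(\<lambda>_. 0) \<in> L" "\<And>x y. x \<in> L \<Longrightarrow> y \<in> L \<Longrightarrow> (\<lambda>v. x v - y v) \<in> L"
    "\<And>x v. x \<in> L \<Longrightarrow> v \<notin> F \<Longrightarrow> x v = 0"
  shows "\<exists>(k::nat) \<omega>. (\<forall>i<k. \<omega> i \<in> L) \<and> (\<forall>x\<in>L. \<exists>z. \<forall>v. x v = (\<Sum>i<k. z i * \<omega> i v)) \<and>
    (\<forall>z. (\<forall>v. (\<Sum>i<k. z i * \<omega> i v) = 0) \<longrightarrow> (\<forall>i<k. z i = 0))"
  using assms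
proof (induction F arbitrary: L rule: finite_induct)
  case empty
  then show ?case by (intro exI[of _ 0]) auto
next
  case (insert p F)
  note zero = insert.prems(1) and diff = insert.prems(2)
  show ?case
  proof (cases "\<forall>x\<in>L. x p = 0")
    case True
    show ?thesis
    proof (rule insert.IH[OF zero diff])
      show "x v = 0" if "x \<in> L" "v \<notin> F" for x v
        using that insert.prems(3)[of x v] True by (cases "v = p") auto
    qed
  next
    case False
    then obtain y where y: "y \<in> L" "y p \<noteq> 0" by blast
    let ?P = "\<lambda>d. d > 0 \<and> (\<exists>w\<in>L. w p = int d)"
    have "\<exists>w\<in>L. w p = \<bar>y p\<bar>"
    proof (cases "y p > 0")
      case True
      then show ?thesis using y(1) by (intro bexI[of _ y]) auto
    next
      case False
      then show ?thesis using diff[OF zero y(1)] by (intro bexI[of _ "\<lambda>v. 0 - y v"]) auto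
    qed
    then have "?P (nat \<bar>y p\<bar>)" using y(2) by auto
    then have Pd: "?P (LEAST d. ?P d)" by (rule LeastI)
    define d where "d = (LEAST d. ?P d)"
    obtain w where w: "w \<in> L" "w p = int d" and d: "d > 0" using Pd unfolding d_def by blast
    have min: "d \<le> d'" if "?P d'" for d' unfolding d_def using that by (rule Least_le)
    have red: "(\<lambda>v. y v - (y p div int d) * w v) \<in> L" "y p - (y p div int d) * w p = 0" if "y \<in> L" for y
    proof -
      show m: "(\<lambda>v. y v - (y p div int d) * w v) \<in> L"
        by (rule diff[OF that int_scale_mem[OF zero diff w(1)]])
      have eq: "y p - (y p div int d) * w p = y p mod int d"
        unfolding w(2) by (simp add: minus_div_mult_eq_mod)
      have "y p mod int d = 0"
      proof (rule ccontr)
        assume "y p mod int d \<noteq> 0"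
        moreover have "0 \<le> y p mod int d" using d by simp
        ultimately have pos: "nat (y p mod int d) > 0" "int (nat (y p mod int d)) = y p mod int d" by auto
        have "\<exists>w\<in>L. w p = y p mod int d" using m eq by (rule_tac bexI[OF _ m]) simp
        then have "?P (nat (y p mod int d))" using pos by simp
        from min[OF this] have "int d \<le> y p mod int d" using pos(2) by linarith
        moreover have "y p mod int d < int d" using d by (intro pos_mod_bound) simp
        ultimately show False by linarith
      qed
      then show "y p - (y p div int d) * w p = 0" using eq by simp
    qed
    let ?L = "{x \<in> L. x p = 0}"
    have "\<exists>(k::nat) \<omega>. (\<forall>i<k. \<omega> i \<in> ?L) \<and> (\<forall>x\<in>?L. \<exists>z. \<forall>v. x v = (\<Sum>i<k. z i * \<omega> i v)) \<and>
      (\<forall>z. (\<forall>v. (\<Sum>i<k. z i * \<omega> i v) = 0) \<longrightarrow> (\<forall>i<k. z i = 0))"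
    proof (rule insert.IH)
      show "x v = 0" if "x \<in> ?L" "v \<notin> F" for x v
        using that insert.prems(3)[of x v] by (cases "v = p") auto
    qed (use zero diff in auto)
    then obtain k :: nat and \<omega> where K: "\<forall>i<k. \<omega> i \<in> ?L"
      "\<forall>x\<in>?L. \<exists>z. \<forall>v. x v = (\<Sum>i<k. z i * \<omega> i v)"
      "\<forall>z. (\<forall>v. (\<Sum>i<k. z i * \<omega> i v) = 0) \<longrightarrow> (\<forall>i<k. z i = 0)"
      by (elim exE conjE) (rule that)
    have k: "\<omega> i \<in> L" "\<omega> i p = 0" if "i < k" for i using K(1) that by auto
    have gen: "\<exists>z. \<forall>v. x v = (\<Sum>i<k. z i * \<omega> i v)" if "x \<in> L" "x p = 0" for x
      using K(2) that by simp
    have indep: "\<forall>i<k. z i = 0" if "\<forall>v. (\<Sum>i<k. z i * \<omega> i v) = 0" for z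
      using K(3)[rule_format, OF that[rule_format]] by blast
    let ?b = "fun_upd \<omega> k w"
    have sum: "(\<Sum>i<Suc k. z i * ?b i v) = (\<Sum>i<k. z i * \<omega> i v) + z k * w v" for z v
      by simp
    show ?thesis
    proof (intro exI[of _ "Suc k"] exI[of _ ?b] conjI allI impI ballI)
      fix i assume "i < Suc k" then show "?b i \<in> L" using k w by auto
    next
      fix x assume x: "x \<in> L"
      obtain z where z: "\<And>v. x v - (x p div int d) * w v = (\<Sum>i<k. z i * \<omega> i v)"
        using gen[OF red[OF x]] by blast
      have "x v = (\<Sum>i<Suc k. (z(k := x p div int d)) i * ?b i v)" for v
        using z[of v] by (simp add: sum)
      then show "\<exists>z. \<forall>v. x v = (\<Sum>i<Suc k. z i * ?b i v)" by blast
    next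
      fix z i assume z: "\<forall>v. (\<Sum>i<Suc k. z i * ?b i v) = 0" and i: "i < Suc k"
      have "(\<Sum>i<k. z i * \<omega> i p) = 0" using k by simp
      then have zk: "z k = 0" using z[rule_format, of p] w d unfolding sum by simp
      then have "\<forall>i<k. z i = 0" using z unfolding sum by (intro indep) simp
      then show "z i = 0" using zk i by (auto simp: less_Suc_eq)
    qed
  qed
qed

lemma power_int_sum: "(x::'f::field) \<noteq> 0 \<Longrightarrow> x powi (\<Sum>i\<in>I. f i) = (\<Prod>i\<in>I. x powi f i)"
  by (induction I rule: infinite_finite_induct) (simp_all add: power_int_add)

lemma prod_power_int: "(\<Prod>i\<in>I. f i :: 'f::field) powi n = (\<Prod>i\<in>I. f i powi n)"
  by (induction I rule: infinite_finite_induct) (simp_all add: power_int_mult_distrib)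

lemma power_nat_eq: "0 \<le> n \<Longrightarrow> x ^ nat n = x powi n"
  by (simp add: power_int_def)

lemma mono_eval_sum: "mono_eval x (\<Sum>i\<in>I. f i) = (\<Prod>i\<in>I. mono_eval x (f i))"
  by (induction I rule: infinite_finite_induct) (simp_all add: mono_eval_add)

lemma lookup_sum_single: "lookup (\<Sum>j\<in>UNIV. Poly_Mapping.single j (f j)) (i::'v::finite) = f i"
  by (simp add: lookup_sum lookup_single when_def)

lemma alg_torus_mult: "s \<in> alg_torus k \<Longrightarrow> t \<in> alg_torus k \<Longrightarrow> (\<lambda>i. s i * t i) \<in> alg_torus k"
  by (auto simp: alg_torus_def)

text \<open>The family \<open>\<omega>\<close> is a basis of the lattice spanned by the differences of the exponents \<open>e j\<close> with
  \<open>c j \<noteq> 0\<close>. The matrix \<open>a\<close> expresses these differences in the basis, and \<open>n\<close> expresses the basis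
  in the exponents.\<close>

locale toric_basis = toric_data c e D
  for c :: "'m::finite \<Rightarrow> complex" and e :: "'m \<Rightarrow> ('n::{finite,linorder} \<Rightarrow>\<^sub>0 nat)" and D :: nat +
  fixes j0 :: 'm and k :: nat and \<omega> :: "nat \<Rightarrow> 'n \<Rightarrow> int" and a :: "'m \<Rightarrow> nat \<Rightarrow> int" and n :: "nat \<Rightarrow> 'm \<Rightarrow> int"
  assumes j0: "c j0 \<noteq> 0"
    and a: "c j \<noteq> 0 \<Longrightarrow> int (lookup (e j) v) - int (lookup (e j0) v) = (\<Sum>i<k. a j i * \<omega> i v)"
    and n_supp: "c j = 0 \<Longrightarrow> n i j = 0"
    and n_sum: "i < k \<Longrightarrow> (\<Sum>j\<in>UNIV. n i j) = 0"
    and n: "i < k \<Longrightarrow> \<omega> i v = (\<Sum>j\<in>UNIV. n i j * int (lookup (e j) v))"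
    and indep: "(\<And>v. (\<Sum>i<k. z i * \<omega> i v) = 0) \<Longrightarrow> i < k \<Longrightarrow> z i = 0"
begin

definition J :: "'m set" where "J = {j. c j \<noteq> 0}"

lemma sum_J: "(\<And>j. c j = 0 \<Longrightarrow> f j = (0::int)) \<Longrightarrow> (\<Sum>j\<in>UNIV. f j) = (\<Sum>j\<in>J. f j)"
  by (rule sum.mono_neutral_right) (auto simp: J_def)

text \<open>The character of coordinate \<open>j\<close> relative to coordinate \<open>j0\<close>,
  in terms of the lattice basis. Its value for \<open>c j = 0\<close> is harmless, as it only occurs
  multiplied by \<open>c j\<close>.\<close>

definition up :: "(nat \<Rightarrow> complex) \<Rightarrow> 'm \<Rightarrow> complex" where
  "up u j = (\<Prod>i<k. u i powi a j i)"

lemma up_nonzero: "u \<in> alg_torus k \<Longrightarrow> up u j \<noteq> 0"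
  by (auto simp: up_def alg_torus_def)

lemma up_mult: "up (\<lambda>i. s i * t i) j = up s j * up t j"
  by (simp add: up_def power_int_mult_distrib prod.distrib)

definition emb_vec :: "(nat \<Rightarrow> complex) \<Rightarrow> complex^'m" where
  "emb_vec u = (\<chi> j. c j * up u j)"

definition emb :: "(nat \<Rightarrow> complex) \<Rightarrow> (complex^'m) set" where
  "emb u = proj_point (emb_vec u)"

lemma emb_vec_nonzero: "u \<in> alg_torus k \<Longrightarrow> emb_vec u \<noteq> 0"
  using up_nonzero[of u j0] j0 by (auto simp: emb_vec_def vec_eq_iff)

text \<open>Inverse of \<open>emb\<close>: a basis vector of the lattice is a combination of
  exponents with coefficients \<open>n i\<close> of total 0, hence a Laurent monomial of degree 0 in
  the normalised coordinates.\<close>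

definition rho :: "complex^'m \<Rightarrow> nat \<Rightarrow> complex" where
  "rho v i = (if i < k then \<Prod>j\<in>J. (v $ j / c j) powi n i j else 1)"

text \<open>Expressing the basis in the exponents and these again in the basis gives the basis back,
  so independence applies. The reference exponent \<open>e j0\<close> drops out since
  \<open>n i\<close> has total 0.\<close>

lemma coordinates_unit:
  assumes "i < k" "i' < k"
  shows "(\<Sum>j\<in>J. n i j * a j i') = (if i' = i then 1 else 0)"
proof -
  define z where "z = (\<lambda>i'. (\<Sum>j\<in>J. n i j * a j i') - (if i' = i then 1 else 0))"
  have "(\<Sum>i'<k. z i' * \<omega> i' v) = 0" for v
  proof -
    have "(\<Sum>i'<k. z i' * \<omega> i' v) = (\<Sum>i'<k. \<Sum>j\<in>J. n i j * a j i' * \<omega> i' v) - \<omega> i v"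
      using assms(1) by (simp add: z_def left_diff_distrib sum_subtractf sum_distrib_right if_distrib[of "\<lambda>x. x * _"] cong: if_cong)
    also have "(\<Sum>i'<k. \<Sum>j\<in>J. n i j * a j i' * \<omega> i' v) = (\<Sum>j\<in>J. n i j * (\<Sum>i'<k. a j i' * \<omega> i' v))"
      by (subst sum.swap) (simp add: sum_distrib_left mult.assoc)
    also have "\<dots> = (\<Sum>j\<in>J. n i j * (int (lookup (e j) v) - int (lookup (e j0) v)))"
      by (intro sum.cong) (auto simp: a J_def)
    also have "\<dots> = (\<Sum>j\<in>J. n i j * int (lookup (e j) v)) - (\<Sum>j\<in>J. n i j) * int (lookup (e j0) v)"
      by (simp add: right_diff_distrib sum_subtractf sum_distrib_right)
    also have "(\<Sum>j\<in>J. n i j) = 0" using n_sum[OF assms(1)] sum_J[of "n i"] n_supp by simp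
    also have "(\<Sum>j\<in>J. n i j * int (lookup (e j) v)) = \<omega> i v"
      using n[OF assms(1)] sum_J[of "\<lambda>j. n i j * int (lookup (e j) v)"] n_supp by simp
    finally show ?thesis by simp
  qed
  then have "z i' = 0" using assms(2) by (rule indep[where z = z])
  then show ?thesis by (simp add: z_def)
qed

lemma rho_scale: "s \<noteq> 0 \<Longrightarrow> rho (s *s v) = rho v"
proof (rule ext)
  fix i assume s: "s \<noteq> 0"
  show "rho (s *s v) i = rho v i"
  proof (cases "i < k")
    case True
    have "(\<Sum>j\<in>J. n i j) = 0" using n_sum[OF True] sum_J[of "n i"] n_supp by simp
    then have "(\<Prod>j\<in>J. s powi n i j) = 1" using s by (simp add: power_int_sum[symmetric])
    moreover have "rho (s *s v) i = (\<Prod>j\<in>J. s powi n i j * (v $ j / c j) powi n i j)"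
      using True by (simp add: rho_def power_int_mult_distrib[symmetric])
    ultimately show ?thesis using True by (simp add: rho_def prod.distrib)
  qed (simp add: rho_def)
qed

lemma rho_emb_vec:
  assumes "u \<in> alg_torus k"
  shows "rho (emb_vec u) = u"
proof
  fix i
  show "rho (emb_vec u) i = u i"
  proof (cases "i < k")
    case True
    have u: "u i' \<noteq> 0" if "i' < k" for i' using assms that by (auto simp: alg_torus_def)
    have "rho (emb_vec u) i = (\<Prod>j\<in>J. \<Prod>i'<k. u i' powi (n i j * a j i'))"
      using True by (auto simp: rho_def emb_vec_def up_def J_def prod_power_int power_int_mult[symmetric] mult.commute intro!: prod.cong)
    also have "\<dots> = (\<Prod>i'<k. u i' powi (\<Sum>j\<in>J. n i j * a j i'))"
      by (subst prod.swap) (simp add: power_int_sum u)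
    also have "\<dots> = (\<Prod>i'<k. if i' = i then u i else 1)"
      using True by (intro prod.cong) (auto simp: coordinates_unit)
    finally show ?thesis using True by simp
  next
    case False
    then show ?thesis using assms by (simp add: rho_def alg_torus_def)
  qed
qed

text \<open>The point \<open>u\<close> is not lifted to a point of the ambient torus. For
  \<open>f\<close> homogeneous of degree \<open>d\<close>, the difference of \<open>expo m\<close>
  and \<open>d\<close> times \<open>e j0\<close> lies in the lattice whenever
  \<open>mono_eval c m\<close> is nonzero. So the value of \<open>up u\<close> on such a monomial
  depends only on \<open>expo m\<close>, and the cancellation behind \<open>Phi f = 0\<close>
  carries over.\<close>

lemma emb_in_Y:
  assumes "u \<in> alg_torus k"
  shows "emb u \<in> Y"
  unfolding emb_def in_Y_iff[OF emb_vec_nonzero[OF assms]]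
proof (intro allI impI)
  fix d f assume f: "homogeneous d f" and Phi: "Phi f = 0"
  have u: "u i' \<noteq> 0" if "i' < k" for i' using assms that by (auto simp: alg_torus_def)
  define Z where "Z = (\<lambda>\<alpha>. SOME z. \<forall>v. int (lookup \<alpha> v) - int d * int (lookup (e j0) v) = (\<Sum>i<k. z i * \<omega> i v))"
  define h where "h = (\<lambda>\<alpha>. \<Prod>i<k. u i powi Z \<alpha> i)"
  have h: "mono_eval c m * mono_eval (up u) m = mono_eval c m * h (expo m)" if m: "m \<in> keys f" for m
  proof (cases "mono_eval c m = 0")
    case False
    then have supp: "lookup m j = 0" if "c j = 0" for j
      using that by (auto simp: mono_eval_UNIV)
    define b where "b = (\<lambda>i. \<Sum>j\<in>UNIV. int (lookup m j) * a j i)"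
    have b: "int (lookup (expo m) v) - int d * int (lookup (e j0) v) = (\<Sum>i<k. b i * \<omega> i v)" for v
    proof -
      have "int d = (\<Sum>j\<in>UNIV. int (lookup m j))"
        using f m by (auto simp: homogeneous_iff tdeg_UNIV)
      then have "int (lookup (expo m) v) - int d * int (lookup (e j0) v)
        = (\<Sum>j\<in>UNIV. int (lookup m j) * (int (lookup (e j) v) - int (lookup (e j0) v)))"
        by (simp add: lookup_expo right_diff_distrib sum_subtractf sum_distrib_right)
      also have "\<dots> = (\<Sum>j\<in>UNIV. int (lookup m j) * (\<Sum>i<k. a j i * \<omega> i v))"
      proof (intro sum.cong refl)
        fix j show "int (lookup m j) * (int (lookup (e j) v) - int (lookup (e j0) v)) = int (lookup m j) * (\<Sum>i<k. a j i * \<omega> i v)"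
          by (cases "c j = 0") (simp_all add: supp a)
      qed
      also have "\<dots> = (\<Sum>i<k. b i * \<omega> i v)"
        unfolding b_def sum_distrib_left sum_distrib_right by (subst sum.swap) (simp add: mult.assoc)
      finally show ?thesis .
    qed
    then have "\<exists>z. \<forall>v. int (lookup (expo m) v) - int d * int (lookup (e j0) v) = (\<Sum>i<k. z i * \<omega> i v)"
      by blast
    then have "\<forall>v. int (lookup (expo m) v) - int d * int (lookup (e j0) v) = (\<Sum>i<k. Z (expo m) i * \<omega> i v)"
      unfolding Z_def by (rule someI_ex)
    then have "(\<Sum>i<k. (Z (expo m) i - b i) * \<omega> i v) = 0" for v
      using b[of v] by (simp add: left_diff_distrib sum_subtractf)
    then have "Z (expo m) i - b i = 0" if "i < k" for i
      using that by (rule indep[where z = "\<lambda>i. Z (expo m) i - b i"])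
    then have "h (expo m) = (\<Prod>i<k. u i powi b i)" by (simp add: h_def)
    also have "\<dots> = (\<Prod>j\<in>UNIV. \<Prod>i<k. u i powi (int (lookup m j) * a j i))"
      by (subst prod.swap) (simp add: b_def power_int_sum u)
    also have "\<dots> = mono_eval (up u) m"
      unfolding mono_eval_UNIV up_def prod_power_distrib
      by (intro prod.cong refl) (simp add: power_int_mult mult.commute)
    finally show ?thesis by simp
  qed simp
  have "(\<Sum>m\<in>keys f. lookup f m * mono_eval c m * h (expo m)) = 0"
    using Phi by (intro sum_single_eq_0) (simp_all add: Phi_eq)
  moreover have "mono_eval (($) (emb_vec u)) m = mono_eval c m * mono_eval (up u) m" for m
    by (simp add: emb_vec_def mono_eval_UNIV power_mult_distrib prod.distrib)
  ultimately show "peval f (($) (emb_vec u)) = 0"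
    unfolding peval_eq_sum by (simp add: h mult.assoc)
qed

text \<open>Taking for \<open>u i\<close> the value of the character \<open>\<omega> i\<close> at
  \<open>t\<close>, the vectors \<open>pt t\<close> and \<open>emb_vec u\<close> differ by the
  factor \<open>mono_eval t (e j0)\<close>.\<close>

lemma torus_points_subset_emb: "torus_points \<subseteq> emb ` alg_torus k"
proof
  fix L assume "L \<in> torus_points"
  then obtain t where t: "\<And>v. t v \<noteq> 0" "L = proj_point (pt t)" by (auto simp: torus_points_def)
  define u where "u = (\<lambda>i. if i < k then \<Prod>v\<in>UNIV. t v powi \<omega> i v else 1)"
  have u: "u \<in> alg_torus k" using t by (auto simp: alg_torus_def u_def)
  have "up u j = mono_eval t (e j) / mono_eval t (e j0)" if "c j \<noteq> 0" for j
  proof -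
    have "up u j = (\<Prod>i<k. \<Prod>v\<in>UNIV. t v powi (a j i * \<omega> i v))"
      by (simp add: up_def u_def prod_power_int power_int_mult[symmetric] mult.commute)
    also have "\<dots> = (\<Prod>v\<in>UNIV. t v powi (int (lookup (e j) v) - int (lookup (e j0) v)))"
      by (subst prod.swap) (simp add: a[OF that] power_int_sum t)
    also have "\<dots> = mono_eval t (e j) / mono_eval t (e j0)"
      by (simp add: power_int_diff t mono_eval_UNIV prod_dividef)
    finally show ?thesis .
  qed
  then have "c j * mono_eval t (e j) = mono_eval t (e j0) * (c j * up u j)" for j
    using t by (cases "c j = 0") (auto simp: mono_eval_UNIV)
  then have "pt t = mono_eval t (e j0) *s emb_vec u" by (simp add: pt_def emb_vec_def vec_eq_iff)
  then have "L = emb u" unfolding t(2) emb_def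
    using t(1) by (intro proj_point_eqI[of "mono_eval t (e j0)"]) (auto simp: mono_eval_UNIV)
  then show "L \<in> emb ` alg_torus k" using u by blast
qed

text \<open>The positive and the negative part of \<open>z\<close> are monomials of equal degree and
  equal exponent, so the difference of their normalised versions is an equation of
  \<open>Y\<close>.\<close>

lemma binomial_relation:
  assumes v: "v \<noteq> 0" "proj_point v \<in> Y" "\<And>j. j \<in> J \<Longrightarrow> v $ j \<noteq> 0"
    and z: "\<And>j. j \<notin> J \<Longrightarrow> z j = 0" "(\<Sum>j\<in>UNIV. z j) = 0" "\<And>w. (\<Sum>j\<in>UNIV. z j * int (lookup (e j) w)) = 0"
  shows "(\<Prod>j\<in>J. (v $ j / c j) powi z j) = 1"
proof -
  define p where "p = (\<Sum>j\<in>UNIV. Poly_Mapping.single j (nat (z j)))"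
  define q where "q = (\<Sum>j\<in>UNIV. Poly_Mapping.single j (nat (- z j)))"
  have lp: "lookup p j = nat (z j)" "lookup q j = nat (- z j)" for j
    by (simp_all only: p_def q_def lookup_sum_single)
  have zpq: "z j = int (lookup p j) - int (lookup q j)" for j by (simp add: lp)
  have "int (tdeg p) - int (tdeg q) = 0"
    using z(2) by (simp add: tdeg_UNIV zpq sum_subtractf)
  then have deg: "tdeg q = tdeg p" by simp
  have "int (lookup (expo p) w) - int (lookup (expo q) w) = 0" for w
    using z(3)[of w] by (simp add: lookup_expo zpq left_diff_distrib sum_subtractf)
  then have ex: "expo q = expo p" by (intro poly_mapping_eqI) (metis eq_iff_diff_eq_0 of_nat_eq_iff)
  have cz: "mono_eval c p \<noteq> 0" "mono_eval c q \<noteq> 0"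
    using z(1) by (auto simp: mono_eval_UNIV lp J_def)
  define f where "f = Poly_Mapping.single p (1 / mono_eval c p) - Poly_Mapping.single q (1 / mono_eval c q)"
  have hom: "homogeneous (tdeg p) f"
    unfolding f_def using deg by (intro homogeneous_diff homogeneous_single) auto
  have "Phi f = 0"
    unfolding f_def using cz by (simp add: mono_eval_Phi mult_single ex)
  then have "peval f (($) v) = 0" using in_Y_iff[OF v(1)] v(2) hom by blast
  then have eq: "mono_eval (($) v) p / mono_eval c p = mono_eval (($) v) q / mono_eval c q"
    by (simp add: f_def)
  have quot: "mono_eval (($) v) m / mono_eval c m = (\<Prod>j\<in>J. (v $ j / c j) ^ lookup m j)" if "\<And>j. j \<notin> J \<Longrightarrow> lookup m j = 0" for m
  proof -
    have "keys m \<subseteq> J" using that by (auto simp: in_keys_iff)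
    then show ?thesis by (simp add: mono_eval_superset[of J] prod_dividef[symmetric] power_divide)
  qed
  have "(\<Prod>j\<in>J. (v $ j / c j) powi z j) = (\<Prod>j\<in>J. (v $ j / c j) ^ lookup p j / (v $ j / c j) ^ lookup q j)"
    unfolding zpq by (intro prod.cong refl, subst power_int_diff) (use v(3) J_def in auto)
  also have "\<dots> = (mono_eval (($) v) p / mono_eval c p) / (mono_eval (($) v) q / mono_eval c q)"
    using z(1) by (simp add: prod_dividef quot lp)
  also have "\<dots> = 1"
  proof -
    have "v $ j ^ nat (- z j) \<noteq> 0" for j using v(3)[of j] z(1)[of j] by (cases "j \<in> J") auto
    then show ?thesis unfolding eq using cz by (simp add: mono_eval_UNIV lp)
  qed
  finally show ?thesis .
qed

lemma Y_coordinate_0: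
  assumes "v \<noteq> 0" "proj_point v \<in> Y" "j \<notin> J"
  shows "v $ j = 0"
proof -
  have "Phi (pvar j) = 0" using assms(3) by (simp add: J_def mono_eval_Phi)
  then have "peval (pvar j) (($) v) = 0"
    by (rule in_Y_iff[OF assms(1), THEN iffD1, rule_format, OF assms(2) homogeneous_pvar])
  then show ?thesis by simp
qed

lemma rho_in_torus:
  assumes "\<And>j. j \<in> J \<Longrightarrow> v $ j \<noteq> 0"
  shows "rho v \<in> alg_torus k"
  using assms by (auto simp: alg_torus_def rho_def J_def)

lemma emb_rho:
  assumes v: "v \<noteq> 0" "proj_point v \<in> Y" "\<And>j. j \<in> J \<Longrightarrow> v $ j \<noteq> 0"
  shows "proj_point v = emb (rho v)"
proof -
  define w where "w = (\<lambda>j. v $ j / c j)"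
  have w: "w j \<noteq> 0" if "j \<in> J" for j using v(3)[OF that] that by (simp add: w_def J_def)
  have main: "w j = up (rho v) j * w j0" if j: "j \<in> J" for j
  proof -
    \<comment> \<open>The relation saying that the combination of exponents with coefficients
      \<open>a j i * n i j'\<close> equals \<open>e j - e j0\<close>.\<close>
    define z where "z = (\<lambda>j'. (\<Sum>i<k. n i j' * a j i) + ((if j' = j0 then 1 else 0) - (if j' = j then 1 else 0)))"
    have "(\<Prod>j'\<in>J. w j' powi z j') = 1"
      unfolding w_def
    proof (rule binomial_relation[OF v])
      show "z j' = 0" if "j' \<notin> J" for j'
        using that j j0 n_supp by (auto simp: z_def J_def)
      have "(\<Sum>j'\<in>UNIV. \<Sum>i<k. n i j' * a j i) = (\<Sum>i<k. (\<Sum>j'\<in>UNIV. n i j') * a j i)"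
        unfolding sum_distrib_right by (rule sum.swap)
      then show "(\<Sum>j'\<in>UNIV. z j') = 0" by (simp add: z_def sum.distrib sum_subtractf n_sum)
      fix x
      have "(\<Sum>j'\<in>UNIV. (\<Sum>i<k. n i j' * a j i) * int (lookup (e j') x)) = (\<Sum>i<k. a j i * (\<Sum>j'\<in>UNIV. n i j' * int (lookup (e j') x)))"
        unfolding sum_distrib_right sum_distrib_left by (subst sum.swap) (simp add: mult_ac)
      also have "\<dots> = (\<Sum>i<k. a j i * \<omega> i x)" by (intro sum.cong) (auto simp: n)
      also have "\<dots> = int (lookup (e j) x) - int (lookup (e j0) x)" using a j by (simp add: J_def)
      finally show "(\<Sum>j'\<in>UNIV. z j' * int (lookup (e j') x)) = 0"
        by (simp add: z_def distrib_right left_diff_distrib sum.distrib sum_subtractf if_distrib[of "\<lambda>y. y * _"] cong: if_cong)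
    qed
    also have "(\<Prod>j'\<in>J. w j' powi z j') = (\<Prod>j'\<in>J. w j' powi (\<Sum>i<k. n i j' * a j i)) *
       ((\<Prod>j'\<in>J. if j' = j0 then w j0 else 1) / (\<Prod>j'\<in>J. if j' = j then w j else 1))"
      unfolding prod_dividef[symmetric] prod.distrib[symmetric] z_def
      using w by (intro prod.cong) (auto simp: power_int_add power_int_diff)
    also have "\<dots> = (\<Prod>j'\<in>J. w j' powi (\<Sum>i<k. n i j' * a j i)) * (w j0 / w j)"
      using j j0 by (simp add: J_def)
    also have "(\<Prod>j'\<in>J. w j' powi (\<Sum>i<k. n i j' * a j i)) = (\<Prod>i<k. \<Prod>j'\<in>J. w j' powi (n i j' * a j i))"
      by (subst prod.swap) (simp add: power_int_sum w)
    also have "\<dots> = up (rho v) j"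
      by (simp add: up_def rho_def prod_power_int power_int_mult w_def)
    finally show ?thesis using w[OF j] by (simp add: field_simps)
  qed
  have "v = w j0 *s emb_vec (rho v)"
  proof (simp add: vec_eq_iff emb_vec_def, intro allI)
    fix j
    show "v $ j = w j0 * (c j * up (rho v) j)"
    proof (cases "j \<in> J")
      case True
      then have "v $ j = c j * w j" by (simp add: w_def J_def)
      then show ?thesis using main[OF True] by simp
    next
      case False
      then show ?thesis using Y_coordinate_0[OF v(1,2) False] by (simp add: J_def)
    qed
  qed
  then show ?thesis unfolding emb_def using w j0 by (intro proj_point_eqI[of "w j0"]) (auto simp: J_def)
qed

text \<open>Shows that the torus is open in \<open>Y\<close>: where no coordinate in
  \<open>J\<close> vanishes, \<open>rho\<close> recovers a parameter.\<close>

lemma emb_image: "emb ` alg_torus k = Y \<inter> basic_open (\<Prod>j\<in>J. pvar j)"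
proof (intro subset_antisym subsetI)
  fix L assume "L \<in> emb ` alg_torus k"
  then obtain u where u: "u \<in> alg_torus k" "L = emb u" by auto
  have "emb u \<in> basic_open (\<Prod>j\<in>J. pvar j)"
    unfolding emb_def proj_point_in_basic_open[OF homogeneous_prod_pvar emb_vec_nonzero[OF u(1)]]
    using up_nonzero[OF u(1)] by (simp add: emb_vec_def J_def)
  then show "L \<in> Y \<inter> basic_open (\<Prod>j\<in>J. pvar j)" using u emb_in_Y by auto
next
  fix L assume L: "L \<in> Y \<inter> basic_open (\<Prod>j\<in>J. pvar j)"
  then obtain v where v: "v \<noteq> 0" "L = proj_point v" using Y_subset by (auto simp: proj_space_def)
  have vj: "v $ j \<noteq> 0" if "j \<in> J" for j
    using L that unfolding v(2) Int_iff proj_point_in_basic_open[OF homogeneous_prod_pvar v(1)] by simp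
  then show "L \<in> emb ` alg_torus k" using emb_rho[OF v(1)] rho_in_torus[of v] L v by auto
qed

text \<open>Large enough to make every exponent \<open>M + a j i\<close> nonnegative, so that
  polynomials can express the morphisms. The shift multiplies all coordinates by one nonzero
  factor.\<close>

definition M :: int where "M = (\<Sum>j\<in>UNIV. \<Sum>i<k. \<bar>a j i\<bar>)"

lemma M: "i < k \<Longrightarrow> 0 \<le> M + a j i"
proof -
  assume "i < k"
  then have "\<bar>a j i\<bar> \<le> (\<Sum>i<k. \<bar>a j i\<bar>)" by (intro member_le_sum) auto
  also have "\<dots> \<le> M" unfolding M_def by (intro member_le_sum) (auto intro: sum_nonneg)
  finally show ?thesis by linarith
qed

definition ups :: "(nat \<Rightarrow> complex) \<Rightarrow> 'm \<Rightarrow> complex" where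
  "ups u j = (\<Prod>i<k. u i ^ nat (M + a j i))"

lemma ups: "u \<in> alg_torus k \<Longrightarrow> ups u j = (\<Prod>i<k. u i powi M) * up u j"
  unfolding ups_def up_def prod.distrib[symmetric]
  by (intro prod.cong) (auto simp: alg_torus_def M power_nat_eq power_int_add)

lemma ups_factor: "u \<in> alg_torus k \<Longrightarrow> (\<Prod>i<k. u i powi M) \<noteq> 0"
  by (auto simp: alg_torus_def)

lemma torus_morphism_emb: "torus_morphism k Y emb"
  unfolding torus_morphism_def
proof (intro conjI ballI)
  fix t\<^sub>0 assume t0: "t\<^sub>0 \<in> alg_torus k"
  define F where "F = (\<lambda>j. Poly_Mapping.single (\<Sum>i<k. Poly_Mapping.single i (nat (M + a j i))) (c j))"
  have F: "peval (F j) t = c j * ups t j" for j t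
    by (simp add: F_def mono_eval_sum ups_def)
  show "\<exists>F. (\<exists>j. peval (F j) t\<^sub>0 \<noteq> 0) \<and> (\<forall>t\<in>alg_torus k. (\<exists>j. peval (F j) t \<noteq> 0) \<longrightarrow>
      emb t = proj_point (\<chi> j. peval (F j) t))"
  proof (intro exI[of _ F] conjI ballI impI)
    show "\<exists>j. peval (F j) t\<^sub>0 \<noteq> 0"
      unfolding F using j0 ups[OF t0] up_nonzero[OF t0] ups_factor[OF t0] by (intro exI[of _ j0]) simp
    fix t assume t: "t \<in> alg_torus k"
    have "proj_point (\<chi> j. peval (F j) t) = proj_point (emb_vec t)"
      using ups_factor[OF t] by (intro proj_point_eqI[of "\<Prod>i<k. t i powi M"]) (auto simp: vec_eq_iff F emb_vec_def ups[OF t])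
    then show "emb t = proj_point (\<chi> j. peval (F j) t)" by (simp add: emb_def)
  qed
qed (rule emb_in_Y)

lemma rho_emb:
  assumes "u \<in> alg_torus k" "emb u = proj_point v" "v \<noteq> 0"
  shows "rho v = u"
proof -
  obtain s where "s \<noteq> 0" "v = s *s emb_vec u"
    using proj_point_eqD[of v "emb_vec u"] assms by (auto simp: emb_def)
  then show ?thesis using rho_scale rho_emb_vec assms(1) by simp
qed

lemma inj_emb: "inj_on emb (alg_torus k)"
  using rho_emb[OF _ _ emb_vec_nonzero] by (intro inj_onI) (metis emb_def)

text \<open>The inverse is a coordinate of \<open>rho\<close>. Since \<open>n i\<close> has total 0,
  its positive and negative parts yield a numerator and a denominator of one degree, valid on the
  whole torus at once.\<close>

lemma regular_inverse:
  assumes "i < k"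
  shows "regular_function (emb ` alg_torus k) (\<lambda>x. inv_into (alg_torus k) emb x i)"
  unfolding regular_function_def
proof (intro ballI exI[of _ "emb ` alg_torus k"] conjI)
  define N where "N = (\<lambda>m::'m \<Rightarrow> nat. \<Sum>j\<in>UNIV. Poly_Mapping.single j (m j))"
  define f where "f = (\<lambda>m. Poly_Mapping.single (N m) (1 / mono_eval c (N m)))"
  have lN: "lookup (N m) j = m j" for m j by (simp only: N_def lookup_sum_single)
  have tN: "tdeg (N m) = (\<Sum>j\<in>UNIV. m j)" for m by (simp add: tdeg_UNIV lN)
  define p q where "p = (\<lambda>j. nat (n i j))" and "q = (\<lambda>j. nat (- n i j))"
  have npq: "n i j = int (p j) - int (q j)" for j by (simp add: p_def q_def)
  have "int (tdeg (N p)) - int (tdeg (N q)) = 0"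
    using n_sum[OF assms] by (simp add: tN npq sum_subtractf)
  then have deg: "tdeg (N q) = tdeg (N p)" by simp
  have pf: "peval (f m) (($) v) = (\<Prod>j\<in>J. (v $ j / c j) ^ m j)" if "\<And>j. j \<notin> J \<Longrightarrow> m j = 0" for m v
  proof -
    have "keys (N m) \<subseteq> J" using that by (metis in_keys_iff lN subsetI)
    then show ?thesis by (simp add: f_def mono_eval_superset[of J] prod_dividef[symmetric] power_divide lN)
  qed
  have pq0: "p j = 0" "q j = 0" if "j \<notin> J" for j using that n_supp by (auto simp: p_def q_def J_def)
  show "openin (subtopology zariski (emb ` alg_torus k)) (emb ` alg_torus k)"
    using emb_image Y_subset unfolding openin_subtopology
    by (intro exI[of _ "topspace zariski"]) (auto simp: topspace_zariski[symmetric])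
  fix x assume "x \<in> emb ` alg_torus k" then show "x \<in> emb ` alg_torus k" .
  show "\<exists>d f g. homogeneous d f \<and> homogeneous d g \<and> (\<forall>v. v \<noteq> 0 \<longrightarrow> proj_point v \<in> emb ` alg_torus k \<longrightarrow>
      peval g (($) v) \<noteq> 0 \<and> inv_into (alg_torus k) emb (proj_point v) i = peval f (($) v) / peval g (($) v))"
  proof (intro exI conjI allI impI)
    show "homogeneous (tdeg (N p)) (f p)" "homogeneous (tdeg (N p)) (f q)"
      using deg by (simp_all add: f_def homogeneous_single)
    fix v :: "complex^'m" assume v: "v \<noteq> 0" "proj_point v \<in> emb ` alg_torus k"
    have vj: "v $ j \<noteq> 0" if "j \<in> J" for j
      using v(2) that unfolding emb_image Int_iff proj_point_in_basic_open[OF homogeneous_prod_pvar v(1)] by simp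
    show "peval (f q) (($) v) \<noteq> 0" using vj pq0 by (simp add: pf) (simp add: J_def)
    obtain u where u: "u \<in> alg_torus k" "proj_point v = emb u" using v(2) by auto
    have "inv_into (alg_torus k) emb (proj_point v) i = rho v i"
      using u rho_emb[OF u(1) _ v(1)] by (simp add: inv_into_f_f[OF inj_emb])
    also have "\<dots> = (\<Prod>j\<in>J. (v $ j / c j) ^ p j / (v $ j / c j) ^ q j)"
      using assms vj unfolding rho_def npq by (simp, intro prod.cong refl, subst power_int_diff) (auto simp: J_def)
    also have "\<dots> = peval (f p) (($) v) / peval (f q) (($) v)"
      using pq0 by (simp add: pf prod_dividef)
    finally show "inv_into (alg_torus k) emb (proj_point v) i = peval (f p) (($) v) / peval (f q) (($) v)" .
  qed
qed

lemma dense_torus_embedding_emb: "dense_torus_embedding k Y emb"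
  unfolding dense_torus_embedding_def
proof (intro conjI allI impI)
  show "openin (subtopology zariski Y) (emb ` alg_torus k)"
    unfolding emb_image openin_subtopology using openin_basic_open[OF homogeneous_prod_pvar] by blast
  show "Y \<subseteq> zariski closure_of (emb ` alg_torus k)"
    unfolding Y_def by (intro closure_of_mono torus_points_subset_emb)
qed (simp_all add: torus_morphism_emb inj_emb regular_inverse)

section \<open>The action of the torus on the closure\<close>

definition act :: "(nat \<Rightarrow> complex) \<Rightarrow> (complex^'m) set \<Rightarrow> (complex^'m) set" where
  "act u L = (\<lambda>v. \<chi> j. up u j * v $ j) ` L"

lemma act_proj_point: "act u (proj_point v) = proj_point (\<chi> j. up u j * v $ j)"
  by (auto simp: act_def vec.span_singleton image_image vec_eq_iff intro!: image_cong)

lemma act_emb: "act s (emb t) = emb (\<lambda>i. s i * t i)"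
  by (simp add: emb_def act_proj_point emb_vec_def up_mult mult_ac)

text \<open>The pull-back \<open>f'\<close> of an equation \<open>f\<close> along the diagonal map
  is homogeneous of the same degree. It vanishes at torus points because they lie in the image of
  \<open>emb\<close>, which the action preserves, and so it vanishes on all of
  \<open>Y\<close>.\<close>

lemma act_in_Y:
  assumes u: "u \<in> alg_torus k" and "L \<in> Y"
  shows "act u L \<in> Y"
proof -
  obtain v where v: "v \<noteq> 0" "L = proj_point v" using assms Y_subset by (auto simp: proj_space_def)
  define v' where "v' = (\<chi> j. up u j * v $ j)"
  have "v' \<noteq> 0" using v(1) up_nonzero[OF u] by (auto simp: v'_def vec_eq_iff)
  have "peval f (($) v') = 0" if f: "homogeneous d f" "Phi f = 0" for d f
  proof -
    define f' where "f' = (\<Sum>m\<in>keys f. Poly_Mapping.single m (lookup f m * mono_eval (up u) m))"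
    have f': "peval f' (($) w) = peval f (($) (\<chi> j. up u j * w $ j))" for w
      by (simp add: f'_def peval_eq_sum[of f] mono_eval_UNIV power_mult_distrib prod.distrib mult_ac)
    have "lookup f' m = 0" if "m \<notin> keys f" for m
      using that by (auto simp: f'_def lookup_sum lookup_single when_def intro!: sum.neutral)
    then have "keys f' \<subseteq> keys f" by (auto simp: in_keys_iff)
    then have hom: "homogeneous d f'" using f(1) by (auto simp: homogeneous_iff)
    have "Phi f' = 0"
      unfolding Phi_eq_0_iff
    proof (intro allI impI)
      fix t :: "'n \<Rightarrow> complex" assume t: "\<forall>i. t i \<noteq> 0"
      have "proj_point (pt t) \<in> emb ` alg_torus k"
        using t torus_points_subset_emb by (auto simp: torus_points_def)
      then obtain s where s: "s \<in> alg_torus k" "proj_point (pt t) = emb s" by auto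
      have "act u (proj_point (pt t)) \<in> Y"
        unfolding s(2) act_emb by (intro emb_in_Y alg_torus_mult u s)
      moreover have "(\<chi> j. up u j * pt t $ j) \<noteq> 0"
        using pt_nonzero t up_nonzero[OF u] by (auto simp: vec_eq_iff)
      ultimately show "peval f' (($) (pt t)) = 0"
        unfolding f' act_proj_point using in_Y_iff f by blast
    qed
    then have "peval f' (($) v) = 0" using in_Y_iff[OF v(1)] assms(2) v(2) hom by blast
    then show ?thesis by (simp add: f' v'_def)
  qed
  then show ?thesis unfolding v(2) act_proj_point using in_Y_iff[OF \<open>v' \<noteq> 0\<close>] v'_def by blast
qed

lemma action_morphism_act: "action_morphism k Y act"
  unfolding action_morphism_def
proof (intro conjI ballI allI impI)
  fix t\<^sub>0 and v\<^sub>0 :: "complex^'m" assume t0: "t\<^sub>0 \<in> alg_torus k" and v0: "v\<^sub>0 \<noteq> 0"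
  define F :: "'m \<Rightarrow> (nat + 'm) cpoly" where
    "F = (\<lambda>j. Poly_Mapping.single ((\<Sum>i<k. Poly_Mapping.single (Inl i) (nat (M + a j i))) + Poly_Mapping.single (Inr j) 1) 1)"
  have F: "peval (F j) (case_sum t (($) v)) = ups t j * v $ j" for j t v
    by (simp add: F_def mono_eval_sum mono_eval_add ups_def)
  show "\<exists>d F. (\<forall>j. homogeneous_in (range Inr) d (F j)) \<and>
     (\<exists>j. peval (F j) (case_sum t\<^sub>0 (($) v\<^sub>0)) \<noteq> 0) \<and>
     (\<forall>t\<in>alg_torus k. \<forall>v. v \<noteq> 0 \<longrightarrow> proj_point v \<in> Y \<longrightarrow> (\<exists>j. peval (F j) (case_sum t (($) v)) \<noteq> 0) \<longrightarrow>
         act t (proj_point v) = proj_point (\<chi> j. peval (F j) (case_sum t (($) v))))"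
  proof (intro exI[of _ "1::nat"] exI[of _ F] conjI allI ballI impI)
    fix j
    let ?m = "(\<Sum>i<k. Poly_Mapping.single (Inl i) (nat (M + a j i))) + Poly_Mapping.single (Inr j) 1 :: (nat + 'm) \<Rightarrow>\<^sub>0 nat"
    have lm: "lookup ?m (Inr j') = (if j' = j then 1 else 0)" for j'
      by (simp add: lookup_add lookup_sum lookup_single when_def)
    have "keys ?m \<inter> range Inr = {Inr j}" using lm by (auto simp: in_keys_iff split: if_splits)
    then have "(\<Sum>v\<in>keys ?m \<inter> range Inr. lookup ?m v) = 1" using lm by simp
    then show "homogeneous_in (range Inr) 1 (F j)" by (simp add: F_def homogeneous_in_def)
  next
    obtain j where "v\<^sub>0 $ j \<noteq> 0" using v0 by (auto simp: vec_eq_iff)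
    then show "\<exists>j. peval (F j) (case_sum t\<^sub>0 (($) v\<^sub>0)) \<noteq> 0"
      unfolding F using ups[OF t0] up_nonzero[OF t0] ups_factor[OF t0] by (intro exI[of _ j]) simp
  next
    fix t and v :: "complex^'m" assume t: "t \<in> alg_torus k"
    have "proj_point (\<chi> j. ups t j * v $ j) = proj_point (\<chi> j. up t j * v $ j)"
      using ups_factor[OF t] by (intro proj_point_eqI[of "\<Prod>i<k. t i powi M"]) (auto simp: vec_eq_iff ups[OF t])
    then show "act t (proj_point v) = proj_point (\<chi> j. peval (F j) (case_sum t (($) v)))"
      by (simp add: F act_proj_point)
  qed
qed (rule act_in_Y)

lemma toric_variety_Y_aux: "toric_variety Y"
  unfolding toric_variety_def
proof (intro conjI exI[of _ k] exI[of _ emb] exI[of _ act] ballI)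
  show "act (\<lambda>i. 1) x = x" for x by (simp add: act_def up_def)
  show "act (\<lambda>i. s i * t i) x = act s (act t x)" for s t x
    by (simp add: act_def up_mult image_image mult_ac)
qed (simp_all add: closed_subvariety_Y dense_torus_embedding_emb action_morphism_act act_emb)

end

lemma (in toric_data) toric_variety_Y: "toric_variety Y"
proof -
  obtain j0 where j0: "c j0 \<noteq> 0" using nontrivial by blast
  \<comment> \<open>Combinations of exponents with total coefficient 0 are the combinations of their
    differences; keeping the coefficients supplies the matrix \<open>n\<close>.\<close>
  define Z where "Z = {z :: 'm \<Rightarrow> int. (\<forall>j. c j = 0 \<longrightarrow> z j = 0) \<and> (\<Sum>j\<in>UNIV. z j) = 0}"
  define lat where "lat = (\<lambda>(z :: 'm \<Rightarrow> int) v. \<Sum>j\<in>UNIV. z j * int (lookup (e j) v))"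
  define L where "L = lat ` Z"
  have "\<exists>(k::nat) \<omega>. (\<forall>i<k. \<omega> i \<in> L) \<and> (\<forall>x\<in>L. \<exists>z. \<forall>v. x v = (\<Sum>i<k. z i * \<omega> i v)) \<and>
    (\<forall>z. (\<forall>v. (\<Sum>i<k. z i * \<omega> i v) = 0) \<longrightarrow> (\<forall>i<k. z i = 0))"
  proof (rule lattice_basis[of UNIV])
    show "(\<lambda>_. 0) \<in> L" unfolding L_def by (rule image_eqI[of _ _ "\<lambda>_. 0"]) (auto simp: lat_def Z_def)
    fix x y assume "x \<in> L" "y \<in> L"
    then obtain z z' where z: "z \<in> Z" "x = lat z" "z' \<in> Z" "y = lat z'" by (auto simp: L_def)
    show "(\<lambda>v. x v - y v) \<in> L" unfolding L_def
      by (rule image_eqI[of _ _ "\<lambda>j. z j - z' j"]) (use z in \<open>auto simp: lat_def Z_def left_diff_distrib sum_subtractf\<close>)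
  qed auto
  then obtain k :: nat and \<omega> where K: "\<forall>i<k. \<omega> i \<in> L"
      "\<forall>x\<in>L. \<exists>z. \<forall>v. x v = (\<Sum>i<k. z i * \<omega> i v)"
      "\<forall>z. (\<forall>v. (\<Sum>i<k. z i * \<omega> i v) = 0) \<longrightarrow> (\<forall>i<k. z i = 0)"
    by (elim exE conjE) (rule that)
  have "\<exists>n. \<forall>i<k. n i \<in> Z \<and> \<omega> i = lat (n i)"
    using K(1) unfolding L_def by (intro choice_iff[THEN iffD1] allI) blast
  then obtain n0 where n0: "\<And>i. i < k \<Longrightarrow> n0 i \<in> Z \<and> \<omega> i = lat (n0 i)" by blast
  \<comment> \<open>Zero from \<open>k\<close> on, because the support condition of
    \<open>toric_basis\<close> is imposed for every index.\<close>
  define n where "n = (\<lambda>i. if i < k then n0 i else (\<lambda>_. 0))"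
  have "\<exists>z. \<forall>v. int (lookup (e j) v) - int (lookup (e j0) v) = (\<Sum>i<k. z i * \<omega> i v)" if "c j \<noteq> 0" for j
  proof -
    define z where "z = (\<lambda>j'. (if j' = j then 1 else 0) - (if j' = j0 then 1 else 0) :: int)"
    have "z \<in> Z" using that j0 by (auto simp: Z_def z_def sum_subtractf)
    moreover have "lat z v = int (lookup (e j) v) - int (lookup (e j0) v)" for v
      by (simp add: lat_def z_def left_diff_distrib sum_subtractf if_distrib[of "\<lambda>y. y * _"] cong: if_cong)
    moreover have "\<exists>x. \<forall>v. lat z v = (\<Sum>i<k. x i * \<omega> i v)"
      using K(2) \<open>z \<in> Z\<close> unfolding L_def by blast
    ultimately show ?thesis by simp
  qed
  then have "\<exists>a. \<forall>j. c j \<noteq> 0 \<longrightarrow> (\<forall>v. int (lookup (e j) v) - int (lookup (e j0) v) = (\<Sum>i<k. a j i * \<omega> i v))"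
    by (intro choice_iff[THEN iffD1] allI) blast
  then obtain a where a: "\<And>j v. c j \<noteq> 0 \<Longrightarrow> int (lookup (e j) v) - int (lookup (e j0) v) = (\<Sum>i<k. a j i * \<omega> i v)"
    by blast
  interpret toric_basis c e D j0 k \<omega> a n
  proof
    show "n i j = 0" if "c j = 0" for i j using n0[of i] that by (auto simp: n_def Z_def)
    show "(\<Sum>j\<in>UNIV. n i j) = 0" if "i < k" for i using n0[OF that] that by (auto simp: n_def Z_def)
    show "\<omega> i v = (\<Sum>j\<in>UNIV. n i j * int (lookup (e j) v))" if "i < k" for i v
      using n0[OF that] that by (auto simp: n_def lat_def)
    show "z i = 0" if "\<And>v. (\<Sum>i<k. z i * \<omega> i v) = 0" "i < k" for z i
      using K(3)[rule_format, OF that] .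
  qed (use j0 a in auto)
  show ?thesis by (rule toric_variety_Y_aux)
qed

section \<open>Rank functions and minors\<close>

definition vanish :: "'n set \<Rightarrow> (complex^'n) set" where
  "vanish A = {v. \<forall>i\<in>A. v $ i = 0}"

definition col_space :: "'n set \<Rightarrow> complex^'n^'n \<Rightarrow> (complex^'n) set" where
  "col_space K h = {h *v x | x. x \<in> vanish (- K)}"

lemma subspace_vanish: "vec.subspace (vanish A)"
  by (auto simp: vec.subspace_def vanish_def)

lemma vanish_Un: "vanish (A \<union> B) = vanish A \<inter> vanish B"
  by (auto simp: vanish_def)

lemma vanish_UNIV: "vanish UNIV = {0}"
  by (auto simp: vanish_def vec_eq_iff)

lemma vanish_empty: "vanish {} = UNIV"
  by (auto simp: vanish_def)

lemma dim_vanish: "vec.dim (vanish A :: (complex^'n) set) = card (- A)"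
  using dim_substandard_cart[of "- A", where 'a = complex] by (simp add: vanish_def Ball_def)

lemma card_compl: "card (- A) = CARD('a) - card A" for A :: "'a::finite set"
  by (simp add: Compl_eq_Diff_UNIV card_Diff_subset)

lemma col_space_image: "col_space K h = (*v) h ` vanish (- K)"
  by (auto simp: col_space_def)

lemma subspace_col_space: "vec.subspace (col_space K h)"
  unfolding col_space_image by (intro vec.subspace_image matrix_vector_mul_linear_gen subspace_vanish)

lemma dim_col_space:
  fixes h :: "complex^'n^'n"
  assumes "invertible h"
  shows "vec.dim (col_space K h) = card K"
proof -
  have "inj ((*v) h)" using assms inj_matrix_vector_mult by blast
  then have "vec.dim ((*v) h ` vanish (- K)) = vec.dim (vanish (- K) :: (complex^'n) set)"
    by (intro vec.dim_image_eq matrix_vector_mul_linear_gen) (auto intro: inj_on_subset)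
  then show ?thesis by (simp add: col_space_image dim_vanish)
qed

lemma dim_le_vanish:
  fixes V :: "(complex^'n) set"
  assumes "vec.subspace V"
  shows "vec.dim V \<le> card A + vec.dim (V \<inter> vanish A)"
proof -
  have "vec.dim {x + y |x y. x \<in> V \<and> y \<in> vanish A} + vec.dim (V \<inter> vanish A) = vec.dim V + vec.dim (vanish A :: (complex^'n) set)"
    by (intro vec.dim_sums_Int assms subspace_vanish)
  moreover have "vec.dim {x + y |x y. x \<in> V \<and> y \<in> vanish A} \<le> CARD('n)"
    by (rule dim_subset_UNIV_cart_gen)
  moreover have "card A + card (- A) = CARD('n)" by (simp add: card_Un_disjoint[symmetric] Compl_partition)
  ultimately show ?thesis by (simp add: dim_vanish)
qed

text \<open>The rank of the rows in \<open>A\<close> of the submatrix with columns in \<open>K\<close>, if \<open>h\<close> is invertible.\<close>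

definition rk :: "'n set \<Rightarrow> complex^'n^'n \<Rightarrow> 'n set \<Rightarrow> int" where
  "rk K h A = int (card K) - int (vec.dim (col_space K h \<inter> vanish A))"

lemma rk_empty: "invertible h \<Longrightarrow> rk K h {} = 0"
  by (simp add: rk_def vanish_empty dim_col_space)

lemma rk_UNIV: "rk K h UNIV = int (card K)"
proof -
  have "col_space K h \<inter> vanish UNIV = {0}"
    using vec.subspace_0[OF subspace_col_space] by (auto simp: vanish_UNIV)
  then show ?thesis by (simp add: rk_def)
qed

lemma rk_le_card: "invertible h \<Longrightarrow> rk K h A \<le> int (card A)"
  using dim_le_vanish[OF subspace_col_space, of K h A] by (simp add: rk_def dim_col_space)

lemma rk_le_card': "rk K h A \<le> int (card K)"
  by (simp add: rk_def)

text \<open>Dimension formula for the subspaces of the column space cut out by \<open>A\<close> and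
  by \<open>B\<close>: their intersection belongs to \<open>A \<union> B\<close>, and their sum is
  contained in the subspace of \<open>A \<inter> B\<close>.\<close>

lemma submodular_rk: "submodular_on E (rk K h)"
  unfolding submodular_on_def
proof (intro allI impI)
  fix A B
  let ?U = "col_space K h"
  have "vec.dim {x + y |x y. x \<in> ?U \<inter> vanish A \<and> y \<in> ?U \<inter> vanish B} + vec.dim ((?U \<inter> vanish A) \<inter> (?U \<inter> vanish B))
     = vec.dim (?U \<inter> vanish A) + vec.dim (?U \<inter> vanish B)"
    by (intro vec.dim_sums_Int vec.subspace_inter subspace_col_space subspace_vanish)
  moreover have "vec.dim {x + y |x y. x \<in> ?U \<inter> vanish A \<and> y \<in> ?U \<inter> vanish B} \<le> vec.dim (?U \<inter> vanish (A \<inter> B))"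
    by (intro vec.dim_subset) (auto simp: vanish_def intro: vec.subspace_add[OF subspace_col_space])
  moreover have "(?U \<inter> vanish A) \<inter> (?U \<inter> vanish B) = ?U \<inter> vanish (A \<union> B)" by (auto simp: vanish_Un)
  ultimately show "rk K h (A \<union> B) + rk K h (A \<inter> B) \<le> rk K h A + rk K h B"
    by (simp add: rk_def)
qed

lemma rk_eq_card_iff: "rk K h A = int (card K) \<longleftrightarrow> col_space K h \<inter> vanish A = {0}"
proof -
  have "vec.subspace (col_space K h \<inter> vanish A)"
    by (intro vec.subspace_inter subspace_col_space subspace_vanish)
  then have "0 \<in> col_space K h \<inter> vanish A" by (rule vec.subspace_0)
  then show ?thesis by (auto simp: rk_def)
qed

text \<open>Up to sign, the minor of \<open>h\<close> with columns \<open>K\<close> and rows outside \<open>\<sigma> ` (- K)\<close>: the other columns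
  are replaced by unit vectors.\<close>

definition minor :: "'n set \<Rightarrow> ('n \<Rightarrow> 'n) \<Rightarrow> complex^'n^'n \<Rightarrow> complex^'n^'n" where
  "minor K \<sigma> h = (\<chi> i j. if j \<in> K then h $ i $ j else if i = \<sigma> j then 1 else 0)"

abbreviation minor_det :: "'n::finite set \<Rightarrow> ('n \<Rightarrow> 'n) \<Rightarrow> complex^'n^'n \<Rightarrow> complex" where
  "minor_det K \<sigma> h \<equiv> det (minor K \<sigma> h)"

section \<open>Minors under diagonal and block triangular factors\<close>

definition dg :: "('n \<Rightarrow> complex) \<Rightarrow> complex^'n^'n" where
  "dg t = (\<chi> i j. if i = j then t i else 0)"

lemma dg_nth: "dg t $ i $ j = (if i = j then t i else 0)"
  by (simp add: dg_def)

lemma det_dg: "det (dg t) = (\<Prod>i\<in>UNIV. t i)"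
  by (subst det_diagonal) (simp_all add: dg_def)

lemma dg_mult_nth: "(dg t ** h) $ i $ j = t i * h $ i $ j"
  by (simp add: dg_def matrix_matrix_mult_def if_distrib[of "\<lambda>x. x * _"] cong: if_cong)

lemma mult_dg_nth: "(h ** dg t) $ i $ j = h $ i $ j * t j"
  by (simp add: dg_def matrix_matrix_mult_def if_distrib[of "\<lambda>x. _ * x"] cong: if_cong)

lemma minor_det_nonzero_inj: "minor_det K \<sigma> h \<noteq> 0 \<Longrightarrow> inj_on \<sigma> (- K)"
proof (rule inj_onI, rule ccontr)
  fix i j assume "minor_det K \<sigma> h \<noteq> 0" "i \<in> - K" "j \<in> - K" "\<sigma> i = \<sigma> j" "i \<noteq> j"
  moreover from this have "column i (minor K \<sigma> h) = column j (minor K \<sigma> h)"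
    by (simp add: column_def minor_def)
  ultimately show False using det_identical_columns by blast
qed

lemma minor_det_dg:
  assumes "\<And>i. t i \<noteq> 0" "inj_on \<sigma> (- K)"
  shows "minor_det K \<sigma> (dg t ** h) = (\<Prod>i\<in>- \<sigma> ` (- K). t i) * minor_det K \<sigma> h"
proof -
  have "dg t ** minor K \<sigma> h = minor K \<sigma> (dg t ** h) ** dg (\<lambda>j. if j \<in> K then 1 else t (\<sigma> j))"
    by (simp add: vec_eq_iff dg_mult_nth mult_dg_nth) (auto simp: minor_def dg_mult_nth)
  from arg_cong[OF this, of det]
  have "(\<Prod>i\<in>UNIV. t i) * minor_det K \<sigma> h = minor_det K \<sigma> (dg t ** h) * (\<Prod>j\<in>UNIV. if j \<in> K then 1 else t (\<sigma> j))"
    by (simp add: det_mul det_dg)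
  also have "(\<Prod>j\<in>UNIV. if j \<in> K then 1 else t (\<sigma> j)) = (\<Prod>j\<in>- K. t (\<sigma> j))"
    by (rule prod.mono_neutral_cong_right) auto
  also have "\<dots> = (\<Prod>i\<in>\<sigma> ` (- K). t i)" using assms(2) by (simp add: prod.reindex)
  also have "(\<Prod>i\<in>UNIV. t i) = (\<Prod>i\<in>- \<sigma> ` (- K). t i) * (\<Prod>i\<in>\<sigma> ` (- K). t i)"
    by (subst prod.union_disjoint[symmetric]) (auto simp: Un_commute Compl_partition)
  finally show ?thesis using assms(1) by simp
qed

text \<open>The columns \<open>K\<close> of \<open>h ** p\<close> only involve the columns
  \<open>K\<close> of \<open>h\<close>, and unit columns pass through unchanged. The factor does not
  depend on \<open>\<sigma>\<close>, which makes all these minors sections of one line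
  bundle.\<close>

lemma minor_det_mult:
  assumes "\<And>i j. i \<notin> K \<Longrightarrow> j \<in> K \<Longrightarrow> p $ i $ j = 0"
  shows "minor_det K \<sigma> (h ** p) = minor_det K \<sigma> h * minor_det K id p"
proof -
  have "(minor K \<sigma> h ** minor K id p) $ i $ j = minor K \<sigma> (h ** p) $ i $ j" for i j
  proof (cases "j \<in> K")
    case True
    have "(minor K \<sigma> h ** minor K id p) $ i $ j = (\<Sum>k\<in>UNIV. h $ i $ k * p $ k $ j)"
      using assms[OF _ True] unfolding matrix_matrix_mult_def
      by (simp, intro sum.cong) (auto simp: minor_def True)
    then show ?thesis by (simp add: minor_def True matrix_matrix_mult_def)
  next
    case False
    then show ?thesis
      by (simp add: minor_def matrix_matrix_mult_def if_distrib[of "\<lambda>x. _ * x"] cong: if_cong)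
  qed
  then have "minor K \<sigma> (h ** p) = minor K \<sigma> h ** minor K id p" by (simp add: vec_eq_iff)
  then show ?thesis by (simp add: det_mul)
qed

lemma minor_mult_vec:
  "(minor K \<sigma> h *v x) $ i = (h *v (\<chi> j. if j \<in> K then x $ j else 0)) $ i + (\<Sum>j\<in>- K. if i = \<sigma> j then x $ j else 0)"
proof -
  have "(minor K \<sigma> h *v x) $ i = (\<Sum>j\<in>UNIV. (if j \<in> K then h $ i $ j * x $ j else 0) + (if j \<notin> K \<and> i = \<sigma> j then x $ j else 0))"
    unfolding matrix_vector_mult_def by (simp, intro sum.cong) (auto simp: minor_def)
  also have "\<dots> = (\<Sum>j\<in>UNIV. if j \<in> K then h $ i $ j * x $ j else 0) + (\<Sum>j\<in>UNIV. if j \<notin> K \<and> i = \<sigma> j then x $ j else 0)"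
    by (rule sum.distrib)
  also have "(\<Sum>j\<in>UNIV. if j \<notin> K \<and> i = \<sigma> j then x $ j else 0) = (\<Sum>j\<in>- K. if i = \<sigma> j then x $ j else 0)"
    by (rule sum.mono_neutral_cong_right) auto
  also have "(\<Sum>j\<in>UNIV. if j \<in> K then h $ i $ j * x $ j else 0) = (h *v (\<chi> j. if j \<in> K then x $ j else 0)) $ i"
    unfolding matrix_vector_mult_def by (simp, intro sum.cong) auto
  finally show ?thesis .
qed

lemma det_nonzero_if_kernel_trivial:
  fixes A :: "complex^'n^'n"
  assumes "\<And>x. A *v x = 0 \<Longrightarrow> x = 0"
  shows "det A \<noteq> 0"
  using assms invertible_det_nz[of A] invertible_left_inverse[of A] matrix_left_invertible_ker[of A] by auto

lemma kernel_trivial_if_det_nonzero: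
  fixes A :: "complex^'n^'n"
  assumes "det A \<noteq> 0" "A *v x = 0"
  shows "x = 0"
  using assms invertible_det_nz[of A] invertible_left_inverse[of A] matrix_left_invertible_ker[of A] by auto

text \<open>For a kernel vector of the completed minor, \<open>h\<close> maps the part in
  \<open>K\<close> to a vector that vanishes on the rows \<open>I\<close>, hence to 0. The unit
  columns, placed in distinct rows, then force the remaining entries to vanish.\<close>

lemma exists_minor_nonzero:
  fixes h :: "complex^'n^'n"
  assumes h: "det h \<noteq> 0" and "card I = card K" and I: "col_space K h \<inter> vanish I = {0}"
  shows "\<exists>\<sigma>. inj_on \<sigma> (- K) \<and> \<sigma> ` (- K) = - I \<and> minor_det K \<sigma> h \<noteq> 0"
proof -
  have "card (- K) = card (- I)" using assms(2) by (simp add: card_compl)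
  then obtain \<sigma> where "bij_betw \<sigma> (- K) (- I)" using finite_same_card_bij[of "- K" "- I"] by auto
  then have \<sigma>: "inj_on \<sigma> (- K)" "\<sigma> ` (- K) = - I" by (auto simp: bij_betw_def)
  have "minor_det K \<sigma> h \<noteq> 0"
  proof (rule det_nonzero_if_kernel_trivial)
    fix x assume x: "minor K \<sigma> h *v x = 0"
    define y where "y = (\<chi> j. if j \<in> K then x $ j else 0)"
    have row: "(h *v y) $ i + (\<Sum>j\<in>- K. if i = \<sigma> j then x $ j else 0) = 0" for i
      using minor_mult_vec[of K \<sigma> h x i] x by (simp add: y_def)
    have "(h *v y) $ i = 0" if "i \<in> I" for i
    proof -
      have "(\<Sum>j\<in>- K. if i = \<sigma> j then x $ j else 0) = 0" using \<sigma> that by (intro sum.neutral) auto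
      then show ?thesis using row[of i] by simp
    qed
    then have "h *v y \<in> col_space K h \<inter> vanish I"
      by (auto simp: col_space_def vanish_def y_def)
    then have "h *v y = 0" using I by simp
    then have y0: "y = 0" using kernel_trivial_if_det_nonzero[OF h] by blast
    have "x $ j = 0" for j
    proof (cases "j \<in> K")
      case True
      then show ?thesis using y0 by (simp add: y_def vec_eq_iff) (metis True)
    next
      case False
      have "(\<Sum>j'\<in>- K. if \<sigma> j = \<sigma> j' then x $ j' else 0) = (\<Sum>j'\<in>- K. if j' = j then x $ j' else 0)"
        using \<sigma>(1) False by (intro sum.cong) (auto simp: inj_on_def)
      then show ?thesis using row[of "\<sigma> j"] y0 False by simp
    qed
    then show "x = 0" by (simp add: vec_eq_iff)
  qed
  then show ?thesis using \<sigma> by blast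
qed

text \<open>No nonzero vector of the column space vanishes on the set \<open>I\<close> of rows left
  free by the unit columns. Vectors that vanish on \<open>A\<close> are therefore detected by the
  rows \<open>I - A\<close>, which bounds their dimension.\<close>

lemma minor_nonzero_rk:
  fixes h :: "complex^'n^'n"
  assumes "minor_det K \<sigma> h \<noteq> 0"
  shows "int (card (A - \<sigma> ` (- K))) \<le> rk K h A"
proof -
  have inj: "inj_on \<sigma> (- K)" by (rule minor_det_nonzero_inj) fact
  define I where "I = - \<sigma> ` (- K)"
  have cI: "card I = card K"
    using card_image[OF inj] by (simp add: I_def card_compl card_mono)
  have "v = 0" if v: "v \<in> col_space K h" "v \<in> vanish I" for v
  proof -
    obtain x where x: "v = h *v x" "x \<in> vanish (- K)" using v by (auto simp: col_space_def)
    define y where "y = (\<chi> j. if j \<in> K then x $ j else - (v $ (\<sigma> j)))"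
    have yx: "(\<chi> j. if j \<in> K then y $ j else 0) = x" using x(2) by (auto simp: y_def vec_eq_iff vanish_def)
    have "(minor K \<sigma> h *v y) $ i = 0" for i
    proof (cases "i \<in> I")
      case True
      then have "(\<Sum>j\<in>- K. if i = \<sigma> j then y $ j else 0) = 0" by (intro sum.neutral) (auto simp: I_def)
      then show ?thesis using True v(2) x(1) by (simp add: minor_mult_vec yx vanish_def)
    next
      case False
      then obtain j where j: "j \<notin> K" "i = \<sigma> j" by (auto simp: I_def)
      have "(\<Sum>j'\<in>- K. if i = \<sigma> j' then y $ j' else 0) = (\<Sum>j'\<in>- K. if j' = j then y $ j' else 0)"
        using inj j by (intro sum.cong) (auto simp: inj_on_def)
      also have "\<dots> = - v $ i" using j by (simp add: y_def)
      finally show ?thesis using x(1) by (simp add: minor_mult_vec yx)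
    qed
    then have "minor K \<sigma> h *v y = 0" by (simp add: vec_eq_iff)
    then have "y = 0" by (rule kernel_trivial_if_det_nonzero[OF assms])
    then have "x = 0" unfolding yx[symmetric] by (simp add: vec_eq_iff)
    then show ?thesis using x(1) by simp
  qed
  then have "(col_space K h \<inter> vanish A) \<inter> vanish (I - A) \<subseteq> {0}"
    by (auto simp: vanish_def)
  then have d0: "vec.dim ((col_space K h \<inter> vanish A) \<inter> vanish (I - A)) = 0"
    by simp
  have "vec.dim (col_space K h \<inter> vanish A) \<le> card (I - A)"
    using dim_le_vanish[OF vec.subspace_inter[OF subspace_col_space subspace_vanish], of K h A "I - A"] d0
    by linarith
  moreover have "card I = card (I - A) + card (I \<inter> A)"
    by (subst card_Un_disjoint[symmetric]) (auto intro!: arg_cong[of _ _ card])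
  moreover have "A - \<sigma> ` (- K) = I \<inter> A" by (auto simp: I_def)
  ultimately show ?thesis using cI by (simp add: rk_def)
qed

text \<open>The integral points of the base polytope of a matroid are the indicator vectors of its bases, and
  the bases are the nonvanishing minors.\<close>

lemma sum_of_bases:
  fixes h :: "complex^'n^'n" and \<mu> :: "'n \<Rightarrow> nat"
  assumes h: "det h \<noteq> 0" and Q: "finite Q"
    and le: "\<And>A. (\<Sum>i\<in>A. int (\<mu> i)) \<le> (\<Sum>q\<in>Q. rk (K q) h A)"
    and eq: "(\<Sum>i\<in>UNIV. \<mu> i) = (\<Sum>q\<in>Q. card (K q))"
  shows "\<exists>\<sigma>. (\<forall>q\<in>Q. minor_det (K q) (\<sigma> q) h \<noteq> 0) \<and> (\<forall>i. \<mu> i = card {q\<in>Q. i \<notin> \<sigma> q ` (- K q)})"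
proof -
  have inv: "invertible h" using h by (simp add: invertible_det_nz)
  have "\<exists>\<nu>. (\<forall>q\<in>Q. (\<forall>A\<subseteq>UNIV. sum (\<nu> q) A \<le> rk (K q) h A) \<and> sum (\<nu> q) UNIV = rk (K q) h UNIV) \<and>
    (\<forall>i\<in>UNIV. int (\<mu> i) = (\<Sum>q\<in>Q. \<nu> q i))"
  proof (rule integral_polymatroid_sum)
    show "(\<Sum>i\<in>UNIV. int (\<mu> i)) = (\<Sum>q\<in>Q. rk (K q) h UNIV)"
      using eq by (simp add: rk_UNIV flip: of_nat_sum)
  qed (use Q le inv in \<open>auto simp: submodular_rk rk_empty\<close>)
  then obtain \<nu> where \<nu>: "\<And>q A. q \<in> Q \<Longrightarrow> sum (\<nu> q) A \<le> rk (K q) h A" "\<And>q. q \<in> Q \<Longrightarrow> sum (\<nu> q) UNIV = int (card (K q))"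
    "\<And>i. int (\<mu> i) = (\<Sum>q\<in>Q. \<nu> q i)" by (auto simp: rk_UNIV)
  define I where "I = (\<lambda>q. {i. \<nu> q i = 1})"
  \<comment> \<open>The upper bound holds since a singleton has rank at most 1, the lower one since
    the complement of a singleton has rank at most the total \<open>card (K q)\<close>.\<close>
  have \<nu>01: "\<nu> q i = (if i \<in> I q then 1 else 0)" if q: "q \<in> Q" for q i
  proof -
    have "\<nu> q i \<le> 1" using \<nu>(1)[OF q, of "{i}"] rk_le_card[OF inv, of "K q" "{i}"] by simp
    moreover have "sum (\<nu> q) UNIV = \<nu> q i + sum (\<nu> q) (UNIV - {i})" by (simp add: sum.remove)
    then have "0 \<le> \<nu> q i" using \<nu>(1)[OF q, of "UNIV - {i}"] \<nu>(2)[OF q] rk_le_card'[of "K q" h "UNIV - {i}"] by simp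
    ultimately show ?thesis by (auto simp: I_def)
  qed
  have "\<exists>\<sigma>. inj_on \<sigma> (- K q) \<and> \<sigma> ` (- K q) = - I q \<and> minor_det (K q) \<sigma> h \<noteq> 0" if q: "q \<in> Q" for q
  proof (rule exists_minor_nonzero[OF h])
    have "sum (\<nu> q) UNIV = int (card (I q))"
      using \<nu>01[OF q] by (simp add: sum.If_cases)
    then show c: "card (I q) = card (K q)" using \<nu>(2)[OF q] by simp
    have "sum (\<nu> q) (I q) = int (card (I q))" using \<nu>01[OF q] by simp
    then have "rk (K q) h (I q) = int (card (K q))"
      using \<nu>(1)[OF q, of "I q"] rk_le_card'[of "K q" h "I q"] c by simp
    then show "col_space (K q) h \<inter> vanish (I q) = {0}" by (simp add: rk_eq_card_iff)
  qed
  then obtain \<sigma> where \<sigma>: "\<And>q. q \<in> Q \<Longrightarrow> inj_on (\<sigma> q) (- K q) \<and> \<sigma> q ` (- K q) = - I q \<and> minor_det (K q) (\<sigma> q) h \<noteq> 0"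
    by metis
  have "\<mu> i = card {q\<in>Q. i \<notin> \<sigma> q ` (- K q)}" for i
  proof -
    have "int (\<mu> i) = (\<Sum>q\<in>Q. if i \<notin> \<sigma> q ` (- K q) then 1 else 0)"
      unfolding \<nu>(3) using \<nu>01 \<sigma> by (intro sum.cong) auto
    also have "\<dots> = int (card {q\<in>Q. i \<notin> \<sigma> q ` (- K q)})"
      using Q by (simp add: sum.If_cases Int_def)
    finally show ?thesis by simp
  qed
  then show "\<exists>\<sigma>. (\<forall>q\<in>Q. minor_det (K q) (\<sigma> q) h \<noteq> 0) \<and> (\<forall>i. \<mu> i = card {q\<in>Q. i \<notin> \<sigma> q ` (- K q)})"
    using \<sigma> by blast
qed

section \<open>Determinants of upper triangular matrices\<close>

lemma permutes_UNIV_le_imp_id: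
  fixes p :: "'n::{finite,linorder} \<Rightarrow> 'n"
  assumes "p permutes UNIV" "\<And>i. p i \<le> i"
  shows "p = id"
proof
  fix i show "p i = id i"
  proof (induction "card {j. j < i}" arbitrary: i rule: less_induct)
    case less
    have *: "p j = j" if "j < i" for j
    proof -
      have "{k. k < j} \<subset> {k. k < i}" using that by auto
      then have "card {k. k < j} < card {k. k < i}" by (intro psubset_card_mono) auto
      then show ?thesis using less by simp
    qed
    show ?case
    proof (rule ccontr)
      assume "p i \<noteq> id i"
      then have "p i < i" using assms(2)[of i] by simp
      then have "p (p i) = p i" by (rule *)
      then have "p i = i" using permutes_inj[OF assms(1)] by (simp add: inj_eq)
      then show False using \<open>p i < i\<close> by simp
    qed
  qed
qed

lemma det_upper_triangular:
  fixes A :: "complex^'n::{finite,linorder}^'n::{finite,linorder}"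
  assumes "\<And>i j. j < i \<Longrightarrow> A $ i $ j = 0"
  shows "det A = (\<Prod>i\<in>UNIV. A $ i $ i)"
proof -
  have "(\<Prod>i\<in>UNIV. A $ i $ p i) = 0" if p: "p permutes UNIV" "p \<noteq> id" for p
  proof -
    define r where "r = Hilbert_Choice.inv p"
    have r: "r permutes UNIV" unfolding r_def by (rule permutes_inv[OF p(1)])
    have pr: "p (r i) = i" for i unfolding r_def by (rule permutes_inverses(1)[OF p(1)])
    have "r \<noteq> id"
    proof
      assume "r = id"
      then have "p i = i" for i using pr[of i] by simp
      then show False using p(2) by (auto simp: fun_eq_iff)
    qed
    then obtain i where "\<not> r i \<le> i" using permutes_UNIV_le_imp_id[OF r] by blast
    then have "p (r i) < r i" using pr by simp
    then have "A $ (r i) $ p (r i) = 0" by (rule assms)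
    then show ?thesis by (intro prod_zero) auto
  qed
  then have "det A = (\<Sum>p\<in>{id}. of_int (sign p) * (\<Prod>i\<in>UNIV. A $ i $ p i))"
    unfolding det_def by (intro sum.mono_neutral_right) (auto simp: permutes_id)
  then show ?thesis by simp
qed

lemma minor_det_id_upper_triangular:
  fixes A :: "complex^'n::{finite,linorder}^'n::{finite,linorder}"
  assumes "\<And>i j. j < i \<Longrightarrow> A $ i $ j = 0"
  shows "minor_det K id A = (\<Prod>i\<in>K. A $ i $ i)"
proof -
  have "minor_det K id A = (\<Prod>i\<in>UNIV. minor K id A $ i $ i)"
    using assms by (intro det_upper_triangular) (auto simp: minor_def)
  also have "\<dots> = (\<Prod>i\<in>K. A $ i $ i)" by (rule prod.mono_neutral_cong_right) (auto simp: minor_def)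
  finally show ?thesis .
qed

section \<open>Growth of functions on the special linear group\<close>

definition upper :: "complex^'n::{finite,linorder}^'n::{finite,linorder} \<Rightarrow> bool" where
  "upper u \<longleftrightarrow> (\<forall>i j. j < i \<longrightarrow> u $ i $ j = 0) \<and> det u = 1"

lemma det_cnj: "det (\<chi> i j. cnj (A $ i $ j)) = cnj (det (A :: complex^'n^'n))"
  by (simp add: det_def)

text \<open>The inner product of the type is the real part of the Hermitian one; orthogonality to
  \<open>\<i> *s y\<close> supplies the imaginary part.\<close>

lemma complex_orthogonal:
  fixes x y :: "complex^'n"
  assumes "x \<bullet> y = 0" "x \<bullet> (\<i> *s y) = 0"
  shows "(\<Sum>r\<in>UNIV. cnj (y $ r) * x $ r) = 0"
proof -
  have "Re (\<Sum>r\<in>UNIV. cnj (y $ r) * x $ r) = x \<bullet> y"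
    by (simp add: inner_vec_def inner_complex_def algebra_simps)
  moreover have "Im (\<Sum>r\<in>UNIV. cnj (y $ r) * x $ r) = x \<bullet> (\<i> *s y)"
    by (simp add: inner_vec_def inner_complex_def algebra_simps)
  ultimately show ?thesis using assms by (simp add: complex_eq_iff)
qed

text \<open>Gram-Schmidt orthogonalisation of the columns.\<close>

lemma unitary_times_upper:
  fixes h :: "complex^'n::{finite,linorder}^'n::{finite,linorder}"
  assumes h: "det h = 1"
  shows "\<exists>u. upper u \<and> (\<forall>i j. norm ((h ** u) $ i $ j) \<le> 1)"
proof -
  \<comment> \<open>The complex span of the columns before \<open>j\<close>. It is stable under
    complex scalars, so orthogonality to it for the real inner product amounts to Hermitian
    orthogonality.\<close>
  define W where "W = (\<lambda>j. {h *v c | c. \<forall>i. j \<le> i \<longrightarrow> c $ i = 0})"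
  have W_scale: "a *s w \<in> W j" if w: "w \<in> W j" for a w j
  proof -
    obtain c where c: "w = h *v c" "\<forall>i. j \<le> i \<longrightarrow> c $ i = 0" using w by (auto simp: W_def)
    then have "a *s w = h *v (a *s c)" by (simp add: vector_scalar_commute)
    then show ?thesis using c by (auto simp: W_def intro!: exI[of _ "a *s c"])
  qed
  have W_sub: "subspace (W j)" for j
    unfolding subspace_def
  proof (intro conjI allI ballI)
    show "0 \<in> W j" by (auto simp: W_def intro!: exI[of _ 0])
    fix v w assume "v \<in> W j" "w \<in> W j"
    then obtain c d where c: "v = h *v c" "\<forall>i. j \<le> i \<longrightarrow> c $ i = 0" "w = h *v d" "\<forall>i. j \<le> i \<longrightarrow> d $ i = 0"
      by (auto simp: W_def)
    then have "v + w = h *v (c + d)" by (simp add: matrix_vector_right_distrib)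
    then show "v + w \<in> W j" using c by (auto simp: W_def intro!: exI[of _ "c + d"])
  next
    fix v and r :: real assume "v \<in> W j"
    moreover have "r *\<^sub>R v = complex_of_real r *s v"
      by (simp add: vec_eq_iff) (simp add: scaleR_conv_of_real)
    ultimately show "r *\<^sub>R v \<in> W j" using W_scale by simp
  qed
  have "\<exists>c. (\<forall>i. j \<le> i \<longrightarrow> c $ i = 0) \<and> (\<forall>w\<in>W j. orthogonal (column j h - h *v c) w)" for j
  proof -
    obtain y z where "y \<in> span (W j)" "\<And>w. w \<in> span (W j) \<Longrightarrow> orthogonal z w" "column j h = y + z"
      using orthogonal_subspace_decomp_exists[of "W j" "column j h"] by blast
    moreover have "span (W j) = W j" using W_sub by (simp add: span_eq_iff)
    ultimately have yz: "y \<in> W j" "\<And>w. w \<in> W j \<Longrightarrow> orthogonal z w" "column j h = y + z" by auto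
    then obtain c where "y = h *v c" "\<forall>i. j \<le> i \<longrightarrow> c $ i = 0" by (auto simp: W_def)
    then show ?thesis using yz by (intro exI[of _ c]) auto
  qed
  then obtain c where c: "\<And>i j. j \<le> i \<Longrightarrow> c j $ i = 0"
    and orth: "\<And>j w. w \<in> W j \<Longrightarrow> orthogonal (column j h - h *v c j) w" by metis
  define z where "z = (\<lambda>j. column j h - h *v c j)"
  have "column j h = h *v axis j 1" for j
    by (simp add: vec_eq_iff column_def matrix_vector_mult_def axis_def if_distrib cong: if_cong)
  then have z: "z j = h *v (axis j 1 - c j)" for j
    by (simp add: z_def matrix_vector_mult_diff_distrib)
  have z0: "z j \<noteq> 0" for j
  proof
    assume "z j = 0"
    then have "h *v (axis j 1 - c j) = 0" using z by simp
    then have "axis j 1 - c j = 0" by (rule kernel_trivial_if_det_nonzero[rotated]) (simp add: h)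
    from arg_cong[OF this, of "\<lambda>v. v $ j"] show False using c[of j j] by simp
  qed
  define u where "u = (\<chi> i j. complex_of_real (1 / norm (z j)) * (axis j 1 - c j) $ i)"
  have ut: "u $ i $ j = 0" if "j < i" for i j
    using that c[of j i] by (simp add: u_def axis_def)
  have ud: "u $ j $ j = complex_of_real (1 / norm (z j))" for j
    using c[of j j] by (simp add: u_def)
  define k where "k = h ** u"
  have k: "k $ i $ j = complex_of_real (1 / norm (z j)) * z j $ i" for i j
  proof -
    have "k $ i $ j = (\<Sum>r\<in>UNIV. h $ i $ r * (complex_of_real (1 / norm (z j)) * (axis j 1 - c j) $ r))"
      unfolding k_def matrix_matrix_mult_def u_def by simp
    also have "\<dots> = complex_of_real (1 / norm (z j)) * (\<Sum>r\<in>UNIV. h $ i $ r * (axis j 1 - c j) $ r)"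
      unfolding sum_distrib_left by (rule sum.cong) simp_all
    also have "(\<Sum>r\<in>UNIV. h $ i $ r * (axis j 1 - c j) $ r) = z j $ i"
      unfolding z matrix_vector_mult_def by simp
    finally show ?thesis .
  qed
  define kc where "kc = (\<lambda>j. complex_of_real (1 / norm (z j)) *s z j)"
  have kc: "kc j $ i = k $ i $ j" for i j by (simp add: k kc_def)
  have nk: "norm (kc j) = 1" for j
  proof -
    have "kc j = (1 / norm (z j)) *\<^sub>R z j"
      unfolding kc_def by (simp add: vec_eq_iff) (simp add: scaleR_conv_of_real)
    then show ?thesis using z0 by simp
  qed
  have kW: "kc i \<in> W j" if "i < j" for i j
  proof -
    have "z i \<in> W j" unfolding z W_def using that c[of i] by (auto simp: axis_def intro!: exI[of _ "axis i 1 - c i"])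
    then show ?thesis unfolding kc_def by (rule W_scale)
  qed
  have ortho: "(\<Sum>r\<in>UNIV. cnj (k $ r $ i) * k $ r $ j) = 0" if "i < j" for i j
  proof -
    have "z j \<bullet> kc i = 0" "z j \<bullet> (\<i> *s kc i) = 0"
      using orth[OF kW[OF that]] orth[OF W_scale[OF kW[OF that]], of \<i>] by (simp_all add: orthogonal_def z_def)
    then have "(\<Sum>r\<in>UNIV. cnj (kc i $ r) * z j $ r) = 0" by (rule complex_orthogonal)
    then have "complex_of_real (1 / norm (z j)) * (\<Sum>r\<in>UNIV. cnj (k $ r $ i) * z j $ r) = 0" by (simp add: kc)
    then show ?thesis by (simp add: sum_distrib_left k mult_ac)
  qed
  define H where "H = (\<chi> i j. cnj (k $ j $ i))"
  have "(H ** k) $ i $ j = (if i = j then 1 else 0)" for i j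
  proof -
    have e: "(H ** k) $ i $ j = (\<Sum>r\<in>UNIV. cnj (k $ r $ i) * k $ r $ j)"
      by (simp add: H_def matrix_matrix_mult_def)
    consider "i < j" | "j < i" | "i = j" by (rule linorder_cases)
    then show ?thesis
    proof cases
      case 1
      then show ?thesis using ortho[OF 1] e by simp
    next
      case 2
      have "(H ** k) $ i $ j = cnj (\<Sum>r\<in>UNIV. cnj (k $ r $ j) * k $ r $ i)"
        unfolding e by (simp add: mult.commute)
      then show ?thesis using ortho[OF 2] 2 by simp
    next
      case 3
      have "(\<Sum>r\<in>UNIV. cnj (k $ r $ j) * k $ r $ j) = complex_of_real (\<Sum>r\<in>UNIV. (norm (kc j $ r))\<^sup>2)"
        unfolding of_real_sum complex_norm_square kc by (simp add: mult.commute)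
      also have "(\<Sum>r\<in>UNIV. (norm (kc j $ r))\<^sup>2) = (norm (kc j))\<^sup>2"
        by (simp add: norm_vec_def L2_set_def sum_nonneg)
      finally show ?thesis using 3 e nk by simp
    qed
  qed
  then have "H ** k = mat 1" by (simp add: vec_eq_iff mat_def)
  then have "det H * det k = 1" by (metis det_I det_mul)
  moreover have "det H = cnj (det k)"
  proof -
    have "H = transpose (\<chi> i j. cnj (k $ i $ j))" by (simp add: H_def transpose_def)
    then show ?thesis by (simp add: det_transpose det_cnj)
  qed
  ultimately have "(norm (det k))\<^sup>2 = 1"
    by (metis complex_norm_square mult.commute of_real_eq_1_iff)
  then have n1: "norm (det k) = 1" by (metis abs_norm_cancel abs_square_eq_1)
  \<comment> \<open>The diagonal of \<open>u\<close> is real and positive, so \<open>det u\<close>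
    is determined by its absolute value, which is 1 as for \<open>k\<close>.\<close>
  have "det u = (\<Prod>j\<in>UNIV. complex_of_real (1 / norm (z j)))"
    using ut by (subst det_upper_triangular) (auto simp: ud)
  then have du: "det u = complex_of_real (\<Prod>j\<in>UNIV. 1 / norm (z j))" by simp
  have "det k = det u" using h by (simp add: k_def det_mul)
  then have "norm (det u) = 1" using n1 by simp
  then have "det u = 1" unfolding du norm_of_real
    using z0 by (simp add: abs_prod prod_nonneg)
  then have "upper u" using ut by (simp add: upper_def)
  moreover have "norm ((h ** u) $ i $ j) \<le> 1" for i j
    using Finite_Cartesian_Product.norm_nth_le[of "kc j" i] nk[of j] by (simp add: kc k_def)
  ultimately show ?thesis by blast
qed

text \<open>A smallest set \<open>I\<close> of rows on which no nonzero vector of the column space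
  vanishes has \<open>card K\<close> elements: by minimality each of its rows lowers the dimension,
  and fewer rows cannot bring the dimension \<open>card K\<close> down to 0.\<close>

lemma exists_minor:
  fixes h :: "complex^'n^'n"
  assumes h: "det h \<noteq> 0"
  shows "\<exists>\<sigma>. minor_det K \<sigma> h \<noteq> 0"
proof -
  let ?U = "col_space K h"
  have inv: "invertible h" using h by (simp add: invertible_det_nz)
  define P where "P = (\<lambda>I. ?U \<inter> vanish I = {0})"
  have "P UNIV" unfolding P_def rk_eq_card_iff[symmetric] by (rule rk_UNIV)
  then have "\<exists>I. P I \<and> (\<forall>I'. P I' \<longrightarrow> card I \<le> card I')" by (rule ex_has_least_nat)
  then obtain I where I: "P I" "\<And>I'. card I' < card I \<Longrightarrow> \<not> P I'" by (meson not_le)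
  have sub: "vec.subspace (?U \<inter> vanish T)" for T
    by (intro vec.subspace_inter subspace_col_space subspace_vanish)
  have "vec.dim (?U \<inter> vanish T) + card T \<le> card K" if "T \<subseteq> I" for T
    using finite_subset[OF that finite] that
  proof (induction T rule: finite_induct)
    case empty
    then show ?case by (simp add: vanish_empty dim_col_space inv)
  next
    case (insert i T)
    have "card (I - {i}) < card I" using insert.prems by (intro psubset_card_mono) auto
    then have "\<not> P (I - {i})" by (rule I(2))
    moreover have "0 \<in> ?U \<inter> vanish (I - {i})" using vec.subspace_0[OF sub] .
    ultimately obtain v where v: "v \<in> ?U" "v \<in> vanish (I - {i})" "v \<noteq> 0" unfolding P_def by blast
    have "v \<notin> vanish {i}"
    proof
      assume "v \<in> vanish {i}"
      then have "v \<in> ?U \<inter> vanish I" using v by (auto simp: vanish_def)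
      then show False using I(1) v(3) unfolding P_def by auto
    qed
    then have "v \<in> ?U \<inter> vanish T" "v \<notin> ?U \<inter> vanish (insert i T)"
      using v insert by (auto simp: vanish_def)
    moreover have "?U \<inter> vanish (insert i T) \<subseteq> ?U \<inter> vanish T" by (auto simp: vanish_def)
    ultimately have "vec.span (?U \<inter> vanish (insert i T)) \<subset> vec.span (?U \<inter> vanish T)"
      using vec.span_eq_iff sub by (metis psubsetI)
    then have "vec.dim (?U \<inter> vanish (insert i T)) < vec.dim (?U \<inter> vanish T)"
      by (rule vec.dim_psubset)
    then show ?case using insert by simp
  qed
  from this[of I] have "card I \<le> card K" by simp
  moreover have "card K \<le> card I"
    using dim_le_vanish[OF subspace_col_space, of K h I] I(1) by (simp add: P_def dim_col_space inv)
  ultimately have "card I = card K" by simp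
  then show ?thesis using exists_minor_nonzero[OF h _ I(1)[unfolded P_def]] by blast
qed

text \<open>A norm of the vector of Pluecker coordinates. Each minor may be counted several times,
  and maps \<open>\<sigma>\<close> that are not injective on the complement of \<open>K\<close>
  contribute 0.\<close>

definition minors_norm :: "'n::finite set \<Rightarrow> complex^'n^'n \<Rightarrow> real" where
  "minors_norm K h = (\<Sum>\<sigma>\<in>UNIV. norm (minor_det K \<sigma> h))"

lemma minors_norm_pos: "det h \<noteq> 0 \<Longrightarrow> 0 < minors_norm K h"
proof -
  assume "det h \<noteq> 0"
  then obtain \<sigma> where "minor_det K \<sigma> h \<noteq> 0" using exists_minor by blast
  then show ?thesis unfolding minors_norm_def by (intro sum_pos2[of _ \<sigma>]) auto
qed

lemma minors_norm_mult:
  "(\<And>i j. i \<notin> K \<Longrightarrow> j \<in> K \<Longrightarrow> p $ i $ j = 0) \<Longrightarrow> minors_norm K (h ** p) = minors_norm K h * norm (minor_det K id p)"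
  by (simp add: minors_norm_def minor_det_mult norm_mult sum_distrib_right)

lemma continuous_on_minors_norm: "continuous_on S (minors_norm K)"
proof -
  have "continuous_on S (\<lambda>h. minor K \<sigma> h $ i $ j)" for \<sigma> i j
    by (cases "j \<in> K") (auto simp: minor_def intro!: continuous_intros)
  then show ?thesis unfolding minors_norm_def det_def
    by (intro continuous_on_sum continuous_on_norm continuous_on_mult continuous_on_prod continuous_on_const)
qed

lemma norm_vec_le_sum: "norm v \<le> (\<Sum>i\<in>UNIV. norm (v $ i))"
  unfolding norm_vec_def by (rule L2_set_le_sum) auto

text \<open>The quotient of the unimodular group by its upper triangular subgroup is compact. So a
  function with a prescribed behaviour under that subgroup has the growth of the minors that
  behave in the same way.\<close>

lemma growth:
  fixes K :: "nat \<Rightarrow> 'n::{finite,linorder} set" and f :: "complex^'n::{finite,linorder}^'n::{finite,linorder} \<Rightarrow> complex"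
  assumes down: "\<And>q i j. j \<in> K q \<Longrightarrow> i < j \<Longrightarrow> i \<in> K q"
    and P: "closed P" "\<And>h. h \<in> P \<Longrightarrow> det h = 1" "\<And>h u. h \<in> P \<Longrightarrow> upper u \<Longrightarrow> h ** u \<in> P"
    and cont: "continuous_on P f"
    and f: "\<And>h u. h \<in> P \<Longrightarrow> upper u \<Longrightarrow> f (h ** u) = (\<Prod>q<L. \<Prod>i\<in>K q. u $ i $ i) * f h"
  shows "\<exists>C\<ge>0. \<forall>h\<in>P. norm (f h) \<le> C * (\<Prod>q<L. minors_norm (K q) h)"
proof (cases "P = {}")
  case True
  then show ?thesis by auto
next
  case False
  define S where "S = P \<inter> {k. \<forall>i j. norm (k $ i $ j) \<le> 1}"
  have dec: "\<exists>u. upper u \<and> h ** u \<in> S" if "h \<in> P" for h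
    using unitary_times_upper[OF P(2)[OF that]] P(3)[OF that] by (auto simp: S_def)
  then have Sne: "S \<noteq> {}" using False by blast
  have "closed {k :: complex^'n::{finite,linorder}^'n::{finite,linorder}. \<forall>i j. norm (k $ i $ j) \<le> 1}"
    by (intro closed_Collect_all closed_Collect_le continuous_intros)
  then have "closed S" unfolding S_def using P(1) by (intro closed_Int)
  moreover have "bounded S"
  proof -
    have "norm k \<le> (\<Sum>i\<in>(UNIV :: 'n set). \<Sum>j\<in>(UNIV :: 'n set). (1::real))" if "k \<in> S" for k
    proof -
      have "norm k \<le> (\<Sum>i\<in>UNIV. norm (k $ i))" by (rule norm_vec_le_sum)
      also have "\<dots> \<le> (\<Sum>i\<in>(UNIV :: 'n set). \<Sum>j\<in>(UNIV :: 'n set). (1::real))"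
        using that by (intro sum_mono order_trans[OF norm_vec_le_sum]) (auto simp: S_def)
      finally show ?thesis .
    qed
    then show ?thesis by (auto simp: bounded_iff)
  qed
  ultimately have S: "compact S" by (simp add: compact_eq_bounded_closed)
  have Sd: "det k = 1" if "k \<in> S" for k using that P(2) by (auto simp: S_def)
  have "\<exists>\<delta>>0. \<forall>k\<in>S. \<delta> \<le> minors_norm (K q) k" for q
  proof -
    obtain k0 where "k0 \<in> S" "\<forall>k\<in>S. minors_norm (K q) k0 \<le> minors_norm (K q) k"
      using continuous_attains_inf[OF S Sne continuous_on_minors_norm] by blast
    then show ?thesis using minors_norm_pos[of k0 "K q"] Sd[of k0] by auto
  qed
  then obtain \<delta> where \<delta>: "\<And>q. \<delta> q > 0" "\<And>q k. k \<in> S \<Longrightarrow> \<delta> q \<le> minors_norm (K q) k" by metis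
  have "continuous_on S (\<lambda>k. norm (f k))"
    using cont by (intro continuous_on_norm continuous_on_subset[OF cont]) (auto simp: S_def)
  then obtain k1 where k1: "k1 \<in> S" "\<forall>k\<in>S. norm (f k) \<le> norm (f k1)"
    using continuous_attains_sup[OF S Sne] by blast
  \<comment> \<open>The maximum of \<open>f\<close> over the lower bounds of the minors on the
    compact set. Right multiplication by \<open>u\<close> changes both sides of the estimate by the
    same diagonal factor, so the constant serves for all of \<open>P\<close>.\<close>
  define C where "C = norm (f k1) / (\<Prod>q<L. \<delta> q)"
  have "norm (f h) \<le> C * (\<Prod>q<L. minors_norm (K q) h)" if h: "h \<in> P" for h
  proof -
    obtain u where u: "upper u" "h ** u \<in> S" using dec[OF h] by blast
    have ut: "u $ i $ j = 0" if "j < i" for i j using u(1) that by (auto simp: upper_def)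
    have "minors_norm (K q) (h ** u) = minors_norm (K q) h * norm (\<Prod>i\<in>K q. u $ i $ i)" for q
    proof -
      have "u $ i $ j = 0" if "i \<notin> K q" "j \<in> K q" for i j
        using down[OF that(2), of i] that ut[of j i] by (metis linorder_less_linear)
      then show ?thesis by (simp add: minors_norm_mult minor_det_id_upper_triangular[OF ut])
    qed
    then have ge: "\<delta> q \<le> minors_norm (K q) h * norm (\<Prod>i\<in>K q. u $ i $ i)" for q
      using \<delta>(2)[OF u(2), of q] by simp
    have "norm (f h) * (\<Prod>q<L. \<delta> q) \<le> norm (f h) * (\<Prod>q<L. minors_norm (K q) h * norm (\<Prod>i\<in>K q. u $ i $ i))"
      using ge \<delta>(1) by (intro mult_left_mono prod_mono) (auto intro: less_imp_le)
    also have "\<dots> = norm (f (h ** u)) * (\<Prod>q<L. minors_norm (K q) h)"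
      by (simp add: f[OF h u(1)] norm_mult prod.distrib prod_norm[symmetric])
    also have "\<dots> \<le> norm (f k1) * (\<Prod>q<L. minors_norm (K q) h)"
      using k1(2) u(2) minors_norm_pos[of h] P(2)[OF h]
      by (intro mult_right_mono prod_nonneg) (auto intro: less_imp_le)
    finally show ?thesis using \<delta>(1) by (simp add: C_def field_simps prod_pos)
  qed
  moreover have "C \<ge> 0" unfolding C_def using \<delta>(1) by (intro divide_nonneg_nonneg prod_nonneg) (auto intro: less_imp_le)
  ultimately show ?thesis by blast
qed

lemma power_int_mono_exp: "1 \<le> (s::real) \<Longrightarrow> a \<le> b \<Longrightarrow> s powi a \<le> s powi b"
  by (rule power_int_increasing)

text \<open>Evaluating the growth bound along one-parameter subgroups confines the weights to the
  polytope of rank inequalities.\<close>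

lemma weight_bound:
  fixes K :: "nat \<Rightarrow> 'n::finite set" and h :: "complex^'n^'n" and \<mu> :: "'n \<Rightarrow> int"
  assumes C: "0 \<le> C" and bound: "\<And>t. (\<And>i. t i \<noteq> 0) \<Longrightarrow> (\<Prod>i\<in>UNIV. t i) = 1 \<Longrightarrow>
      norm ((\<Prod>i\<in>UNIV. t i powi \<mu> i) * c) \<le> C * (\<Prod>q<L. minors_norm (K q) (dg t ** h))"
    and c: "c \<noteq> 0" and sum: "(\<Sum>i\<in>UNIV. \<mu> i) = (\<Sum>q<L. int (card (K q)))"
  shows "(\<Sum>i\<in>A. \<mu> i) \<le> (\<Sum>q<L. rk (K q) h A)"
proof (rule ccontr)
  define N where "N = int CARD('n)"
  define a where "a = int (card A)"
  define r where "r = (\<lambda>q. rk (K q) h A)"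
  define B where "B = C * (\<Prod>q<L. minors_norm (K q) h)"
  assume "\<not> ?thesis"
  then have gt: "(\<Sum>q<L. r q) + 1 \<le> (\<Sum>i\<in>A. \<mu> i)" by (simp add: r_def)
  have N1: "1 \<le> N" by (simp add: N_def Suc_leI)
  have mn: "0 \<le> minors_norm K' h'" for K' and h' :: "complex^'n^'n" by (simp add: minors_norm_def sum_nonneg)
  have main: "s * norm c \<le> B" if s: "1 \<le> s" for s :: real
  proof -
    \<comment> \<open>Rows in \<open>A\<close> are scaled by \<open>s^(N - a)\<close> and the others
      by \<open>s^(-a)\<close>, so the product of all entries is 1. The correction \<open>a\<close>
      cancels in the comparison because the weight and the minors have the same total
      degree.\<close>
    define t where "t = (\<lambda>i. complex_of_real s powi (N * (if i \<in> A then 1 else 0) - a))"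
    have s0: "complex_of_real s \<noteq> 0" using s by simp
    have t0: "t i \<noteq> 0" for i using s0 by (simp add: t_def)
    have prod_t: "(\<Prod>i\<in>I. t i powi z i) = complex_of_real s powi (N * (\<Sum>i\<in>I \<inter> A. z i) - a * (\<Sum>i\<in>I. z i))" for I and z :: "'n \<Rightarrow> int"
    proof -
      have "(\<Prod>i\<in>I. t i powi z i) = complex_of_real s powi (\<Sum>i\<in>I. (N * (if i \<in> A then 1 else 0) - a) * z i)"
        by (simp add: t_def power_int_sum[OF s0] power_int_mult)
      also have "(\<Sum>i\<in>I. (N * (if i \<in> A then 1 else 0) - a) * z i) = N * (\<Sum>i\<in>I. if i \<in> A then z i else 0) - a * (\<Sum>i\<in>I. z i)"
      proof -
        have "(\<Sum>i\<in>I. (N * (if i \<in> A then 1 else 0) - a) * z i) = (\<Sum>i\<in>I. N * (if i \<in> A then z i else 0) - a * z i)"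
          by (intro sum.cong) (auto simp: left_diff_distrib)
        then show ?thesis by (simp add: sum_subtractf sum_distrib_left)
      qed
      also have "(\<Sum>i\<in>I. if i \<in> A then z i else 0) = (\<Sum>i\<in>I \<inter> A. z i)"
        by (simp add: sum.inter_restrict)
      finally show ?thesis .
    qed
    have t1: "(\<Prod>i\<in>UNIV. t i) = 1"
      using prod_t[where I = UNIV and z = "\<lambda>_. 1"] by (simp add: N_def a_def)
    have minors: "minors_norm (K q) (dg t ** h) \<le> s powi (N * r q - a * int (card (K q))) * minors_norm (K q) h" for q
      unfolding minors_norm_def sum_distrib_left
    proof (rule sum_mono)
      fix \<sigma>
      show "norm (minor_det (K q) \<sigma> (dg t ** h)) \<le> s powi (N * r q - a * int (card (K q))) * norm (minor_det (K q) \<sigma> h)"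
      proof (cases "inj_on \<sigma> (- K q) \<and> minor_det (K q) \<sigma> h \<noteq> 0")
        case True
        define I where "I = - \<sigma> ` (- K q)"
        have cI: "card I = card (K q)"
          using card_image[of \<sigma> "- K q"] True by (simp add: I_def card_compl card_mono)
        have "(\<Prod>i\<in>I. t i) = complex_of_real s powi (N * int (card (I \<inter> A)) - a * int (card (K q)))"
          using prod_t[where I = I and z = "\<lambda>_. 1"] by (simp add: cI)
        moreover have "int (card (I \<inter> A)) \<le> r q"
          using minor_nonzero_rk[of "K q" \<sigma> h A] True by (simp add: r_def I_def Diff_eq Int_commute)
        then have "s powi (N * int (card (I \<inter> A)) - a * int (card (K q))) \<le> s powi (N * r q - a * int (card (K q)))"
          using N1 by (intro power_int_mono_exp[OF s]) simp
        ultimately show ?thesis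
          using True s by (simp add: minor_det_dg[OF t0] I_def[symmetric] norm_mult norm_power_int mult_right_mono)
      next
        case False
        have "minor_det (K q) \<sigma> (dg t ** h) = 0"
        proof (cases "inj_on \<sigma> (- K q)")
          case True
          then show ?thesis using False by (simp add: minor_det_dg[OF t0])
        qed (use minor_det_nonzero_inj in blast)
        then show ?thesis using s by simp
      qed
    qed
    have "s powi (N * (\<Sum>i\<in>A. \<mu> i) - a * (\<Sum>q<L. int (card (K q)))) * norm c \<le> C * (\<Prod>q<L. minors_norm (K q) (dg t ** h))"
      using bound[OF t0 t1] prod_t[where I = UNIV and z = \<mu>] s by (simp add: norm_mult norm_power_int sum)
    also have "\<dots> \<le> C * (\<Prod>q<L. s powi (N * r q - a * int (card (K q))) * minors_norm (K q) h)"
      using minors mn by (intro mult_left_mono[OF _ C] prod_mono) auto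
    also have "\<dots> = s powi (N * (\<Sum>q<L. r q) - a * (\<Sum>q<L. int (card (K q)))) * B"
      using s by (simp add: B_def prod.distrib power_int_sum[symmetric] sum_subtractf sum_distrib_left)
    finally have "s powi (N * (\<Sum>i\<in>A. \<mu> i)) * norm c \<le> s powi (N * (\<Sum>q<L. r q)) * B"
      using s by (simp add: power_int_diff divide_right_mono field_simps)
    \<comment> \<open>Both sums are integers, so a violated inequality fails by at least 1, which
      leaves a spare factor \<open>s\<close>.\<close>
    moreover have "s powi (N * (\<Sum>q<L. r q) + 1) \<le> s powi (N * (\<Sum>i\<in>A. \<mu> i))"
    proof (rule power_int_mono_exp[OF s])
      have "N * ((\<Sum>q<L. r q) + 1) \<le> N * (\<Sum>i\<in>A. \<mu> i)" using gt N1 by (intro mult_left_mono) auto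
      then show "N * (\<Sum>q<L. r q) + 1 \<le> N * (\<Sum>i\<in>A. \<mu> i)" using N1 by (simp add: algebra_simps)
    qed
    ultimately have "s powi (N * (\<Sum>q<L. r q) + 1) * norm c \<le> s powi (N * (\<Sum>q<L. r q)) * B"
      by (meson mult_right_mono norm_ge_zero order_trans)
    then show ?thesis using s by (simp add: power_int_add mult.assoc)
  qed
  have B0: "0 \<le> B" unfolding B_def using C mn by (intro mult_nonneg_nonneg prod_nonneg) auto
  \<comment> \<open>Every \<open>s\<close> above \<open>B / norm c\<close> contradicts the bound;
    adding 1 also ensures \<open>1 \<le> s\<close>.\<close>
  have "(B / norm c + 1) * norm c \<le> B" using B0 by (intro main) simp
  moreover have "(B / norm c + 1) * norm c = B + norm c" using c by (simp add: field_simps)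
  ultimately show False using c by simp
qed

section \<open>The parabolic subgroup of a weight\<close>

lemma SL_simps [simp]: "carrier SL = {A. det A = 1}" "A \<otimes>\<^bsub>SL\<^esub> B = A ** B" "\<one>\<^bsub>SL\<^esub> = mat 1"
  by (simp_all add: SL_def)

lemma det_1_right_inverse:
  fixes A :: "complex^'n^'n"
  assumes "det A = 1"
  obtains B where "det B = 1" "B ** A = mat 1" "A ** B = mat 1"
proof -
  obtain B where B: "A ** B = mat 1" "B ** A = mat 1"
    using assms invertible_det_nz[of A] by (auto simp: invertible_def)
  then have "det A * det B = 1" by (metis det_I det_mul)
  then show ?thesis using that B assms by simp
qed

lemma group_SL: "group SL"
proof (rule groupI)
  fix A :: "complex^'n^'n" assume "A \<in> carrier SL"
  then have "det A = 1" by simp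
  then obtain B where "det B = 1" "B ** A = mat 1" by (rule det_1_right_inverse)
  then show "\<exists>B\<in>carrier SL. B \<otimes>\<^bsub>SL\<^esub> A = \<one>\<^bsub>SL\<^esub>" by (intro bexI[of _ B]) simp_all
qed (auto simp: det_mul matrix_mul_assoc det_I)

lemma inv_SL:
  fixes A :: "complex^'n^'n"
  assumes "det A = 1"
  shows "det (inv\<^bsub>SL\<^esub> A) = 1" "inv\<^bsub>SL\<^esub> A ** A = mat 1" "A ** inv\<^bsub>SL\<^esub> A = mat 1"
  using group.inv_closed[OF group_SL, of A] group.l_inv[OF group_SL, of A] group.r_inv[OF group_SL, of A] assms by auto

lemma inv_SL_eq:
  fixes A :: "complex^'n^'n"
  assumes "det A = 1" "det B = 1" "A ** B = mat 1"
  shows "inv\<^bsub>SL\<^esub> A = B"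
proof -
  have "B ** A = mat 1" using assms(3) by (simp add: matrix_left_right_inverse)
  then show ?thesis using group.inv_equality[OF group_SL, of B A] assms by simp
qed

lemma upper_borel_iff: "b \<in> upper_borel \<longleftrightarrow> upper b"
  by (auto simp: upper_borel_def upper_def)

lemma diag_torus_iff: "t \<in> diag_torus \<longleftrightarrow> (\<exists>x. t = dg x \<and> (\<Prod>i\<in>UNIV. x i) = 1)"
proof
  assume t: "t \<in> diag_torus"
  then have "t = dg (\<lambda>i. t $ i $ i)" by (simp add: diag_torus_def dg_def vec_eq_iff)
  moreover have "(\<Prod>i\<in>UNIV. t $ i $ i) = 1"
    using t det_diagonal[of t] by (simp add: diag_torus_def)
  ultimately show "\<exists>x. t = dg x \<and> (\<Prod>i\<in>UNIV. x i) = 1" by (intro exI conjI)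
qed (auto simp: diag_torus_def det_dg dg_nth)

lemma dg_mult: "dg s ** dg t = dg (\<lambda>i. s i * t i)"
  by (simp add: vec_eq_iff dg_mult_nth dg_nth)

lemma dg_1: "dg (\<lambda>_. 1) = mat 1"
  by (simp add: vec_eq_iff dg_nth mat_def)

section \<open>Polynomial functions of matrices\<close>

definition polynomial_fun :: "(complex^'n^'n \<Rightarrow> complex) \<Rightarrow> bool" where
  "polynomial_fun f \<longleftrightarrow> (\<exists>p :: ('n \<times> 'n) cpoly. \<forall>g. f g = peval p (entries g))"

lemma polynomial_fun_const: "polynomial_fun (\<lambda>_. c)"
  unfolding polynomial_fun_def by (rule exI[of _ "pconst c"]) simp

lemma polynomial_fun_entry: "polynomial_fun (\<lambda>g. g $ i $ j)"
  unfolding polynomial_fun_def by (rule exI[of _ "pvar (i, j)"]) simp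

lemma polynomial_fun_mult: "polynomial_fun f \<Longrightarrow> polynomial_fun g \<Longrightarrow> polynomial_fun (\<lambda>x. f x * g x)"
  unfolding polynomial_fun_def by (metis peval.hom_mult)

lemma polynomial_fun_add: "polynomial_fun f \<Longrightarrow> polynomial_fun g \<Longrightarrow> polynomial_fun (\<lambda>x. f x + g x)"
  unfolding polynomial_fun_def by (metis peval.hom_add)

lemma polynomial_fun_sum: "(\<And>i. i \<in> I \<Longrightarrow> polynomial_fun (f i)) \<Longrightarrow> polynomial_fun (\<lambda>x. \<Sum>i\<in>I. f i x)"
  by (induction I rule: infinite_finite_induct) (auto intro: polynomial_fun_const polynomial_fun_add)

lemma polynomial_fun_prod: "(\<And>i. i \<in> I \<Longrightarrow> polynomial_fun (f i)) \<Longrightarrow> polynomial_fun (\<lambda>x. \<Prod>i\<in>I. f i x)"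
  by (induction I rule: infinite_finite_induct) (auto intro: polynomial_fun_const polynomial_fun_mult)

lemma polynomial_fun_minor_det: "polynomial_fun (minor_det K \<sigma>)"
proof -
  have "polynomial_fun (\<lambda>g. minor K \<sigma> g $ i $ j)" for i j
    by (cases "j \<in> K") (simp_all add: minor_def polynomial_fun_entry polynomial_fun_const)
  then show ?thesis
    unfolding det_def by (intro polynomial_fun_sum polynomial_fun_mult polynomial_fun_prod polynomial_fun_const)
qed

lemma continuous_on_peval_entries: "continuous_on S (\<lambda>g. peval p (entries g))"
  unfolding peval_eq_sum mono_eval_def case_prod_unfold by (intro continuous_intros)

lemma closed_det_1: "closed {A :: complex^'n^'n. det A = 1}"
  unfolding det_def by (intro closed_Collect_eq continuous_intros)

lemma zariski_closed_imp_closed: "zariski_closed_in_SL P \<Longrightarrow> closed P"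
proof -
  assume "zariski_closed_in_SL P"
  then obtain S where "P = {A. det A = 1} \<inter> (\<Inter>p\<in>S. {g. peval p (entries g) = 0})"
    by (auto simp: zariski_closed_in_SL_def)
  then show ?thesis
    by (auto intro!: closed_Int closed_det_1 closed_INT closed_Collect_eq continuous_on_peval_entries continuous_on_const)
qed

text \<open>\<open>l\<close> represents the weight modulo constant vectors. Positive entries make
  its character polynomial in the diagonal entries and the degree \<open>L\<close> positive even for
  the trivial weight.\<close>

locale flag =
  fixes l :: "'n::{finite,linorder} \<Rightarrow> nat" and lam :: "int^'n::{finite,linorder}"
  assumes antitone: "i \<le> j \<Longrightarrow> l j \<le> l i" and l_pos: "1 \<le> l i"
    and weight: "t \<in> diag_torus \<Longrightarrow> weight_char lam t = (\<Prod>i\<in>UNIV. t $ i $ i ^ l i)"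
begin

definition L :: nat where "L = (\<Sum>i\<in>UNIV. l i)"

text \<open>The columns of the Young diagram of \<open>l\<close>.\<close>

definition K :: "nat \<Rightarrow> 'n set" where "K q = {i. q < l i}"

lemma l_le_L: "l i \<le> L"
  unfolding L_def by (rule member_le_sum) auto

lemma K_down: "j \<in> K q \<Longrightarrow> i < j \<Longrightarrow> i \<in> K q"
  using antitone[of i j, OF less_imp_le] by (auto simp: K_def)

lemma K_nested: "K q \<subseteq> K q' \<or> K q' \<subseteq> K q"
  by (auto simp: K_def)

lemma prod_levels: "(\<Prod>q<L. \<Prod>i\<in>K q. x i) = (\<Prod>i\<in>UNIV. x i ^ l i :: complex)"
proof -
  have level: "(\<Prod>q<L. if q < l i then x i else 1) = x i ^ l i" for i
  proof -
    have "(\<Prod>q<L. if q < l i then x i else 1) = (\<Prod>q<l i. x i)"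
      using l_le_L[of i] by (intro prod.mono_neutral_cong_right) auto
    then show ?thesis by simp
  qed
  have "(\<Prod>q<L. \<Prod>i\<in>K q. x i) = (\<Prod>q<L. \<Prod>i\<in>UNIV. if q < l i then x i else 1)"
    by (rule prod.cong[OF refl], rule prod.mono_neutral_cong_left) (auto simp: K_def)
  also have "\<dots> = (\<Prod>i\<in>UNIV. \<Prod>q<L. if q < l i then x i else 1)" by (rule prod.swap)
  also have "\<dots> = (\<Prod>i\<in>UNIV. x i ^ l i)" by (simp only: level)
  finally show ?thesis .
qed

lemma sum_levels: "(\<Sum>q<L. \<Sum>i\<in>K q. x i) = (\<Sum>i\<in>UNIV. int (l i) * x i)"
proof -
  have level: "(\<Sum>q<L. if q < l i then x i else 0) = int (l i) * x i" for i
  proof -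
    have "(\<Sum>q<L. if q < l i then x i else 0) = (\<Sum>q<l i. x i)"
      using l_le_L[of i] by (intro sum.mono_neutral_cong_right) auto
    then show ?thesis by simp
  qed
  have "(\<Sum>q<L. \<Sum>i\<in>K q. x i) = (\<Sum>q<L. \<Sum>i\<in>UNIV. if q < l i then x i else 0)"
    by (rule sum.cong[OF refl], rule sum.mono_neutral_cong_left) (auto simp: K_def)
  also have "\<dots> = (\<Sum>i\<in>UNIV. \<Sum>q<L. if q < l i then x i else 0)" by (rule sum.swap)
  also have "\<dots> = (\<Sum>i\<in>UNIV. int (l i) * x i)" by (simp only: level)
  finally show ?thesis .
qed

lemma sum_card_K: "(\<Sum>q<L. int (card (K q))) = (\<Sum>i\<in>UNIV. int (l i))"
  using sum_levels[of "\<lambda>_. 1"] by simp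

text \<open>Block upper triangular matrices whose blocks are the level sets of \<open>l\<close>: as
  \<open>l\<close> is antitone, the entries required to vanish lie below the diagonal.\<close>

definition P0 :: "(complex^'n::{finite,linorder}^'n::{finite,linorder}) set" where
  "P0 = {p. det p = 1 \<and> (\<forall>i j. l i < l j \<longrightarrow> p $ i $ j = 0)}"

text \<open>A product of leading principal minors: the columns outside the initial segment
  \<open>K q\<close> are replaced by the unit vectors of the same index. Empty levels contribute the
  factor 1.\<close>

definition psi0 :: "complex^'n::{finite,linorder}^'n::{finite,linorder} \<Rightarrow> complex" where
  "psi0 p = (\<Prod>q<L. minor_det (K q) id p)"

lemma P0_zero: "p \<in> P0 \<Longrightarrow> i \<notin> K q \<Longrightarrow> j \<in> K q \<Longrightarrow> p $ i $ j = 0"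
  by (auto simp: P0_def K_def)

text \<open>A character is invariant under conjugation. Conjugating by a one-parameter subgroup of
  the torus contracts \<open>u\<close> to its diagonal, and the character passes to the limit
  because it is polynomial.\<close>

lemma psi_upper:
  assumes P: "subgroup P SL" "upper_borel \<subseteq> P" and psi: "extends_weight lam P \<psi>" and u: "upper u"
  shows "\<psi> u = (\<Prod>i\<in>UNIV. u $ i $ i ^ l i)"
proof -
  have hom: "\<psi> (g ** h) = \<psi> g * \<psi> h" if "g \<in> P" "h \<in> P" for g h
    using psi that by (simp add: extends_weight_def algebraic_character_def)
  have T: "\<psi> (dg x) = (\<Prod>i\<in>UNIV. x i ^ l i)" if "(\<Prod>i\<in>UNIV. x i) = 1" for x
  proof -
    have "dg x \<in> diag_torus" using that diag_torus_iff by blast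
    then show ?thesis using psi weight[of "dg x"] by (simp add: extends_weight_def dg_nth)
  qed
  have TP: "dg x \<in> P" if "(\<Prod>i\<in>UNIV. x i) = 1" for x
    using P(2) that upper_borel_iff[of "dg x"] by (auto simp: upper_def dg_nth det_dg)
  have uP: "u \<in> P" using P(2) u upper_borel_iff by blast
  have ut: "u $ i $ j = 0" if "j < i" for i j using u that by (auto simp: upper_def)
  obtain pp where pp: "\<And>g. g \<in> P \<Longrightarrow> \<psi> g = peval pp (entries g)"
    using psi by (auto simp: extends_weight_def algebraic_character_def)
  define r where "r = (\<lambda>i::'n. int (card {j. j < i}))"
  have r: "r i < r j" if "i < j" for i j
    unfolding r_def using that by (auto intro!: psubset_card_mono)
  \<comment> \<open>The ranks of the indices, scaled and shifted to have sum 0, so that the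
    one-parameter subgroup has determinant 1. They still increase strictly, so entries above the
    diagonal receive negative powers.\<close>
  define w where "w = (\<lambda>i. int CARD('n) * r i - (\<Sum>i\<in>UNIV. r i))"
  have w: "w i < w j" if "i < j" for i j using r[OF that] by (simp add: w_def)
  have w0: "(\<Sum>i\<in>UNIV. w i) = 0" by (simp add: w_def sum_subtractf sum_distrib_left)
  define v where "v = (\<lambda>(m::nat). \<chi> i j. (of_nat (Suc m) :: complex) powi (w i - w j) * u $ i $ j)"
  have psi_v: "v m \<in> P \<and> \<psi> (v m) = \<psi> u" for m
  proof -
    define s where "s = (of_nat (Suc m) :: complex)"
    have s: "s \<noteq> 0" unfolding s_def by (simp only: of_nat_eq_0_iff)
    define x y where "x = (\<lambda>i. s powi w i)" and "y = (\<lambda>i. s powi (- w i))"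
    have x1: "(\<Prod>i\<in>UNIV. x i) = 1" "(\<Prod>i\<in>UNIV. y i) = 1"
      using w0 by (simp_all add: x_def y_def power_int_sum[OF s, symmetric] sum_negf)
    have xy: "x i * y i = 1" for i by (simp add: x_def y_def power_int_add[symmetric] s)
    have "v m = (\<chi> i j. s powi (w i - w j) * u $ i $ j)" by (simp only: v_def s_def)
    then have "v m = dg x ** u ** dg y"
      by (simp add: vec_eq_iff dg_mult_nth mult_dg_nth x_def y_def power_int_diff power_int_minus s divide_inverse mult_ac)
    moreover have "dg x ** u \<in> P" using subgroup.m_closed[OF P(1) TP[OF x1(1)] uP] by simp
    moreover have "\<psi> (dg x) * \<psi> (dg y) = 1"
      unfolding T[OF x1(1)] T[OF x1(2)] prod.distrib[symmetric] power_mult_distrib[symmetric] xy by simp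
    moreover have "dg x ** u ** dg y \<in> P"
      using subgroup.m_closed[OF P(1) \<open>dg x ** u \<in> P\<close> TP[OF x1(2)]] by simp
    ultimately show ?thesis using hom[of "dg x ** u" "dg y"] hom[of "dg x" u] TP x1 uP by (simp add: mult_ac)
  qed
  define d where "d = dg (\<lambda>i. u $ i $ i)"
  have "(\<lambda>m. v m $ i $ j) \<longlonglongrightarrow> d $ i $ j" for i j
  proof -
    consider "i < j" | "j < i" | "i = j" by (rule linorder_cases)
    then show ?thesis
    proof cases
      case 1
      define k where "k = nat (w j - w i)"
      have k: "0 < k" "w i - w j = - int k" using w[OF 1] by (auto simp: k_def)
      have "(\<lambda>m. inverse (of_nat (Suc m)) :: complex) \<longlonglongrightarrow> 0"
        using tendsto_of_real[OF LIMSEQ_inverse_real_of_nat, where 'a = complex]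
        by (simp only: of_real_inverse of_real_of_nat_eq of_real_0)
      then have "(\<lambda>m. inverse (of_nat (Suc m)) ^ k * u $ i $ j) \<longlonglongrightarrow> 0 ^ k * u $ i $ j"
        by (intro tendsto_intros)
      then show ?thesis using 1 k by (auto simp: v_def d_def dg_nth power_int_minus power_inverse zero_power)
    next
      case 2
      then show ?thesis using ut[OF 2] 2 by (auto simp: v_def d_def dg_nth)
    qed (simp add: v_def d_def dg_nth)
  qed
  then have "v \<longlonglongrightarrow> d" by (intro vec_tendstoI)
  then have "(\<lambda>m. peval pp (entries (v m))) \<longlonglongrightarrow> peval pp (entries d)"
    using continuous_on_peval_entries[of UNIV pp]
    by (intro isCont_tendsto_compose[of d "\<lambda>g. peval pp (entries g)"]) (simp_all add: continuous_on_eq_continuous_at)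
  moreover have "det u = (\<Prod>i\<in>UNIV. u $ i $ i)" using ut by (rule det_upper_triangular)
  then have d1: "(\<Prod>i\<in>UNIV. u $ i $ i) = 1" using u by (simp add: upper_def)
  have "peval pp (entries (v m)) = \<psi> u" for m using pp psi_v by metis
  ultimately have "(\<lambda>m::nat. \<psi> u) \<longlonglongrightarrow> \<psi> d" using pp[OF TP[OF d1]] by (simp add: d_def)
  then have "\<psi> u = \<psi> d" by (simp add: LIMSEQ_const_iff)
  then show ?thesis using T[OF d1] by (simp add: d_def)
qed

text \<open>Here the subgroup takes the place of the whole group, which lets the weight bound speak
  about a parabolic subgroup that is not yet known.\<close>

lemma psi_growth:
  assumes P: "subgroup P SL" "upper_borel \<subseteq> P" "closed P" and psi: "extends_weight lam P \<psi>"
  shows "\<exists>C\<ge>0. \<forall>h\<in>P. norm (\<psi> h) \<le> C * (\<Prod>q<L. minors_norm (K q) h)"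
proof (rule growth[OF K_down P(3)])
  obtain pp where pp: "\<And>g. g \<in> P \<Longrightarrow> \<psi> g = peval pp (entries g)"
    using psi by (auto simp: extends_weight_def algebraic_character_def)
  have "continuous_on P (\<lambda>g. peval pp (entries g))" by (rule continuous_on_peval_entries)
  then show "continuous_on P \<psi>" using pp by (simp cong: continuous_on_cong)
  show "det h = 1" if "h \<in> P" for h using subgroup.subset[OF P(1)] that by auto
  fix h u :: "complex^'n::{finite,linorder}^'n::{finite,linorder}"
  assume h: "h \<in> P" and u: "upper u"
  have uP: "u \<in> P" using P(2) u upper_borel_iff by blast
  show "h ** u \<in> P" using subgroup.m_closed[OF P(1) h uP] by simp
  have "\<psi> (h ** u) = \<psi> h * \<psi> u" using psi h uP by (simp add: extends_weight_def algebraic_character_def)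
  then show "\<psi> (h ** u) = (\<Prod>q<L. \<Prod>i\<in>K q. u $ i $ i) * \<psi> h"
    using psi_upper[OF P(1,2) psi u] by (simp add: prod_levels)
qed auto

text \<open>Along the torus orbit of \<open>p\<close> the character has weight \<open>l\<close>, so
  the weight bound holds for \<open>l\<close> and the rows \<open>K q\<close>. As the levels are
  nested, each rank is at most \<open>card (K q' \<inter> K q)\<close>; these numbers already add up
  to the left-hand side, so all the rank estimates are equalities.\<close>

lemma big_cell:
  assumes P: "subgroup P SL" "upper_borel \<subseteq> P" "closed P" and psi: "extends_weight lam P \<psi>"
    and p: "p \<in> P" and q: "q < L"
  shows "col_space (K q) p \<inter> vanish (K q) = {0}"
proof -
  obtain C where C: "0 \<le> C" "\<And>h. h \<in> P \<Longrightarrow> norm (\<psi> h) \<le> C * (\<Prod>q<L. minors_norm (K q) h)"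
    using psi_growth[OF P psi] by blast
  have detp: "det p = 1" using subgroup.subset[OF P(1)] p by auto
  then have inv: "invertible p" by (simp add: invertible_det_nz)
  have "(\<Sum>i\<in>K q. int (l i)) \<le> (\<Sum>q'<L. rk (K q') p (K q))"
  proof (rule weight_bound[OF C(1)])
    show "\<psi> p \<noteq> 0" using psi p by (simp add: extends_weight_def algebraic_character_def)
    show "(\<Sum>i\<in>UNIV. int (l i)) = (\<Sum>q<L. int (card (K q)))" by (simp add: sum_card_K)
    fix t :: "'n \<Rightarrow> complex" assume t: "(\<Prod>i\<in>UNIV. t i) = 1"
    have dt: "dg t \<in> diag_torus" using t diag_torus_iff by blast
    have tP: "dg t \<in> P" using P(2) t upper_borel_iff[of "dg t"] by (auto simp: upper_def dg_nth det_dg)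
    have "\<psi> (dg t ** p) = \<psi> (dg t) * \<psi> p" using psi p tP by (simp add: extends_weight_def algebraic_character_def)
    also have "\<psi> (dg t) = (\<Prod>i\<in>UNIV. t i powi int (l i))"
      using psi dt weight[OF dt] by (simp add: extends_weight_def dg_nth)
    finally show "norm ((\<Prod>i\<in>UNIV. t i powi int (l i)) * \<psi> p) \<le> C * (\<Prod>q<L. minors_norm (K q) (dg t ** p))"
      using C(2)[of "dg t ** p"] subgroup.m_closed[OF P(1) tP p] by simp
  qed
  moreover have "(\<Sum>i\<in>K q. int (l i)) = (\<Sum>q'<L. int (card (K q' \<inter> K q)))"
  proof -
    have "(\<Sum>i\<in>K q. int (l i)) = (\<Sum>i\<in>UNIV. int (l i) * (if i \<in> K q then 1 else 0))"
      by (rule sum.mono_neutral_cong_left) auto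
    also have "\<dots> = (\<Sum>q'<L. \<Sum>i\<in>K q'. if i \<in> K q then 1 else 0)" by (rule sum_levels[symmetric])
    also have "\<dots> = (\<Sum>q'<L. int (card (K q' \<inter> K q)))"
      by (intro sum.cong refl) (simp add: sum.If_cases Int_def)
    finally show ?thesis .
  qed
  moreover have le: "rk (K q') p (K q) \<le> int (card (K q' \<inter> K q))" for q'
    using K_nested[of q q'] rk_le_card[OF inv, of "K q'" "K q"] rk_le_card'[of "K q'" p "K q"]
    by (auto simp: Int_absorb1 Int_absorb2)
  ultimately have "(\<Sum>q'<L. int (card (K q' \<inter> K q)) - rk (K q') p (K q)) = 0"
    using sum_mono[of "{..<L}" "\<lambda>q'. rk (K q') p (K q)" "\<lambda>q'. int (card (K q' \<inter> K q))"] le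
    by (simp add: sum_subtractf)
  then have "\<forall>q'\<in>{..<L}. int (card (K q' \<inter> K q)) - rk (K q') p (K q) = 0"
    using le by (subst sum_nonneg_eq_0_iff[symmetric]) auto
  then have "int (card (K q \<inter> K q)) - rk (K q) p (K q) = 0" using q by blast
  then have "rk (K q) p (K q) = int (card (K q))" by simp
  then show ?thesis by (simp add: rk_eq_card_iff)
qed

text \<open>If \<open>p\<close> in the parabolic subgroup maps a unit vector \<open>e\<^sub>j\<close> with \<open>j \<in> K q\<close> out of the coordinate
  subspace of \<open>K q\<close>, then a unipotent upper triangular \<open>b\<close> moves its image into the image of the
  complementary coordinate subspace, and \<open>p\<inverse> b p\<close> leaves the big cell.\<close>

lemma parabolic_subset_P0:
  assumes P: "subgroup P SL" "upper_borel \<subseteq> P" "closed P" and psi: "extends_weight lam P \<psi>"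
  shows "P \<subseteq> P0"
proof
  fix p assume p: "p \<in> P"
  have detp: "det p = 1" using subgroup.subset[OF P(1)] p by auto
  have cell: "h *v y = 0" if "h \<in> P" "q < L" "y \<in> vanish (- K q)" "h *v y \<in> vanish (K q)" for h y q
    using big_cell[OF P psi that(1,2)] that(3,4) unfolding col_space_def by blast
  obtain p' where p': "p' \<in> P" "p' ** p = mat 1" "p ** p' = mat 1"
    using inv_SL[OF detp] subgroup.m_inv_closed[OF P(1) p] by blast
  have pp': "p *v (p' *v y) = y" "p' *v (p *v y) = y" for y
    using p' by (simp_all add: matrix_vector_mul_assoc matrix_vector_mul_lid)
  show "p \<in> P0" unfolding P0_def
  proof (intro CollectI conjI allI impI detp, rule ccontr)
    fix i j assume ij: "l i < l j" and nz: "p $ i $ j \<noteq> 0"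
    define q where "q = l i"
    have q: "q < L" using ij l_le_L[of j] by (simp add: q_def)
    have iK: "i \<notin> K q" and jK: "j \<in> K q" using ij by (auto simp: K_def q_def)
    define v where "v = p *v axis j 1"
    have vi: "v $ i = p $ i $ j"
      by (simp add: v_def matrix_vector_mult_def axis_def if_distrib cong: if_cong)
    \<comment> \<open>The block of \<open>p\<close> outside \<open>K q\<close>, completed by the
      identity. It is invertible because the big cell condition also holds for the inverse
      \<open>p'\<close>.\<close>
    define Q :: "complex^'n::{finite,linorder}^'n::{finite,linorder}"
      where "Q = (\<chi> a b. if a \<in> K q \<or> b \<in> K q then if a = b then 1 else 0 else p $ a $ b)"
    have Q: "(Q *v y) $ a = (if a \<in> K q then y $ a else (p *v (\<chi> b. if b \<in> K q then 0 else y $ b)) $ a)" for y a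
    proof (cases "a \<in> K q")
      case True
      then show ?thesis by (simp add: Q_def matrix_vector_mult_def if_distrib[of "\<lambda>x. x * _"] cong: if_cong)
    next
      case False
      then show ?thesis unfolding matrix_vector_mult_def Q_def by simp (intro sum.cong, auto)
    qed
    have "det Q \<noteq> 0"
    proof (rule det_nonzero_if_kernel_trivial)
      fix y assume y: "Q *v y = 0"
      define z where "z = (\<chi> b. if b \<in> K q then 0 else y $ b)"
      have yK: "y $ a = 0" if "a \<in> K q" for a using Q[of y a] y that by simp
      then have yz: "y = z" by (simp add: z_def vec_eq_iff)
      have "(p *v z) $ a = 0" if "a \<notin> K q" for a using Q[of y a] y that by (simp add: z_def)
      then have "p *v z \<in> vanish (- K q)" by (auto simp: vanish_def)
      moreover have "p' *v (p *v z) \<in> vanish (K q)" unfolding pp' by (simp add: vanish_def z_def)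
      ultimately have "p' *v (p *v z) = 0" by (rule cell[OF p'(1) q])
      then show "y = 0" using yz pp' by simp
    qed
    then obtain Q' where "Q ** Q' = mat 1" using invertible_det_nz[of Q] by (auto simp: invertible_def)
    then have QQ': "Q *v (Q' *v x) = x" for x by (simp add: matrix_vector_mul_assoc)
    \<comment> \<open>Supported outside \<open>K q\<close> and such that \<open>p *v y\<close>
      agrees with \<open>v\<close> in all rows outside \<open>K q\<close>.\<close>
    define y where "y = (\<chi> b. if b \<in> K q then 0 else (Q' *v v) $ b)"
    define w where "w = p *v y"
    have wv: "w $ a = v $ a" if "a \<notin> K q" for a
      using Q[of "Q' *v v" a] that unfolding QQ' by (simp add: w_def y_def)
    \<comment> \<open>Adds multiples of row \<open>i\<close> to the rows in \<open>K q\<close>,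
      which turns \<open>v\<close> into \<open>w\<close> as \<open>v $ i\<close> is nonzero. It is
      upper triangular because \<open>K q\<close> is an initial segment that misses
      \<open>i\<close>.\<close>
    define b :: "complex^'n::{finite,linorder}^'n::{finite,linorder}"
      where "b = (\<chi> k m. (if k = m then 1 else 0) + (if m = i \<and> k \<in> K q then (w $ k - v $ k) / v $ i else 0))"
    have "b $ k $ m = 0" if "m < k" for k m
      using that iK K_down[of k q m] by (auto simp: b_def)
    moreover have "b $ k $ k = 1" for k using iK by (auto simp: b_def)
    ultimately have "upper b" by (simp add: upper_def det_upper_triangular)
    then have bP: "b \<in> P" using P(2) upper_borel_iff by blast
    have bv: "b *v v = w"
    proof -
      have comp: "(b *v v) $ k = (\<Sum>m\<in>UNIV. b $ k $ m * v $ m)" for k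
        by (simp add: matrix_vector_mult_def)
      have "(b *v v) $ k = w $ k" for k
      proof (cases "k \<in> K q")
        case True
        have "(b *v v) $ k = (\<Sum>m\<in>UNIV. (if k = m then v $ m else 0) + (if m = i then (w $ k - v $ k) / v $ i * v $ m else 0))"
          unfolding comp using True by (intro sum.cong) (auto simp: b_def distrib_right)
        also have "\<dots> = w $ k" using nz by (simp add: sum.distrib vi)
        finally show ?thesis .
      next
        case False
        have "(b *v v) $ k = (\<Sum>m\<in>UNIV. if k = m then v $ m else 0)"
          unfolding comp using False by (intro sum.cong) (auto simp: b_def)
        then show ?thesis using wv[OF False] by simp
      qed
      then show ?thesis by (simp add: vec_eq_iff)
    qed
    have gP: "p' ** b ** p \<in> P"
      using subgroup.m_closed[OF P(1) subgroup.m_closed[OF P(1) p'(1) bP] p] by simp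
    have "(p' ** b ** p) *v axis j 1 = p' *v (b *v v)"
      by (simp add: v_def matrix_vector_mul_assoc matrix_mul_assoc)
    then have gy: "(p' ** b ** p) *v axis j 1 = y" unfolding bv w_def pp' .
    have "(p' ** b ** p) *v axis j 1 = 0"
    proof (rule cell[OF gP q])
      show "axis j 1 \<in> vanish (- K q)" using jK by (auto simp: vanish_def axis_def)
      show "(p' ** b ** p) *v axis j 1 \<in> vanish (K q)" unfolding gy by (simp add: vanish_def y_def)
    qed
    then have "w = 0" using gy by (simp add: w_def)
    then show False using wv[OF iK] vi nz by simp
  qed
qed

end

lemma bounded_powers_imp_le:
  fixes x y :: real
  assumes "\<And>m. x ^ m \<le> C * y ^ m" "0 < y" "0 \<le> x"
  shows "x \<le> y"
proof (rule ccontr)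
  assume "\<not> x \<le> y"
  then have "1 < x / y" using assms(2) by simp
  then obtain m where "C < (x / y) ^ m" using real_arch_pow by blast
  then have "C * y ^ m < x ^ m" using assms(2) by (simp add: power_divide field_simps)
  then show False using assms(1)[of m] by simp
qed

lemma holomorphic_on_peval:
  assumes "\<And>v. (\<lambda>z. x z v) holomorphic_on S"
  shows "(\<lambda>z. peval p (x z)) holomorphic_on S"
  unfolding peval_eq_sum mono_eval_def by (intro holomorphic_intros assms)

lemma holomorphic_on_det:
  assumes "\<And>i j. (\<lambda>z. M z $ i $ j) holomorphic_on S"
  shows "(\<lambda>z. det (M z :: complex^'n^'n)) holomorphic_on S"
  unfolding det_def by (intro holomorphic_intros assms)

section \<open>The block triangular group as the parabolic subgroup of the weight\<close>

context flag
begin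

lemma subgroup_P0: "subgroup P0 SL"
proof (rule group.subgroupI[OF group_SL])
  show "P0 \<subseteq> carrier SL" by (auto simp: P0_def)
  have "mat 1 \<in> P0" by (simp add: P0_def det_I) (auto simp: mat_def)
  then show "P0 \<noteq> {}" by blast
  fix p assume p: "p \<in> P0"
  then have detp: "det p = 1" by (simp add: P0_def)
  define p' where "p' = inv\<^bsub>SL\<^esub> p"
  have p': "det p' = 1" "p' ** p = mat 1" using inv_SL[OF detp] by (simp_all add: p'_def)
  have "p' $ i $ j = 0" if ij: "l i < l j" for i j
  proof -
    define q where "q = l i"
    have iK: "i \<notin> K q" and jK: "j \<in> K q" using ij by (auto simp: K_def q_def)
    \<comment> \<open>The block of \<open>p\<close> on \<open>K q\<close>, completed by unit
      columns, is invertible, so column \<open>j\<close> of the inverse can be found among the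
      vectors supported in \<open>K q\<close>.\<close>
    let ?M = "minor (K q) id p"
    have sum_id: "(\<Sum>j\<in>- K q. if a = id j then y $ j else 0) = (if a \<in> K q then 0 else y $ a)" for a and y :: "complex^'n::{finite,linorder}"
      by simp
    have low: "(p *v (\<chi> j. if j \<in> K q then y $ j else 0)) $ a = 0" if "a \<notin> K q" for a y
      unfolding matrix_vector_mult_def using P0_zero[OF p that] by (auto intro!: sum.neutral)
    have M: "(?M *v y) $ a = (if a \<in> K q then (p *v (\<chi> j. if j \<in> K q then y $ j else 0)) $ a else y $ a)" for y a
      using minor_mult_vec[of "K q" id p y a] low[of a y] by (simp add: sum_id)
    have eqK: "(\<chi> j. if j \<in> K q then y $ j else 0) = y" if "\<And>a. a \<notin> K q \<Longrightarrow> y $ a = 0" for y :: "complex^'n::{finite,linorder}"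
      using that by (simp add: vec_eq_iff)
    have "det ?M \<noteq> 0"
    proof (rule det_nonzero_if_kernel_trivial)
      fix y assume y: "?M *v y = 0"
      have y0: "y $ a = 0" if "a \<notin> K q" for a using M[of y a] y that by simp
      have yK: "(\<chi> j. if j \<in> K q then y $ j else 0) = y" by (rule eqK) (rule y0)
      have "(p *v y) $ a = 0" for a
        using M[of y a] low[of a y] y unfolding yK by (cases "a \<in> K q") auto
      then have "p *v y = 0" by (simp add: vec_eq_iff)
      then show "y = 0" by (rule kernel_trivial_if_det_nonzero[rotated]) (simp add: detp)
    qed
    then obtain Q where "?M ** Q = mat 1" using invertible_det_nz[of ?M] by (auto simp: invertible_def)
    then have "?M *v (Q *v axis j 1) = axis j 1" by (simp add: matrix_vector_mul_assoc)
    then obtain w where w: "?M *v w = axis j 1" by blast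
    have w0: "w $ a = 0" if a: "a \<notin> K q" for a
    proof -
      have "a \<noteq> j" using a jK by auto
      then show ?thesis using M[of w a] w a by (simp add: axis_def)
    qed
    have wK: "(\<chi> j. if j \<in> K q then w $ j else 0) = w" by (rule eqK) (rule w0)
    have "(p *v w) $ a = axis j 1 $ a" for a
    proof (cases "a \<in> K q")
      case True
      then show ?thesis using M[of w a] w unfolding wK by simp
    next
      case False
      then show ?thesis using low[of a w] jK unfolding wK by (auto simp: axis_def)
    qed
    then have "p *v w = axis j 1" by (simp add: vec_eq_iff)
    then have "p' *v axis j 1 = (p' ** p) *v w" by (metis matrix_vector_mul_assoc)
    then have "p' *v axis j 1 = w" by (simp add: p'(2))
    moreover have "(p' *v axis j 1) $ i = p' $ i $ j"
      by (simp add: matrix_vector_mult_def axis_def if_distrib cong: if_cong)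
    ultimately show ?thesis using w0[OF iK] by simp
  qed
  then show "inv\<^bsub>SL\<^esub> p \<in> P0" using p'(1) by (simp add: P0_def p'_def)
  fix r assume r: "r \<in> P0"
  have "(p ** r) $ i $ j = 0" if "l i < l j" for i j
    unfolding matrix_matrix_mult_def using p r that
    by (auto simp: P0_def intro!: sum.neutral) (meson le_less_trans not_le_imp_less)
  then show "p \<otimes>\<^bsub>SL\<^esub> r \<in> P0" using p r by (simp add: P0_def det_mul)
qed

lemma upper_borel_subset_P0: "upper_borel \<subseteq> P0"
proof
  fix b :: "complex^'n::{finite,linorder}^'n::{finite,linorder}"
  assume "b \<in> upper_borel"
  then have b: "upper b" by (simp add: upper_borel_iff)
  have "b $ i $ j = 0" if "l i < l j" for i j
    using b that antitone[of i j] by (auto simp: upper_def) (meson not_le)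
  then show "b \<in> P0" using b by (simp add: P0_def upper_def)
qed

lemma zariski_closed_P0: "zariski_closed_in_SL P0"
proof -
  let ?S = "{pvar (i, j) | i j. l i < l j}"
  have "(\<forall>p\<in>?S. peval p (entries g) = 0) \<longleftrightarrow> (\<forall>i j. l i < l j \<longrightarrow> peval (pvar (i, j)) (entries g) = 0)" for g
    by blast
  then have "P0 = {g \<in> carrier SL. \<forall>p\<in>?S. peval p (entries g) = 0}" by (simp add: P0_def)
  then show ?thesis unfolding zariski_closed_in_SL_def by blast
qed

lemma psi0_mult: "p \<in> P0 \<Longrightarrow> psi0 (h ** p) = psi0 h * psi0 p"
  unfolding psi0_def prod.distrib[symmetric]
  by (intro prod.cong refl minor_det_mult) (auto intro: P0_zero)

lemma psi0_1: "psi0 (mat 1) = 1"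
proof -
  have "minor (K q) id (mat 1) = mat 1" for q by (simp add: minor_def mat_def vec_eq_iff)
  then show ?thesis by (simp add: psi0_def det_I)
qed

lemma polynomial_fun_psi0: "polynomial_fun psi0"
  unfolding psi0_def by (intro polynomial_fun_prod polynomial_fun_minor_det)

lemma psi0_upper: "upper u \<Longrightarrow> psi0 u = (\<Prod>i\<in>UNIV. u $ i $ i ^ l i)"
  using prod_levels[of "\<lambda>i. u $ i $ i"] by (simp add: psi0_def upper_def minor_det_id_upper_triangular)

lemma psi0_nonzero: "p \<in> P0 \<Longrightarrow> psi0 p \<noteq> 0"
proof -
  assume p: "p \<in> P0"
  then have "det p = 1" by (simp add: P0_def)
  then have "psi0 (inv\<^bsub>SL\<^esub> p ** p) = 1" by (simp add: inv_SL psi0_1)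
  then show ?thesis using psi0_mult[OF p, of "inv\<^bsub>SL\<^esub> p"] by auto
qed

lemma extends_weight_psi0: "extends_weight lam P0 psi0"
  unfolding extends_weight_def algebraic_character_def
proof (intro conjI ballI)
  show "\<exists>p. \<forall>g\<in>P0. psi0 g = peval p (entries g)"
    using polynomial_fun_psi0 by (auto simp: polynomial_fun_def)
  fix t :: "complex^'n::{finite,linorder}^'n::{finite,linorder}" assume t: "t \<in> diag_torus"
  then obtain x where x: "t = dg x" "(\<Prod>i\<in>UNIV. x i) = 1" using diag_torus_iff by blast
  then have "upper t" by (simp add: upper_def dg_nth det_dg)
  then show "psi0 t = weight_char lam t" using psi0_upper weight[OF t] by simp
qed (simp_all add: psi0_nonzero psi0_mult)

lemma closed_P0: "closed P0"
  by (rule zariski_closed_imp_closed[OF zariski_closed_P0])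

lemma parabolic_P0: "parabolic P0"
  unfolding parabolic_def
proof (intro conjI subgroup_P0 zariski_closed_P0 bexI[of _ "mat 1"] ballI)
  fix b :: "complex^'n::{finite,linorder}^'n::{finite,linorder}" assume "b \<in> upper_borel"
  moreover have "inv\<^bsub>SL\<^esub> (mat 1 :: complex^'n::{finite,linorder}^'n::{finite,linorder}) = mat 1"
    by (rule inv_SL_eq) (simp_all add: det_I)
  ultimately show "mat 1 \<otimes>\<^bsub>SL\<^esub> b \<otimes>\<^bsub>SL\<^esub> inv\<^bsub>SL\<^esub> mat 1 \<in> P0"
    using upper_borel_subset_P0 by auto
qed (simp add: det_I)

lemma parabolic_of_eq: "parabolic_of lam = P0"
  unfolding parabolic_of_def
proof (rule Greatest_equality)
  show "parabolic P0 \<and> upper_borel \<subseteq> P0 \<and> (\<exists>\<psi>. extends_weight lam P0 \<psi>)"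
    using parabolic_P0 upper_borel_subset_P0 extends_weight_psi0 by blast
  fix P assume "parabolic P \<and> upper_borel \<subseteq> P \<and> (\<exists>\<psi>. extends_weight lam P \<psi>)"
  then show "P \<subseteq> P0"
    using parabolic_subset_P0 zariski_closed_imp_closed by (auto simp: parabolic_def)
qed

text \<open>Growth only bounds \<open>norm (\<psi> h)\<close> by a constant multiple of
  \<open>norm (psi0 h)\<close>. Applied to all powers of \<open>h\<close> the constant disappears by
  multiplicativity, and the inverse of \<open>p\<close> gives the reverse inequality.\<close>

lemma norm_extension_eq:
  assumes psi: "extends_weight lam P0 \<psi>" and p: "p \<in> P0"
  shows "norm (\<psi> p) = norm (psi0 p)"
proof -
  obtain C0 where C0: "0 \<le> C0" "\<And>h. h \<in> P0 \<Longrightarrow> norm (\<psi> h) \<le> C0 * (\<Prod>q<L. minors_norm (K q) h)"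
    using psi_growth[OF subgroup_P0 upper_borel_subset_P0 closed_P0 psi] by blast
  define C where "C = C0 * (\<Prod>q<L. minors_norm (K q) (mat 1 :: complex^'n::{finite,linorder}^'n::{finite,linorder}))"
  have C: "norm (\<psi> h) \<le> C * norm (psi0 h)" if h: "h \<in> P0" for h
  proof -
    have "minors_norm (K q) (mat 1 ** h) = minors_norm (K q) (mat 1) * norm (minor_det (K q) id h)" for q
      by (rule minors_norm_mult) (rule P0_zero[OF h])
    then have "(\<Prod>q<L. minors_norm (K q) h) = (\<Prod>q<L. minors_norm (K q) (mat 1)) * norm (psi0 h)"
      by (simp add: psi0_def prod.distrib prod_norm)
    then show ?thesis using C0(2)[OF h] by (simp add: C_def mult_ac)
  qed
  have hom: "\<psi> (g ** h) = \<psi> g * \<psi> h" if "g \<in> P0" "h \<in> P0" for g h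
    using psi that by (simp add: extends_weight_def algebraic_character_def)
  have one: "mat 1 \<in> P0" using subgroup.one_closed[OF subgroup_P0] by simp
  have nz: "\<psi> g \<noteq> 0" if "g \<in> P0" for g using psi that by (simp add: extends_weight_def algebraic_character_def)
  have psi1: "\<psi> (mat 1) = 1" using hom[OF one one] nz[OF one] by simp
  have le: "norm (\<psi> h) \<le> norm (psi0 h)" if h: "h \<in> P0" for h
  proof (rule bounded_powers_imp_le)
    fix m
    have "\<exists>g\<in>P0. \<psi> g = \<psi> h ^ m \<and> psi0 g = psi0 h ^ m"
    proof (induction m)
      case 0
      then show ?case using one psi1 psi0_1 by auto
    next
      case (Suc m)
      then obtain g where g: "g \<in> P0" "\<psi> g = \<psi> h ^ m" "psi0 g = psi0 h ^ m" by blast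
      then show ?case using subgroup.m_closed[OF subgroup_P0 g(1) h] hom[OF g(1) h] psi0_mult[OF h, of g]
        by (intro bexI[of _ "g ** h"]) (simp_all add: mult.commute)
    qed
    then show "norm (\<psi> h) ^ m \<le> C * norm (psi0 h) ^ m" using C by (metis norm_power)
  qed (simp_all add: psi0_nonzero h)
  have detp: "det p = 1" using p by (simp add: P0_def)
  define p' where "p' = inv\<^bsub>SL\<^esub> p"
  have p': "p' \<in> P0" "p' ** p = mat 1"
    using subgroup.m_inv_closed[OF subgroup_P0 p] inv_SL[OF detp] by (simp_all add: p'_def)
  have inv: "\<psi> p' * \<psi> p = 1" "psi0 p' * psi0 p = 1"
    using hom[OF p'(1) p] psi0_mult[OF p, of p'] p'(2) psi1 psi0_1 by simp_all
  have "1 = norm (\<psi> p') * norm (\<psi> p)" by (metis inv(1) norm_mult norm_one)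
  also have "\<dots> \<le> norm (psi0 p') * norm (\<psi> p)" using le[OF p'(1)] by (intro mult_right_mono) auto
  finally have "norm (psi0 p) * 1 \<le> norm (psi0 p) * (norm (psi0 p') * norm (\<psi> p))"
    by (intro mult_left_mono) auto
  also have "\<dots> = norm (psi0 p' * psi0 p) * norm (\<psi> p)" by (simp add: norm_mult)
  finally have "norm (psi0 p) \<le> norm (\<psi> p)" by (simp add: inv)
  then show ?thesis using le[OF p] by simp
qed

text \<open>Two extensions have quotient of absolute value 1. Along the curve \<open>(1 - z) + z p\<close>, with one
  column rescaled to stay in the group, the quotient is holomorphic, so it is constant by the
  maximum modulus principle.\<close>

lemma extension_unique:
  assumes psi: "extends_weight lam P0 \<psi>" and p: "p \<in> P0"
  shows "\<psi> p = psi0 p"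
proof -
  have detp: "det p = 1" and pz: "\<And>i j. l i < l j \<Longrightarrow> p $ i $ j = 0" using p by (auto simp: P0_def)
  obtain i0 :: 'n where True by blast
  define M :: "complex \<Rightarrow> complex^'n::{finite,linorder}^'n::{finite,linorder}"
    where "M = (\<lambda>z. \<chi> i j. (1 - z) * (if i = j then 1 else 0) + z * p $ i $ j)"
  define d where "d = (\<lambda>z. det (M z))"
  define N where "N = (\<lambda>z. M z ** dg (\<lambda>j. if j = i0 then 1 / d z else 1))"
  define S where "S = {z. d z \<noteq> 0}"
  have M01: "M 0 = mat 1" "M 1 = p" by (simp_all add: M_def mat_def vec_eq_iff)
  then have d01: "d 0 = 1" "d 1 = 1" by (simp_all add: d_def detp det_I)
  have dg1: "dg (\<lambda>j. if j = i0 then 1 / (1::complex) else 1) = mat 1" by (simp add: dg_def mat_def vec_eq_iff)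
  have N01: "N 0 = mat 1" "N 1 = p"
    by (simp_all only: N_def M01 d01 dg1 matrix_mul_lid matrix_mul_rid)
  have holM: "(\<lambda>z. M z $ i $ j) holomorphic_on T" for i j T
    unfolding M_def vec_lambda_beta by (intro holomorphic_intros)
  have hold: "d holomorphic_on T" for T unfolding d_def by (intro holomorphic_on_det holM)
  have NP: "N z \<in> P0" if "z \<in> S" for z
  proof -
    have "det (N z) = 1"
      using that by (simp add: N_def det_mul det_dg S_def) (simp add: d_def)
    moreover have "N z $ i $ j = 0" if "l i < l j" for i j
      using pz[OF that] that by (auto simp: N_def mult_dg_nth M_def)
    ultimately show ?thesis by (simp add: P0_def)
  qed
  have holN: "(\<lambda>z. N z $ i $ j) holomorphic_on S" for i j
  proof (cases "j = i0")
    case True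
    have "(\<lambda>z. M z $ i $ j * (1 / d z)) holomorphic_on S"
      by (intro holomorphic_intros holM hold) (auto simp: S_def)
    then show ?thesis using True by (simp add: N_def mult_dg_nth)
  next
    case False
    then show ?thesis using holM by (simp add: N_def mult_dg_nth)
  qed
  have "open (d -` (- {0}))"
    using holomorphic_on_imp_continuous_on[OF hold[of UNIV]] by (intro open_vimage) auto
  then have openS: "open S" by (simp add: S_def vimage_def)
  \<comment> \<open>The zeros of a nonconstant holomorphic function are countable, and removing a
    countable set does not disconnect the plane; a constant \<open>d\<close> has the value
    1.\<close>
  have connS: "connected S"
  proof (cases "d constant_on UNIV")
    case True
    then have "d z = 1" for z using d01 by (metis constant_on_def UNIV_I)
    then have "S = UNIV" by (auto simp: S_def)
    then show ?thesis using convex_connected[OF convex_UNIV] by simp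
  next
    case False
    have "countable {z \<in> UNIV. d z = 0}"
      by (rule holomorphic_countable_zeros[OF hold]) (use False in auto)
    then have "connected (UNIV - {z. d z = 0})"
      by (intro connected_open_diff_countable) auto
    moreover have "UNIV - {z. d z = 0} = S" by (auto simp: S_def)
    ultimately show ?thesis by simp
  qed
  obtain pp where pp: "\<And>g. g \<in> P0 \<Longrightarrow> \<psi> g = peval pp (entries g)"
    using psi by (auto simp: extends_weight_def algebraic_character_def)
  obtain pp0 where pp0: "\<And>g. psi0 g = peval pp0 (entries g)"
    using polynomial_fun_psi0 by (auto simp: polynomial_fun_def)
  define \<theta> where "\<theta> = (\<lambda>z. \<psi> (N z) / psi0 (N z))"
  have holE: "(\<lambda>z. entries (N z) v) holomorphic_on S" for v using holN by (cases v) simp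
  have "(\<lambda>z. peval pp (entries (N z)) / peval pp0 (entries (N z))) holomorphic_on S"
    using psi0_nonzero[OF NP] by (intro holomorphic_intros holomorphic_on_peval holE) (auto simp: pp0)
  then have hol: "\<theta> holomorphic_on S"
    by (rule holomorphic_transform) (simp add: \<theta>_def pp[OF NP] pp0)
  have norm1: "norm (\<theta> z) = 1" if "z \<in> S" for z
    using norm_extension_eq[OF psi NP[OF that]] psi0_nonzero[OF NP[OF that]] by (simp add: \<theta>_def norm_divide)
  have "\<theta> constant_on S"
    by (rule maximum_modulus_principle[OF hol openS connS openS _ _ , where \<xi> = 0]) (use d01 norm1 in \<open>auto simp: S_def\<close>)
  moreover have "0 \<in> S" "1 \<in> S" using d01 by (auto simp: S_def)
  ultimately have "\<theta> 1 = \<theta> 0" by (auto simp: constant_on_def)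
  moreover have "\<theta> 0 = 1"
  proof -
    have "upper (mat 1 :: complex^'n::{finite,linorder}^'n::{finite,linorder})" by (simp add: upper_def det_I) (simp add: mat_def)
    then have "\<psi> (mat 1) = 1"
      using psi_upper[OF subgroup_P0 upper_borel_subset_P0 psi, of "mat 1"] by (simp add: mat_def)
    then show ?thesis by (simp add: \<theta>_def N01 psi0_1)
  qed
  ultimately have "\<psi> p / psi0 p = 1" by (simp add: \<theta>_def N01)
  then show ?thesis by simp
qed

lemma extended_char_eq: "p \<in> P0 \<Longrightarrow> extended_char lam p = psi0 p"
proof -
  have "extends_weight lam P0 (extended_char lam)"
    unfolding extended_char_def parabolic_of_eq by (rule someI[of _ psi0]) (rule extends_weight_psi0)
  then show "p \<in> P0 \<Longrightarrow> extended_char lam p = psi0 p" by (rule extension_unique)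
qed

end

section \<open>Weights of sections\<close>

lemma complex_differentiable_const: "complex_differentiable_at (\<lambda>_. c) x"
  unfolding complex_differentiable_at_def by (rule exI[of _ "\<lambda>_. 0"]) auto

lemma complex_differentiable_entry: "complex_differentiable_at (\<lambda>g. g $ i $ j) x"
  unfolding complex_differentiable_at_def
  by (rule exI[of _ "\<lambda>g. g $ i $ j"]) (auto intro!: bounded_linear_imp_has_derivative bounded_linear_vec_nth bounded_linear_compose[of "\<lambda>v. v $ j"])

lemma complex_differentiable_add:
  assumes "complex_differentiable_at f x" "complex_differentiable_at g x"
  shows "complex_differentiable_at (\<lambda>y. f y + g y) x"
proof -
  obtain D E where "(f has_derivative D) (at x)" "\<And>c v. D (\<chi> i j. c * v $ i $ j) = c * D v"
    "(g has_derivative E) (at x)" "\<And>c v. E (\<chi> i j. c * v $ i $ j) = c * E v"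
    using assms by (auto simp: complex_differentiable_at_def)
  then show ?thesis unfolding complex_differentiable_at_def
    by (intro exI[of _ "\<lambda>v. D v + E v"]) (auto intro!: derivative_intros simp: algebra_simps)
qed

lemma complex_differentiable_mult:
  assumes "complex_differentiable_at f x" "complex_differentiable_at g x"
  shows "complex_differentiable_at (\<lambda>y. f y * g y) x"
proof -
  obtain D E where "(f has_derivative D) (at x)" "\<And>c v. D (\<chi> i j. c * v $ i $ j) = c * D v"
    "(g has_derivative E) (at x)" "\<And>c v. E (\<chi> i j. c * v $ i $ j) = c * E v"
    using assms by (auto simp: complex_differentiable_at_def)
  then show ?thesis unfolding complex_differentiable_at_def
    by (intro exI[of _ "\<lambda>v. f x * E v + D v * g x"] conjI allI has_derivative_mult) (simp_all add: algebra_simps)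
qed

lemma complex_differentiable_prod:
  "(\<And>i. i \<in> I \<Longrightarrow> complex_differentiable_at (f i) x) \<Longrightarrow> complex_differentiable_at (\<lambda>y. \<Prod>i\<in>I. f i y) x"
  by (induction I rule: infinite_finite_induct) (auto intro: complex_differentiable_const complex_differentiable_mult)

lemma complex_differentiable_sum:
  "(\<And>i. i \<in> I \<Longrightarrow> complex_differentiable_at (f i) x) \<Longrightarrow> complex_differentiable_at (\<lambda>y. \<Sum>i\<in>I. f i y) x"
  by (induction I rule: infinite_finite_induct) (auto intro: complex_differentiable_const complex_differentiable_add)

lemma complex_differentiable_minor_det: "complex_differentiable_at (minor_det K \<sigma>) x"
proof -
  have "complex_differentiable_at (\<lambda>g. minor K \<sigma> g $ i $ j) x" for i j
    by (cases "j \<in> K") (simp_all add: minor_def complex_differentiable_entry complex_differentiable_const)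
  then show ?thesis unfolding det_def
    by (intro complex_differentiable_sum complex_differentiable_mult complex_differentiable_prod complex_differentiable_const)
qed

lemma holomorphic_on_SL_E:
  fixes f :: "complex^'n^'n \<Rightarrow> complex"
  assumes "holomorphic_on_SL f" "det g = 1"
  obtains U F where "open U" "g \<in> U" "\<forall>x\<in>U. complex_differentiable_at F x"
    "\<forall>x\<in>U. det x = 1 \<longrightarrow> F x = f x"
proof -
  have "\<exists>U F. open U \<and> g \<in> U \<and> (\<forall>x\<in>U. complex_differentiable_at F x) \<and> (\<forall>x\<in>U \<inter> carrier SL. F x = f x)"
    using assms unfolding holomorphic_on_SL_def by simp
  then obtain U F where "open U" "g \<in> U" "\<forall>x\<in>U. complex_differentiable_at F x" "\<forall>x\<in>U \<inter> carrier SL. F x = f x"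
    by (elim exE conjE) (rule that)
  then show ?thesis by (intro that[of U F]) auto
qed

lemma continuous_on_holomorphic_on_SL:
  fixes f :: "complex^'n^'n \<Rightarrow> complex"
  assumes "holomorphic_on_SL f"
  shows "continuous_on {g. det g = 1} f"
  unfolding continuous_on_def
proof
  fix g :: "complex^'n^'n" assume g: "g \<in> {g. det g = 1}"
  then have "det g = 1" by simp
  with assms obtain U F where U0: "open U" "g \<in> U" "\<forall>x\<in>U. complex_differentiable_at F x"
    "\<forall>x\<in>U. det x = 1 \<longrightarrow> F x = f x"
    by (rule holomorphic_on_SL_E)
  note U = U0(1,2) U0(3,4)[rule_format]
  obtain D where "(F has_derivative D) (at g)" using U(3)[OF U(2)] by (auto simp: complex_differentiable_at_def)
  then have "(F \<longlongrightarrow> F g) (at g within {g. det g = 1})"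
    using has_derivative_continuous continuous_within tendsto_within_subset by blast
  moreover have "eventually (\<lambda>x. F x = f x) (at g within {g. det g = 1})"
    unfolding eventually_at_topological using U by (intro exI[of _ U]) auto
  moreover have "F g = f g" using U g by auto
  ultimately show "(f \<longlongrightarrow> f g) (at g within {g. det g = 1})"
    by (metis (mono_tags, lifting) Lim_transform_eventually)
qed

section \<open>Characters of one-parameter subgroups\<close>

lemma has_derivative_vecI:
  fixes f :: "'a::euclidean_space \<Rightarrow> 'b::real_normed_vector^'n"
  assumes "\<And>i. ((\<lambda>x. f x $ i) has_derivative (\<lambda>h. f' h $ i)) F"
  shows "(f has_derivative f') F"
  unfolding has_derivative_def
proof
  have lin: "linear (\<lambda>h. f' h $ i)" for i
    using has_derivative_bounded_linear[OF assms] by (rule bounded_linear.linear)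
  have "linear f'"
    by (rule linearI) (simp_all add: vec_eq_iff linear_add[OF lin] linear_scale[OF lin])
  then show "bounded_linear f'" by (simp add: linear_conv_bounded_linear)
  show "((\<lambda>y. (f y - f (Lim F (\<lambda>x. x)) - f' (y - Lim F (\<lambda>x. x))) /\<^sub>R norm (y - Lim F (\<lambda>x. x))) \<longlongrightarrow> 0) F"
    by (rule vec_tendstoI) (use assms in \<open>simp add: has_derivative_def\<close>)
qed

text \<open>Translation turns the derivative at 0 into the differential equation
  \<open>f' = a f\<close>, so the quotient of \<open>f\<close> by the exponential has derivative 0
  everywhere.\<close>

lemma multiplicative_imp_exp:
  fixes f :: "complex \<Rightarrow> complex"
  assumes mult: "\<And>z w. f (z + w) = f z * f w" and f0: "f 0 = 1" and d: "(f has_field_derivative a) (at 0)"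
  shows "f z = exp (a * z)"
proof -
  have df: "(f has_field_derivative a * f z) (at z)" for z
  proof -
    have "((\<lambda>w. f w * f z) has_field_derivative a * f z) (at 0)" using d by (rule DERIV_cmult_right)
    then have "((\<lambda>w. f (w + z)) has_field_derivative a * f z) (at 0)" by (simp add: mult)
    then show ?thesis using DERIV_shift[of f "a * f z" 0 z] by simp
  qed
  have "((\<lambda>z. f z * exp (- (a * z))) has_field_derivative 0) (at z within UNIV)" for z
    by (auto intro!: derivative_eq_intros df)
  then have "\<exists>c. \<forall>z\<in>UNIV. f z * exp (- (a * z)) = c"
    by (intro has_field_derivative_zero_constant) auto
  then obtain c where c: "\<And>z. f z * exp (- (a * z)) = c" by auto
  have "c = 1" using c[of 0] f0 by simp
  then have "f z * exp (- (a * z)) * exp (a * z) = exp (a * z)" using c[of z] by simp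
  then show ?thesis by (simp add: mult.assoc exp_add[symmetric])
qed

text \<open>In the coordinate \<open>z\<close> with \<open>y = e\<^sup>z\<close> the character is \<open>e\<^sup>a\<^sup>z\<close>, and \<open>a\<close> is integral by periodicity.\<close>

lemma character_one_parameter:
  fixes g :: "complex^'n^'n" and x :: "'n \<Rightarrow> int"
  assumes hol: "holomorphic_on_SL f" and g: "det g = 1" and fg: "f g \<noteq> 0" and x: "(\<Sum>i\<in>UNIV. x i) = 0"
    and ev: "\<And>t h. (\<Prod>i\<in>UNIV. t i) = 1 \<Longrightarrow> det h = 1 \<Longrightarrow> f (dg t ** h) = ev t * f h"
  shows "\<exists>m::int. \<forall>y. y \<noteq> 0 \<longrightarrow> ev (\<lambda>i. y powi x i) = y powi m"
proof -
  define cv where "cv = (\<lambda>z. dg (\<lambda>i. exp (of_int (x i) * z)) ** g)"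
  have prod1: "(\<Prod>i\<in>UNIV. exp (of_int (x i) * z)) = (1::complex)" for z
  proof -
    have "(\<Prod>i\<in>UNIV. exp (of_int (x i) * z)) = exp (of_int (\<Sum>i\<in>UNIV. x i) * z)"
      by (simp add: exp_sum[symmetric] sum_distrib_right)
    then show ?thesis by (simp add: x)
  qed
  define \<eta> where "\<eta> = (\<lambda>z. ev (\<lambda>i. exp (of_int (x i) * z)))"
  have f_cv: "f (cv z) = \<eta> z * f g" for z
    unfolding cv_def \<eta>_def by (rule ev[OF prod1 g])
  have cv_add: "cv (z + w) = dg (\<lambda>i. exp (of_int (x i) * z)) ** cv w" for z w
    by (simp add: cv_def matrix_mul_assoc dg_mult distrib_left exp_add)
  have detcv: "det (cv z) = 1" for z using prod1 g by (simp add: cv_def det_mul det_dg)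
  have mult: "\<eta> (z + w) = \<eta> z * \<eta> w" for z w
  proof -
    have "f (cv (z + w)) = \<eta> z * f (cv w)"
      unfolding cv_add \<eta>_def by (rule ev[OF prod1 detcv])
    then show ?thesis using fg by (simp add: f_cv)
  qed
  have cv0: "cv 0 = g" by (simp add: cv_def dg_1)
  have eta0: "\<eta> 0 = 1" using f_cv[of 0] fg by (simp add: cv0)
  have cv_alt: "cv = (\<lambda>z. \<chi> i j. exp (of_int (x i) * z) * g $ i $ j)"
    by (simp add: cv_def fun_eq_iff vec_eq_iff dg_mult_nth)
  define E where "E = (\<lambda>w. \<chi> i j. of_int (x i) * w * g $ i $ j)"
  have dcv: "(cv has_derivative E) (at 0)"
    unfolding cv_alt E_def by (intro has_derivative_vecI) (auto intro!: derivative_eq_intros)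
  obtain U F where U0: "open U" "g \<in> U" "\<forall>x\<in>U. complex_differentiable_at F x"
    "\<forall>x\<in>U. det x = 1 \<longrightarrow> F x = f x"
    using hol g by (rule holomorphic_on_SL_E)
  note U = U0(1,2) U0(3,4)[rule_format]
  obtain DF where DF: "(F has_derivative DF) (at g)" "\<And>c v. DF (\<chi> i j. c * v $ i $ j) = c * DF v"
    using U(3)[OF U(2)] by (auto simp: complex_differentiable_at_def)
  have "((\<lambda>z. F (cv z)) has_derivative (\<lambda>w. DF (E w))) (at 0)"
    using has_derivative_compose[OF dcv, of F DF] DF(1) by (simp add: cv0)
  \<comment> \<open>\<open>DF\<close> is complex linear, which upgrades the real derivative along
    the curve to a complex one.\<close>
  moreover have "(\<lambda>w. DF (E w)) = (*) (DF (E 1))"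
  proof
    fix w
    have "E w = (\<chi> i j. w * E 1 $ i $ j)" by (simp add: E_def vec_eq_iff)
    then have "DF (E w) = DF (\<chi> i j. w * E 1 $ i $ j)" by (rule arg_cong)
    then show "DF (E w) = DF (E 1) * w" unfolding DF(2) by (simp only: mult.commute)
  qed
  ultimately have dF: "((\<lambda>z. F (cv z)) has_field_derivative DF (E 1)) (at 0)"
    by (simp only: has_field_derivative_def)
  have "isCont cv 0" using dcv by (rule has_derivative_continuous)
  then have "(cv \<longlongrightarrow> g) (at 0)" by (simp add: isCont_def cv0)
  then have "eventually (\<lambda>z. cv z \<in> U) (at 0)" using U(1,2) by (rule topological_tendstoD)
  then have "eventually (\<lambda>z. F (cv z) = f (cv z)) (at 0)"
    by eventually_elim (use U(4) detcv in auto)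
  moreover have "F (cv 0) = f (cv 0)" using U(2,4) detcv[of 0] by (simp add: cv0 g)
  ultimately have "((\<lambda>z. f (cv z)) has_field_derivative DF (E 1)) (at 0)"
    using dF DERIV_cong_ev[OF refl _ refl, of "\<lambda>z. F (cv z)" "\<lambda>z. f (cv z)" 0 "DF (E 1)"]
    by (simp add: eventually_nhds_conv_at)
  then have "((\<lambda>z. \<eta> z * f g / f g) has_field_derivative DF (E 1) / f g) (at 0)"
    unfolding f_cv by (rule DERIV_cdivide)
  then have deta: "(\<eta> has_field_derivative DF (E 1) / f g) (at 0)" using fg by simp
  define a where "a = DF (E 1) / f g"
  have eta: "\<eta> z = exp (a * z)" for z
    using mult eta0 deta unfolding a_def by (rule multiplicative_imp_exp)
  have "exp (of_int (x i) * (2 * of_real pi * \<i>)) = 1" for i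
    unfolding exp_eq_1 by (simp add: mult_ac)
  then have "\<eta> (2 * of_real pi * \<i>) = \<eta> 0" by (simp add: \<eta>_def)
  then have "exp (a * (2 * of_real pi * \<i>)) = 1" by (simp add: eta)
  then obtain m :: int where m: "a = of_int m"
    unfolding exp_eq_1 by (auto simp: complex_eq_iff)
  have "ev (\<lambda>i. y powi x i) = y powi m" if y: "y \<noteq> 0" for y
  proof -
    have pw: "exp (of_int k * Ln y) = y powi k" for k
      using y exp_power_int[of "Ln y" k] by simp
    show ?thesis using eta[of "Ln y"] by (simp add: \<eta>_def pw m)
  qed
  then show ?thesis by blast
qed

section \<open>Torus eigenvectors among the sections\<close>

context flag
begin

lemma sections_iff:
  "f \<in> sections lam \<longleftrightarrow> holomorphic_on_SL f \<and> (\<forall>g. det g \<noteq> 1 \<longrightarrow> f g = 0) \<and>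
    (\<forall>g p. det g = 1 \<longrightarrow> p \<in> P0 \<longrightarrow> f (g ** p) = psi0 p * f g)"
  unfolding sections_def parabolic_of_eq using extended_char_eq by auto

lemma section_growth:
  assumes "f \<in> sections lam"
  shows "\<exists>C\<ge>0. \<forall>h\<in>{g. det g = 1}. norm (f h) \<le> C * (\<Prod>q<L. minors_norm (K q) h)"
proof (rule growth[OF K_down closed_det_1])
  show "continuous_on {g. det g = 1} f"
    using assms by (intro continuous_on_holomorphic_on_SL) (simp add: sections_iff)
  fix h u :: "complex^'n::{finite,linorder}^'n::{finite,linorder}"
  assume h: "h \<in> {g. det g = 1}" and u: "upper u"
  show "h ** u \<in> {g. det g = 1}" using h u by (simp add: upper_def det_mul)
  have "u \<in> P0" using u upper_borel_subset_P0 upper_borel_iff by blast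
  then show "f (h ** u) = (\<Prod>q<L. \<Prod>i\<in>K q. u $ i $ i) * f h"
    using assms h by (simp add: sections_iff psi0_upper[OF u] prod_levels)
qed auto

lemma minor_product_in_sections:
  "(\<lambda>g. if det g = 1 then \<Prod>q<L. minor_det (K q) (\<sigma> q) g else 0) \<in> sections lam"
  unfolding sections_iff
proof (intro conjI allI impI)
  show "holomorphic_on_SL (\<lambda>g. if det g = 1 then \<Prod>q<L. minor_det (K q) (\<sigma> q) g else 0)"
    unfolding holomorphic_on_SL_def
    by (intro ballI exI[of _ UNIV] exI[of _ "\<lambda>g. \<Prod>q<L. minor_det (K q) (\<sigma> q) g"])
      (auto intro: complex_differentiable_prod complex_differentiable_minor_det)
  fix g p :: "complex^'n::{finite,linorder}^'n::{finite,linorder}"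
  assume g: "det g = 1" and p: "p \<in> P0"
  have "minor_det (K q) (\<sigma> q) (g ** p) = minor_det (K q) (\<sigma> q) g * minor_det (K q) id p" for q
    by (rule minor_det_mult) (rule P0_zero[OF p])
  then show "(if det (g ** p) = 1 then \<Prod>q<L. minor_det (K q) (\<sigma> q) (g ** p) else 0) =
      psi0 p * (if det g = 1 then \<Prod>q<L. minor_det (K q) (\<sigma> q) g else 0)"
    using g p by (simp add: det_mul P0_def psi0_def prod.distrib mult.commute)
qed auto

lemma torus_character:
  assumes "torus_eigenvector f"
  shows "\<exists>ev. \<forall>t h. (\<Prod>i\<in>UNIV. t i) = 1 \<longrightarrow> det h = 1 \<longrightarrow> f (dg t ** h) = ev t * f h"
proof -
  have "\<exists>c. \<forall>h. det h = 1 \<longrightarrow> f (dg t ** h) = c * f h" if t: "(\<Prod>i\<in>UNIV. t i) = 1" for t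
  proof -
    have t0: "t i \<noteq> 0" for i using t by (metis UNIV_I finite prod_zero_iff zero_neq_one)
    have t': "(\<Prod>i\<in>UNIV. 1 / t i) = 1" using t by (simp add: prod_dividef)
    have "inv\<^bsub>SL\<^esub> (dg (\<lambda>i. 1 / t i)) = dg t"
      by (rule inv_SL_eq) (simp_all add: det_dg t t' dg_mult t0 dg_1)
    moreover have "dg (\<lambda>i. 1 / t i) \<in> diag_torus" using t' diag_torus_iff by blast
    ultimately show ?thesis using assms unfolding torus_eigenvector_def by force
  qed
  then show ?thesis by metis
qed

text \<open>One-parameter subgroups give integral exponents, which the torus determines only up to a
  constant vector. Their total is congruent to \<open>L\<close> modulo \<open>CARD('n)\<close>,
  since scalar matrices act alike from both sides, so a constant shift makes it equal to
  \<open>L\<close>.\<close>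

lemma section_integral_weight:
  assumes f: "f \<in> sections lam" "torus_eigenvector f" and g: "det g = 1" and fg: "f g \<noteq> 0"
  shows "\<exists>\<mu>::'n \<Rightarrow> int. (\<Sum>i\<in>UNIV. \<mu> i) = int L \<and>
    (\<forall>t. (\<Prod>i\<in>UNIV. t i) = 1 \<longrightarrow> f (dg t ** g) = (\<Prod>i\<in>UNIV. t i powi \<mu> i) * f g)"
proof -
  obtain ev where ev: "\<And>t h. (\<Prod>i\<in>UNIV. t i) = 1 \<Longrightarrow> det h = 1 \<Longrightarrow> f (dg t ** h) = ev t * f h"
    using torus_character[OF f(2)] by blast
  have hol: "holomorphic_on_SL f" using f(1) by (simp add: sections_iff)
  obtain i0 :: 'n where True by blast
  \<comment> \<open>One-parameter subgroups with a parameter in place \<open>i\<close> and its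
    inverse in place \<open>i0\<close>; together they generate the diagonal torus.\<close>
  define x where "x = (\<lambda>i j. (if j = i then 1 else 0) - (if j = i0 then 1 else 0) :: int)"
  have x0: "(\<Sum>j\<in>UNIV. x i j) = 0" for i by (simp add: x_def sum_subtractf)
  have "\<exists>m::int. \<forall>y. y \<noteq> 0 \<longrightarrow> ev (\<lambda>j. y powi x i j) = y powi m" for i
    by (rule character_one_parameter[where x = "x i" and ev = ev, OF hol g fg x0 ev])
  then obtain m where m: "\<And>i y. y \<noteq> 0 \<Longrightarrow> ev (\<lambda>j. y powi x i j) = y powi m i" by metis
  have ev_mult: "ev (\<lambda>i. s i * t i) = ev s * ev t" if "(\<Prod>i\<in>UNIV. s i) = 1" "(\<Prod>i\<in>UNIV. t i) = 1" for s t
  proof -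
    have "ev (\<lambda>i. s i * t i) * f g = f (dg s ** (dg t ** g))"
      using ev[of "\<lambda>i. s i * t i" g] that g by (simp add: matrix_mul_assoc dg_mult prod.distrib)
    also have "\<dots> = ev s * (ev t * f g)" using ev[of s "dg t ** g"] ev[of t g] that g by (simp add: det_mul det_dg)
    finally show ?thesis using fg by simp
  qed
  have ev_prod: "ev (\<lambda>j. \<Prod>i\<in>I. y i powi x i j) = (\<Prod>i\<in>I. y i powi m i) \<and> (\<Prod>j\<in>UNIV. \<Prod>i\<in>I. y i powi x i j) = 1"
    if y: "\<And>i. y i \<noteq> 0" for I :: "'n set" and y
  proof (induction I rule: infinite_finite_induct)
    case empty
    have "ev (\<lambda>_. 1) = 1" using ev[of "\<lambda>_. 1" g] g fg by (simp add: dg_1)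
    then show ?case by simp
  next
    case (insert i I)
    have "(\<Prod>j\<in>UNIV. y i powi x i j) = 1" using x0[of i] by (simp add: power_int_sum[OF y, symmetric])
    then show ?case using insert ev_mult[of "\<lambda>j. y i powi x i j" "\<lambda>j. \<Prod>i\<in>I. y i powi x i j"] m[OF y]
      by (simp add: prod.distrib)
  qed simp
  define b where "b = (\<lambda>i. if i = i0 then 0 else m i)"
  have ev_t: "ev t = (\<Prod>i\<in>UNIV. t i powi b i)" if t: "(\<Prod>i\<in>UNIV. t i) = 1" for t
  proof -
    have t0: "t i \<noteq> 0" for i using t by (metis UNIV_I finite prod_zero_iff zero_neq_one)
    have "(\<Prod>i\<in>UNIV - {i0}. t i powi x i j) = t j" for j
    proof (cases "j = i0")
      case True
      have "(\<Prod>i\<in>UNIV - {i0}. t i powi x i j) = (\<Prod>i\<in>UNIV - {i0}. inverse (t i))"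
        using True by (intro prod.cong) (auto simp: x_def power_int_minus)
      moreover have "t i0 * (\<Prod>i\<in>UNIV - {i0}. t i) = 1" using t by (simp add: prod.remove)
      then have "inverse (\<Prod>i\<in>UNIV - {i0}. t i) = t i0" by (intro inverse_unique) (simp add: mult.commute)
      ultimately show ?thesis using True by (simp add: prod_inversef[symmetric] comp_def)
    next
      case False
      have "(\<Prod>i\<in>UNIV - {i0}. t i powi x i j) = (\<Prod>i\<in>UNIV - {i0}. if i = j then t j else 1)"
        using False by (intro prod.cong) (auto simp: x_def)
      then show ?thesis using False by simp
    qed
    then have "ev t = (\<Prod>i\<in>UNIV - {i0}. t i powi m i)"
      using ev_prod[where y = t and I = "UNIV - {i0}", OF t0] by simp
    also have "\<dots> = (\<Prod>i\<in>UNIV. t i powi b i)"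
      by (rule prod.mono_neutral_cong_left) (auto simp: b_def)
    finally show ?thesis .
  qed
  define N where "N = int CARD('n)"
  have N: "N \<noteq> 0" by (simp add: N_def)
  define \<zeta> where "\<zeta> = exp (2 * of_real pi * \<i> / of_nat CARD('n))"
  have "\<zeta> ^ CARD('n) = exp (of_nat CARD('n) * (2 * of_real pi * \<i> / of_nat CARD('n)))"
    unfolding \<zeta>_def by (rule exp_of_nat_mult[symmetric])
  then have z1: "\<zeta> ^ CARD('n) = 1" by simp
  have z0: "\<zeta> \<noteq> 0" by (simp add: \<zeta>_def)
  define S where "S = (\<Sum>i\<in>UNIV. b i)"
  have pz: "(\<Prod>i\<in>(UNIV :: 'n set). \<zeta>) = 1" using z1 by simp
  have "upper (dg (\<lambda>_. \<zeta>) :: complex^'n::{finite,linorder}^'n::{finite,linorder})"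
    using z1 by (simp add: upper_def dg_nth det_dg)
  then have zP: "dg (\<lambda>_. \<zeta>) \<in> P0" and zpsi: "psi0 (dg (\<lambda>_. \<zeta>)) = \<zeta> ^ L"
    using upper_borel_subset_P0 upper_borel_iff psi0_upper by (auto simp: dg_nth power_sum L_def)
  \<comment> \<open>From the left this scalar matrix acts on \<open>f\<close> as a torus element,
    with value \<open>\<zeta> powi S\<close>, and from the right as an element of \<open>P0\<close>,
    with value \<open>\<zeta> ^ L\<close>. As \<open>\<zeta>\<close> is a primitive root of unity,
    \<open>S\<close> and \<open>L\<close> are congruent modulo \<open>CARD('n)\<close>.\<close>
  have "dg (\<lambda>_. \<zeta>) ** g = g ** dg (\<lambda>_. \<zeta>)" by (simp add: vec_eq_iff dg_mult_nth mult_dg_nth mult.commute)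
  then have "ev (\<lambda>_. \<zeta>) * f g = \<zeta> ^ L * f g"
    using ev[OF pz g] f(1) g zP zpsi by (auto simp: sections_iff)
  then have "\<zeta> powi S = \<zeta> powi int L"
    using fg ev_t[OF pz] by (simp add: S_def power_int_sum[OF z0, symmetric])
  then have "\<zeta> powi (int L - S) = 1" using z0 by (simp add: power_int_diff)
  then have "exp (of_int (int L - S) * (2 * of_real pi * \<i> / of_nat CARD('n))) = 1"
    unfolding \<zeta>_def exp_power_int .
  then obtain k :: int where "of_int (int L - S) * (2 * pi / real CARD('n)) = of_int (2 * k) * pi"
    unfolding exp_eq_1 by auto
  then have "of_int (int L - S) * (2 * pi) = real_of_int (k * N) * (2 * pi)" by (simp add: N_def field_simps)
  then have "of_int (int L - S) = real_of_int (k * N)" unfolding mult_cancel_right by simp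
  then have k: "int L - S = k * N" by linarith
  define \<mu> where "\<mu> = (\<lambda>i. b i + k)"
  have "(\<Sum>i\<in>UNIV. \<mu> i) = int L" using k by (simp add: \<mu>_def sum.distrib S_def[symmetric] N_def mult.commute)
  moreover have "f (dg t ** g) = (\<Prod>i\<in>UNIV. t i powi \<mu> i) * f g" if t: "(\<Prod>i\<in>UNIV. t i) = 1" for t
  proof -
    have t0: "t i \<noteq> 0" for i using t by (metis UNIV_I finite prod_zero_iff zero_neq_one)
    have "(\<Prod>i\<in>UNIV. t i powi \<mu> i) = (\<Prod>i\<in>UNIV. t i powi b i) * (\<Prod>i\<in>UNIV. t i) powi k"
      by (simp add: \<mu>_def power_int_add t0 prod.distrib prod_power_int)
    then show ?thesis using ev[OF t g] ev_t[OF t] t by simp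
  qed
  ultimately show ?thesis by blast
qed

lemma section_weight:
  assumes f: "f \<in> sections lam" "torus_eigenvector f" and g: "det g = 1" and fg: "f g \<noteq> 0"
  shows "\<exists>\<mu>::'n \<Rightarrow> nat. (\<Sum>i\<in>UNIV. \<mu> i) = L \<and>
    (\<forall>t. (\<Prod>i\<in>UNIV. t i) = 1 \<longrightarrow> f (dg t ** g) = (\<Prod>i\<in>UNIV. t i ^ \<mu> i) * f g) \<and>
    (\<forall>A. (\<Sum>i\<in>A. int (\<mu> i)) \<le> (\<Sum>q<L. rk (K q) g A))"
proof -
  obtain \<mu> :: "'n \<Rightarrow> int" where \<mu>: "(\<Sum>i\<in>UNIV. \<mu> i) = int L"
    "\<And>t. (\<Prod>i\<in>UNIV. t i) = 1 \<Longrightarrow> f (dg t ** g) = (\<Prod>i\<in>UNIV. t i powi \<mu> i) * f g"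
    using section_integral_weight[OF assms] by blast
  obtain C where C: "0 \<le> C" "\<And>h. det h = 1 \<Longrightarrow> norm (f h) \<le> C * (\<Prod>q<L. minors_norm (K q) h)"
    using section_growth[OF f(1)] by auto
  have cardK: "(\<Sum>q<L. int (card (K q))) = int L" unfolding sum_card_K by (simp add: L_def)
  have bound: "(\<Sum>i\<in>A. \<mu> i) \<le> (\<Sum>q<L. rk (K q) g A)" for A
  proof (rule weight_bound[OF C(1) _ fg])
    fix t :: "'n \<Rightarrow> complex" assume t: "(\<Prod>i\<in>UNIV. t i) = 1"
    then show "norm ((\<Prod>i\<in>UNIV. t i powi \<mu> i) * f g) \<le> C * (\<Prod>q<L. minors_norm (K q) (dg t ** g))"
      using C(2)[of "dg t ** g"] \<mu>(2)[OF t] g by (simp add: det_mul det_dg)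
  qed (simp add: \<mu>(1) cardK)
  \<comment> \<open>The entries other than \<open>i\<close> sum to at most \<open>L\<close>, as
    every rank is bounded by the number of columns, while all entries together sum to
    \<open>L\<close>.\<close>
  have nonneg: "0 \<le> \<mu> i" for i
  proof -
    have "(\<Sum>i\<in>UNIV. \<mu> i) = \<mu> i + (\<Sum>i\<in>UNIV - {i}. \<mu> i)" by (simp add: sum.remove)
    moreover have "(\<Sum>q<L. rk (K q) g (UNIV - {i})) \<le> (\<Sum>q<L. int (card (K q)))"
      by (intro sum_mono rk_le_card')
    ultimately show ?thesis using bound[of "UNIV - {i}"] \<mu>(1) cardK by linarith
  qed
  have "int (\<Sum>i\<in>UNIV. nat (\<mu> i)) = int L" using nonneg \<mu>(1) by simp
  then have "(\<Sum>i\<in>UNIV. nat (\<mu> i)) = L" by linarith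
  moreover have "t i ^ nat (\<mu> i) = t i powi \<mu> i" for t :: "'n \<Rightarrow> complex" and i
    using nonneg by (rule power_nat_eq)
  ultimately show ?thesis
    using \<mu>(2) bound nonneg by (intro exI[of _ "\<lambda>i. nat (\<mu> i)"]) simp
qed

end

section \<open>Closures of torus orbits\<close>

text \<open>Extracting a root of order \<open>CARD('n)\<close> from the product of the entries. By
  homogeneity, statements about diagonal matrices of determinant 1 then extend to the torus of all
  vectors without zero entries.\<close>

lemma scale_to_unit_prod:
  fixes t :: "'n::finite \<Rightarrow> complex"
  assumes "\<And>i. t i \<noteq> 0"
  obtains \<tau> y where "\<tau> \<noteq> 0" "(\<Prod>i\<in>UNIV. y i) = 1" "t = (\<lambda>i. \<tau> * y i)"
proof -
  define \<tau> where "\<tau> = exp (Ln (\<Prod>i\<in>UNIV. t i) / of_nat CARD('n))"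
  have nz: "(\<Prod>i\<in>UNIV. t i) \<noteq> 0" using assms by simp
  have "\<tau> ^ CARD('n) = exp (of_nat CARD('n) * (Ln (\<Prod>i\<in>UNIV. t i) / of_nat CARD('n)))"
    unfolding \<tau>_def by (rule exp_of_nat_mult[symmetric])
  then have "\<tau> ^ CARD('n) = (\<Prod>i\<in>UNIV. t i)" using nz by simp
  then have "(\<Prod>i\<in>UNIV. t i / \<tau>) = 1" using nz by (simp add: prod_dividef)
  moreover have "\<tau> \<noteq> 0" by (simp add: \<tau>_def)
  ultimately show ?thesis by (intro that[of \<tau> "\<lambda>i. t i / \<tau>"]) auto
qed

lemma archimedean_int: "(\<And>k::nat. a + int k * u \<le> b + int k * v) \<Longrightarrow> u \<le> v"
proof (rule ccontr)
  assume *: "\<And>k::nat. a + int k * u \<le> b + int k * v" and "\<not> u \<le> v"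
  then have "int (nat (b - a + 1)) * 1 \<le> int (nat (b - a + 1)) * (u - v)" by (intro mult_left_mono) auto
  moreover have "0 \<le> b - a" using *[of 0] by simp
  ultimately show False using *[of "nat (b - a + 1)"] by (simp add: right_diff_distrib)
qed

text \<open>The conditions are linear and homogeneous in \<open>\<alpha>\<close> and
  \<open>d\<close>, and \<open>d\<close> is fixed by the degree because \<open>0 < L\<close>. For
  large \<open>k\<close> the fixed contribution of \<open>\<epsilon>\<close> to such an inequality
  becomes negligible, so it holds for \<open>\<alpha> - \<beta>\<close>. The same argument gives
  \<open>\<beta>\<close> at most \<open>\<alpha>\<close> entrywise, so that the difference is a
  genuine exponent.\<close>

lemma saturated_degree_bounded:
  fixes R :: "'v::{finite,linorder} set \<Rightarrow> int"
  assumes "0 < L"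
  shows "saturated_monoid {\<alpha>. \<exists>d. tdeg \<alpha> = d * L \<and> (\<forall>A. (\<Sum>i\<in>A. int (lookup \<alpha> i)) \<le> int d * R A)}"
    (is "saturated_monoid ?S")
proof
  show "0 \<in> ?S" by (auto intro!: exI[of _ "0::nat"])
  fix \<alpha> \<beta>
  assume "\<alpha> \<in> ?S" "\<beta> \<in> ?S"
  then obtain d d' where \<alpha>: "tdeg \<alpha> = d * L" "\<And>A. (\<Sum>i\<in>A. int (lookup \<alpha> i)) \<le> int d * R A"
    and \<beta>: "tdeg \<beta> = d' * L" "\<And>A. (\<Sum>i\<in>A. int (lookup \<beta> i)) \<le> int d' * R A" by blast
  have "(\<Sum>i\<in>A. int (lookup (\<alpha> + \<beta>) i)) \<le> int (d + d') * R A" for A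
    using add_mono[OF \<alpha>(2) \<beta>(2), of A A] by (simp add: lookup_add sum.distrib algebra_simps)
  moreover have "tdeg (\<alpha> + \<beta>) = (d + d') * L" using \<alpha>(1) \<beta>(1) by (simp add: algebra_simps)
  ultimately show "\<alpha> + \<beta> \<in> ?S" by blast
  fix \<epsilon>
  assume "\<epsilon> \<in> ?S"
  then obtain d'' where \<epsilon>: "tdeg \<epsilon> = d'' * L" by blast
  assume sat: "\<And>k. \<exists>\<sigma>\<in>?S. \<epsilon> + (\<Sum>i<k::nat. \<alpha>) = \<sigma> + (\<Sum>i<k. \<beta>)"
  have le: "lookup \<beta> i \<le> lookup \<alpha> i" for i
  proof -
    have "0 + int k * int (lookup \<beta> i) \<le> int (lookup \<epsilon> i) + int k * int (lookup \<alpha> i)" for k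
    proof -
      from sat[of k] obtain \<sigma> where "\<epsilon> + (\<Sum>i<k. \<alpha>) = \<sigma> + (\<Sum>i<k. \<beta>)" by blast
      from arg_cong[OF this, of "\<lambda>p. lookup p i"]
      have "lookup \<epsilon> i + k * lookup \<alpha> i = lookup \<sigma> i + k * lookup \<beta> i"
        by (simp add: lookup_add lookup_sum)
      from arg_cong[OF this, of int] show ?thesis by simp
    qed
    then have "int (lookup \<beta> i) \<le> int (lookup \<alpha> i)" by (rule archimedean_int)
    then show ?thesis by simp
  qed
  then have eq: "\<alpha> = (\<alpha> - \<beta>) + \<beta>" by (intro poly_mapping_eqI) (simp add: lookup_add lookup_minus)
  have "tdeg \<beta> \<le> tdeg \<alpha>" using arg_cong[OF eq, of tdeg] by simp
  then have dd: "d' \<le> d" using \<alpha>(1) \<beta>(1) assms by simp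
  have "(\<Sum>i\<in>A. int (lookup (\<alpha> - \<beta>) i)) \<le> int (d - d') * R A" for A
  proof (rule archimedean_int)
    fix k :: nat
    from sat[of k] obtain \<sigma> where "\<sigma> \<in> ?S" and "\<epsilon> + (\<Sum>i<k. \<alpha>) = \<sigma> + (\<Sum>i<k. \<beta>)" by blast
    then obtain e where \<sigma>: "\<epsilon> + (\<Sum>i<k. \<alpha>) = \<sigma> + (\<Sum>i<k. \<beta>)"
      "tdeg \<sigma> = e * L" "\<And>A. (\<Sum>i\<in>A. int (lookup \<sigma> i)) \<le> int e * R A" by blast
    have "(d'' + k * d) * L = (e + k * d') * L"
      using arg_cong[OF \<sigma>(1), of tdeg] \<alpha>(1) \<beta>(1) \<epsilon> \<sigma>(2) by (simp add: algebra_simps)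
    then have "d'' + k * d = e + k * d'" using assms by simp
    from arg_cong[OF this, of int] have "int e = int d'' + int k * int (d - d')"
      using dd by (simp add: of_nat_diff algebra_simps)
    moreover have "int (lookup \<sigma> i) = int (lookup \<epsilon> i) + int k * int (lookup (\<alpha> - \<beta>) i)" for i
    proof -
      have "lookup \<epsilon> i + k * lookup \<alpha> i = lookup \<sigma> i + k * lookup \<beta> i"
        using arg_cong[OF \<sigma>(1), of "\<lambda>p. lookup p i"] by (simp add: lookup_add lookup_sum)
      from arg_cong[OF this, of int] show ?thesis
        using le[of i] by (simp add: lookup_minus of_nat_diff algebra_simps)
    qed
    ultimately show "(\<Sum>i\<in>A. int (lookup \<epsilon> i)) + int k * (\<Sum>i\<in>A. int (lookup (\<alpha> - \<beta>) i))
        \<le> int d'' * R A + int k * (int (d - d') * R A)"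
      using \<sigma>(3)[of A] by (simp add: sum.distrib sum_distrib_left algebra_simps)
  qed
  moreover have "tdeg (\<alpha> - \<beta>) = (d - d') * L"
    using arg_cong[OF eq, of tdeg] \<alpha>(1) \<beta>(1) by (simp add: diff_mult_distrib)
  ultimately show "\<exists>\<sigma>\<in>?S. \<alpha> = \<sigma> + \<beta>" using eq by blast
qed

section \<open>The torus orbit of a point of the flag variety\<close>

locale flag_point = flag l lam
  for l :: "'n::{finite,linorder} \<Rightarrow> nat" and lam :: "int^'n::{finite,linorder}" +
  fixes s :: "'m::finite \<Rightarrow> complex^'n::{finite,linorder}^'n::{finite,linorder} \<Rightarrow> complex"
    and g :: "complex^'n::{finite,linorder}^'n::{finite,linorder}"
  assumes eigenbasis: "torus_eigenbasis lam s" and det_g: "det g = 1"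
begin

lemma basis_in_sections: "s j \<in> sections lam"
  using eigenbasis fun_space.span_base[of "s j" "range s"] by (auto simp: torus_eigenbasis_def)

lemma sections_expansion:
  assumes "f \<in> sections lam"
  shows "\<exists>a. \<forall>h. f h = (\<Sum>j\<in>UNIV. a j * s j h)"
proof -
  have "f \<in> fun_space.span (range s)" "inj s" using eigenbasis assms by (auto simp: torus_eigenbasis_def)
  then obtain u where "f = (\<Sum>v\<in>range s. (\<lambda>h. u v * v h))"
    using fun_space.span_finite[of "range s"] by auto
  also have "\<dots> = (\<Sum>j\<in>UNIV. (\<lambda>h. u (s j) * s j h))"
    using \<open>inj s\<close> by (simp add: sum.reindex)
  also have "(\<Sum>j\<in>I. (\<lambda>h. u (s j) * s j h)) = (\<lambda>h. \<Sum>j\<in>I. u (s j) * s j h)" for I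
    by (induction I rule: infinite_finite_induct) (auto simp: fun_eq_iff)
  finally have "f h = (\<Sum>j\<in>UNIV. u (s j) * s j h)" for h by simp
  then show ?thesis by (intro exI[of _ "\<lambda>j. u (s j)"]) blast
qed

lemma L_pos: "0 < L"
proof -
  have "l undefined \<le> L" unfolding L_def by (intro member_le_sum) auto
  then show ?thesis using l_pos[of undefined] by linarith
qed

lemma exists_exponents:
  "\<exists>e :: 'm \<Rightarrow> 'n \<Rightarrow>\<^sub>0 nat. \<forall>j. tdeg (e j) = L \<and>
    (\<forall>y. (\<Prod>i\<in>UNIV. y i) = 1 \<longrightarrow> s j (dg y ** g) = s j g * mono_eval y (e j)) \<and>
    (s j g \<noteq> 0 \<longrightarrow> (\<forall>A. (\<Sum>i\<in>A. int (lookup (e j) i)) \<le> (\<Sum>q<L. rk (K q) g A)))"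
proof (rule choice, rule allI)
  fix j
  have eig: "torus_eigenvector (s j)" using eigenbasis by (simp add: torus_eigenbasis_def)
  let ?m = "\<lambda>\<mu> :: 'n \<Rightarrow> nat. (\<Sum>i\<in>UNIV. Poly_Mapping.single i (\<mu> i))"
  show "\<exists>e. tdeg e = L \<and>
    (\<forall>y. (\<Prod>i\<in>UNIV. y i) = 1 \<longrightarrow> s j (dg y ** g) = s j g * mono_eval y e) \<and>
    (s j g \<noteq> 0 \<longrightarrow> (\<forall>A. (\<Sum>i\<in>A. int (lookup e i)) \<le> (\<Sum>q<L. rk (K q) g A)))"
  proof (cases "s j g = 0")
    case True
    from torus_character[OF eig] obtain ev
      where "\<And>t h. (\<Prod>i\<in>UNIV. t i) = 1 \<Longrightarrow> det h = 1 \<Longrightarrow> s j (dg t ** h) = ev t * s j h" by blast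
    then have "s j (dg y ** g) = 0" if "(\<Prod>i\<in>UNIV. y i) = 1" for y using that det_g True by simp
    \<comment> \<open>The coordinate vanishes along the whole orbit, so any exponent of degree
      \<open>L\<close> will do; \<open>l\<close> is one.\<close>
    then show ?thesis using True by (intro exI[of _ "?m l"]) (simp add: L_def)
  next
    case False
    from section_weight[OF basis_in_sections eig det_g False] obtain \<mu> :: "'n \<Rightarrow> nat" where
      "(\<Sum>i\<in>UNIV. \<mu> i) = L" "\<And>A. (\<Sum>i\<in>A. int (\<mu> i)) \<le> (\<Sum>q<L. rk (K q) g A)"
      "\<And>t. (\<Prod>i\<in>UNIV. t i) = 1 \<Longrightarrow> s j (dg t ** g) = (\<Prod>i\<in>UNIV. t i ^ \<mu> i) * s j g" by blast
    then show ?thesis by (intro exI[of _ "?m \<mu>"]) (simp add: lookup_sum_single mono_eval_UNIV mult.commute)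
  qed
qed

definition c :: "'m \<Rightarrow> complex" where "c j = s j g"

definition e :: "'m \<Rightarrow> 'n \<Rightarrow>\<^sub>0 nat" where
  "e = (SOME e. \<forall>j. tdeg (e j) = L \<and>
    (\<forall>y. (\<Prod>i\<in>UNIV. y i) = 1 \<longrightarrow> s j (dg y ** g) = s j g * mono_eval y (e j)) \<and>
    (s j g \<noteq> 0 \<longrightarrow> (\<forall>A. (\<Sum>i\<in>A. int (lookup (e j) i)) \<le> (\<Sum>q<L. rk (K q) g A))))"

lemma tdeg_e: "tdeg (e j) = L"
  and basis_dg: "(\<Prod>i\<in>UNIV. y i) = 1 \<Longrightarrow> s j (dg y ** g) = c j * mono_eval y (e j)"
  and e_le: "c j \<noteq> 0 \<Longrightarrow> (\<Sum>i\<in>A. int (lookup (e j) i)) \<le> (\<Sum>q<L. rk (K q) g A)"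
  using someI_ex[OF exists_exponents, folded e_def] by (auto simp: c_def)

text \<open>A product of minors is a section, hence a combination of the basis. Along the orbit both
  sides are combinations of monomials of degree \<open>L\<close>, so by linear independence
  \<open>\<mu>\<close>, whose coefficient is nonzero, must come from a basis section that does not
  vanish at \<open>g\<close>.\<close>

lemma exists_basis_weight:
  assumes nz: "\<And>q. q < L \<Longrightarrow> minor_det (K q) (\<sigma> q) g \<noteq> 0"
    and \<mu>: "\<And>i. lookup \<mu> i = card {q\<in>{..<L}. i \<notin> \<sigma> q ` (- K q)}"
  shows "\<exists>j. c j \<noteq> 0 \<and> e j = \<mu>"
proof (rule ccontr)
  assume none: "\<nexists>j. c j \<noteq> 0 \<and> e j = \<mu>"
  define F where "F = (\<lambda>g. if det g = 1 then \<Prod>q<L. minor_det (K q) (\<sigma> q) g else 0)"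
  have Fg: "F g \<noteq> 0" using nz det_g by (simp add: F_def)
  have "F \<in> sections lam" unfolding F_def by (rule minor_product_in_sections)
  then obtain a where a: "\<And>h. F h = (\<Sum>j\<in>UNIV. a j * s j h)" using sections_expansion by blast
  have F_dg: "F (dg y ** g) = mono_eval y \<mu> * F g" if y: "(\<Prod>i\<in>UNIV. y i) = 1" for y
  proof -
    have y0: "y i \<noteq> 0" for i using y by (metis UNIV_I finite prod_zero_iff zero_neq_one)
    have "(\<Prod>i\<in>- \<sigma> q ` (- K q). y i) = (\<Prod>i\<in>UNIV. if i \<notin> \<sigma> q ` (- K q) then y i else 1)" for q
      by (simp add: prod.If_cases Compl_eq)
    then have "F (dg y ** g) = (\<Prod>q<L. \<Prod>i\<in>UNIV. if i \<notin> \<sigma> q ` (- K q) then y i else 1) * F g"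
      using det_g y by (simp add: F_def det_mul det_dg minor_det_dg[OF y0 minor_det_nonzero_inj[OF nz]] prod.distrib)
    also have "(\<Prod>q<L. \<Prod>i\<in>UNIV. if i \<notin> \<sigma> q ` (- K q) then y i else 1)
        = (\<Prod>i\<in>UNIV. \<Prod>q<L. if i \<notin> \<sigma> q ` (- K q) then y i else 1)" by (rule prod.swap)
    also have "\<dots> = mono_eval y \<mu>"
      unfolding mono_eval_UNIV \<mu> by (intro prod.cong refl) (simp add: prod.If_cases Int_def)
    finally show ?thesis .
  qed
  define p :: "'n cpoly" where
    "p = (\<Sum>j\<in>UNIV. Poly_Mapping.single (e j) (a j * c j)) - Poly_Mapping.single \<mu> (F g)"
  have peval_p: "peval p t = (\<Sum>j\<in>UNIV. a j * c j * mono_eval t (e j)) - F g * mono_eval t \<mu>" for t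
    by (simp add: p_def)
  have tdeg_\<mu>: "tdeg \<mu> = L"
  proof -
    have "int (tdeg \<mu>) = (\<Sum>i\<in>UNIV. \<Sum>q<L. if i \<notin> \<sigma> q ` (- K q) then 1 else 0)"
      unfolding tdeg_UNIV \<mu> by (simp add: sum.If_cases Int_def)
    also have "\<dots> = (\<Sum>q<L. \<Sum>i\<in>UNIV. if i \<notin> \<sigma> q ` (- K q) then 1 else 0)" by (rule sum.swap)
    also have "\<dots> = (\<Sum>q<L. int (card (- \<sigma> q ` (- K q))))" by (simp add: sum.If_cases Compl_eq)
    also have "\<dots> = (\<Sum>q<L. int (card (K q)))"
    proof (rule sum.cong)
      fix q assume "q \<in> {..<L}"
      then have "card (\<sigma> q ` (- K q)) = card (- K q)" using minor_det_nonzero_inj[OF nz] by (simp add: card_image)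
      then have "card (- \<sigma> q ` (- K q)) = card (- (- K q))" by (simp only: card_compl)
      then show "int (card (- \<sigma> q ` (- K q))) = int (card (K q))" by simp
    qed simp
    finally show ?thesis unfolding sum_card_K by (simp add: L_def flip: of_nat_sum)
  qed
  have "p = 0"
  proof (rule peval_eq_0_imp_eq_0)
    fix t :: "'n \<Rightarrow> complex" assume "\<And>v. t v \<noteq> 0"
    then obtain \<tau> y where \<tau>: "\<tau> \<noteq> 0" and y: "(\<Prod>i\<in>UNIV. y i) = 1" and t: "t = (\<lambda>i. \<tau> * y i)"
      by (rule scale_to_unit_prod)
    \<comment> \<open>All monomials of \<open>p\<close> have degree \<open>L\<close>, so the scalar
      \<open>\<tau>\<close> factors out and only vectors with product 1 remain, where the sections
      can be compared.\<close>
    have "peval p t = \<tau> ^ L * ((\<Sum>j\<in>UNIV. a j * s j (dg y ** g)) - F g * mono_eval y \<mu>)"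
      unfolding peval_p t mono_eval_scale tdeg_e tdeg_\<mu> basis_dg[OF y]
      by (simp add: sum_distrib_left algebra_simps)
    also have "\<dots> = 0" unfolding a[symmetric] F_dg[OF y] by simp
    finally show "peval p t = 0" .
  qed
  then have "lookup p \<mu> = 0" by simp
  moreover have "lookup (Poly_Mapping.single (e j) (a j * c j)) \<mu> = 0" for j
    using none by (auto simp: lookup_single when_def)
  ultimately show False using Fg by (simp add: p_def lookup_minus lookup_sum)
qed

lemma exists_section_nonzero: "\<exists>j. c j \<noteq> 0"
proof -
  have "\<exists>\<sigma>. minor_det (K q) \<sigma> g \<noteq> 0" for q using det_g by (intro exists_minor) simp
  then obtain \<sigma> where \<sigma>: "\<And>q. minor_det (K q) (\<sigma> q) g \<noteq> 0" by metis
  define \<mu> where "\<mu> = (\<Sum>i\<in>UNIV. Poly_Mapping.single i (card {q\<in>{..<L}. i \<notin> \<sigma> q ` (- K q)}))"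
  have "\<exists>j. c j \<noteq> 0 \<and> e j = \<mu>" by (rule exists_basis_weight[OF \<sigma>]) (simp add: \<mu>_def lookup_sum_single)
  then show ?thesis by blast
qed

sublocale toric_data c e L
  by unfold_locales (auto simp: L_pos tdeg_e exists_section_nonzero)

text \<open>From left to right, \<open>sum_of_bases\<close> distributes \<open>\<alpha>\<close> over
  \<open>d * L\<close> nonvanishing minors, and each group of \<open>L\<close> minors is the weight
  of a basis section. From right to left the bounds of the generators are added.\<close>

lemma weight_monoid:
  "{\<alpha>. \<exists>d. tdeg \<alpha> = d * L \<and> (\<forall>A. (\<Sum>i\<in>A. int (lookup \<alpha> i)) \<le> int d * (\<Sum>q<L. rk (K q) g A))}
    = {expo m | m. \<forall>j\<in>keys m. c j \<noteq> 0}"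
proof (intro equalityI subsetI; clarify)
  fix \<alpha> d
  assume deg: "tdeg \<alpha> = d * L"
    and le: "\<forall>A. (\<Sum>i\<in>A. int (lookup \<alpha> i)) \<le> int d * (\<Sum>q<L. rk (K q) g A)"
  \<comment> \<open>Every column of the Young diagram is taken \<open>d\<close> times; the first
    index later groups the minors into \<open>d\<close> products.\<close>
  let ?Q = "{..<d} \<times> {..<L}" and ?K = "\<lambda>q. K (snd q)"
  have sumQ: "(\<Sum>q\<in>?Q. f (snd q)) = of_nat d * (\<Sum>q<L. f q)" for f :: "nat \<Rightarrow> int"
    by (simp add: sum.cartesian_product' )
  have "\<exists>\<sigma>. (\<forall>q\<in>?Q. minor_det (?K q) (\<sigma> q) g \<noteq> 0) \<and>
      (\<forall>i. lookup \<alpha> i = card {q\<in>?Q. i \<notin> \<sigma> q ` (- ?K q)})"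
  proof (rule sum_of_bases)
    have "int (\<Sum>q\<in>?Q. card (?K q)) = int d * (\<Sum>q<L. int (card (K q)))"
      using sumQ[of "\<lambda>q. int (card (K q))"] by simp
    also have "\<dots> = int (d * L)" unfolding sum_card_K by (simp add: L_def)
    finally have "int (\<Sum>q\<in>?Q. card (?K q)) = int (d * L)" .
    then have "(\<Sum>q\<in>?Q. card (?K q)) = d * L" by linarith
    then show "(\<Sum>i\<in>UNIV. lookup \<alpha> i) = (\<Sum>q\<in>?Q. card (?K q))"
      using deg by (simp only: tdeg_UNIV)
    show "(\<Sum>i\<in>A. int (lookup \<alpha> i)) \<le> (\<Sum>q\<in>?Q. rk (?K q) g A)" for A
      using le sumQ[of "\<lambda>q. rk (K q) g A"] by simp
  qed (use det_g in auto)
  then obtain \<sigma> where \<sigma>: "\<And>q. q \<in> ?Q \<Longrightarrow> minor_det (?K q) (\<sigma> q) g \<noteq> 0"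
    "\<And>i. lookup \<alpha> i = card {q\<in>?Q. i \<notin> \<sigma> q ` (- ?K q)}" by blast
  define \<mu> where "\<mu> = (\<lambda>p. \<Sum>i\<in>UNIV. Poly_Mapping.single i (card {q\<in>{..<L}. i \<notin> \<sigma> (p, q) ` (- K q)}))"
  have \<mu>: "lookup (\<mu> p) i = card {q\<in>{..<L}. i \<notin> \<sigma> (p, q) ` (- K q)}" for p i
    by (simp add: \<mu>_def lookup_sum_single)
  have "\<exists>j. c j \<noteq> 0 \<and> e j = \<mu> p" if "p < d" for p
    using \<sigma>(1)[of "(p, _)"] that \<mu> by (intro exists_basis_weight[where \<sigma> = "\<lambda>q. \<sigma> (p, q)"]) auto
  then obtain j where j: "\<And>p. p < d \<Longrightarrow> c (j p) \<noteq> 0 \<and> e (j p) = \<mu> p" by metis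
  define m where "m = (\<Sum>p<d. Poly_Mapping.single (j p) (1::nat))"
  have "expo (\<Sum>p<k. Poly_Mapping.single (j p) 1) = (\<Sum>p<k. e (j p))" for k
    by (induction k) (simp_all add: expo_add expo_single[unfolded One_nat_def])
  then have "expo m = (\<Sum>p<d. \<mu> p)" using j by (simp add: m_def)
  moreover have "\<alpha> = (\<Sum>p<d. \<mu> p)"
  proof (rule poly_mapping_eqI)
    fix i
    have "{q\<in>?Q. i \<notin> \<sigma> q ` (- ?K q)} = (SIGMA p:{..<d}. {q\<in>{..<L}. i \<notin> \<sigma> (p, q) ` (- K q)})" by auto
    then show "lookup \<alpha> i = lookup (\<Sum>p<d. \<mu> p) i" by (simp add: \<sigma>(2) lookup_sum \<mu>)
  qed
  moreover have "c j' \<noteq> 0" if "j' \<in> keys m" for j'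
  proof -
    have "\<exists>p<d. j' = j p"
      using subsetD[OF Poly_Mapping.keys_sum that[unfolded m_def]] by (auto split: if_splits)
    then show ?thesis using j by blast
  qed
  ultimately show "\<exists>m. \<alpha> = expo m \<and> (\<forall>j\<in>keys m. c j \<noteq> 0)" by (intro exI[of _ m]) simp
next
  fix m :: "'m \<Rightarrow>\<^sub>0 nat" assume m: "\<forall>j\<in>keys m. c j \<noteq> 0"
  have "(\<Sum>i\<in>A. int (lookup (expo m) i)) \<le> int (tdeg m) * (\<Sum>q<L. rk (K q) g A)" for A
  proof -
    have "(\<Sum>i\<in>A. int (lookup (expo m) i)) = (\<Sum>j\<in>UNIV. int (lookup m j) * (\<Sum>i\<in>A. int (lookup (e j) i)))"
      by (simp add: lookup_expo sum_distrib_left sum.swap[of _ A])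
    also have "\<dots> \<le> (\<Sum>j\<in>UNIV. int (lookup m j) * (\<Sum>q<L. rk (K q) g A))"
    proof (rule sum_mono)
      fix j
      show "int (lookup m j) * (\<Sum>i\<in>A. int (lookup (e j) i)) \<le> int (lookup m j) * (\<Sum>q<L. rk (K q) g A)"
        using m e_le[of j A] by (cases "j \<in> keys m") (auto simp: in_keys_iff intro: mult_left_mono)
    qed
    finally show ?thesis by (simp add: tdeg_UNIV sum_distrib_right)
  qed
  then show "\<exists>d. tdeg (expo m) = d * L \<and>
      (\<forall>A. (\<Sum>i\<in>A. int (lookup (expo m) i)) \<le> int d * (\<Sum>q<L. rk (K q) g A))"
    using tdeg_expo by blast
qed

lemma projective_embedding_dg:
  assumes y: "(\<Prod>i\<in>UNIV. y i) = 1"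
  shows "projective_embedding s (dg y <#\<^bsub>SL\<^esub> (g <#\<^bsub>SL\<^esub> P0)) = proj_point (pt y)"
proof -
  let ?x = "dg y <#\<^bsub>SL\<^esub> (g <#\<^bsub>SL\<^esub> P0)"
  have x: "?x = {dg y ** (g ** p) | p. p \<in> P0}" by (auto simp: l_coset_def SL_def)
  have "mat 1 \<in> P0" using subgroup.one_closed[OF subgroup_P0] by (simp add: SL_def)
  then have "?x \<noteq> {}" unfolding x by blast
  then have "(SOME h. h \<in> ?x) \<in> ?x" by (rule some_in_eq[THEN iffD2])
  then obtain p where p: "p \<in> P0" "(SOME h. h \<in> ?x) = dg y ** (g ** p)" unfolding x by blast
  \<comment> \<open>The chosen representative differs from \<open>dg y ** g\<close> by some
    \<open>p\<close>, and all sections change by the same factor \<open>psi0 p\<close>.\<close>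
  have "s j (dg y ** (g ** p)) = psi0 p * (c j * mono_eval y (e j))" for j
  proof -
    have "s j ((dg y ** g) ** p) = psi0 p * s j (dg y ** g)"
      using basis_in_sections[of j] p(1) y det_g by (simp add: sections_iff det_mul det_dg)
    then show ?thesis by (simp add: matrix_mul_assoc basis_dg[OF y])
  qed
  then have "(\<chi> j. s j (SOME h. h \<in> ?x)) = psi0 p *s pt y"
    unfolding p(2) by (simp add: vec_eq_iff pt_def)
  then show ?thesis
    unfolding projective_embedding_def Let_def by (intro proj_point_eqI[OF psi0_nonzero[OF p(1)]])
qed

lemma image_torus_orbit: "projective_embedding s ` torus_orbit (g <#\<^bsub>SL\<^esub> P0) = torus_points"
proof (intro equalityI subsetI)
  fix z assume "z \<in> projective_embedding s ` torus_orbit (g <#\<^bsub>SL\<^esub> P0)"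
  then obtain t where t: "t \<in> diag_torus" "z = projective_embedding s (t <#\<^bsub>SL\<^esub> (g <#\<^bsub>SL\<^esub> P0))"
    unfolding torus_orbit_def by blast
  from t(1) obtain y where y: "(\<Prod>i\<in>UNIV. y i) = 1" and "t = dg y" unfolding diag_torus_iff by blast
  with t(2) have "z = projective_embedding s (dg y <#\<^bsub>SL\<^esub> (g <#\<^bsub>SL\<^esub> P0))" by simp
  then have "z = proj_point (pt y)" using projective_embedding_dg[OF y] by simp
  moreover have "y i \<noteq> 0" for i using y by (metis UNIV_I finite prod_zero_iff zero_neq_one)
  ultimately show "z \<in> torus_points" unfolding torus_points_def by blast
next
  fix z assume "z \<in> torus_points"
  then obtain t where z: "z = proj_point (pt t)" and "\<And>i. t i \<noteq> 0" unfolding torus_points_def by blast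
  from this(2) obtain \<tau> y where \<tau>: "\<tau> \<noteq> 0" and y: "(\<Prod>i\<in>UNIV. y i) = 1" and t: "t = (\<lambda>i. \<tau> * y i)"
    by (rule scale_to_unit_prod)
  have "pt t = \<tau> ^ L *s pt y" by (simp add: vec_eq_iff pt_def t mono_eval_scale tdeg_e)
  then have "z = proj_point (pt y)" unfolding z using \<tau> by (intro proj_point_eqI[of "\<tau> ^ L"]) auto
  then have "z = projective_embedding s (dg y <#\<^bsub>SL\<^esub> (g <#\<^bsub>SL\<^esub> P0))"
    using projective_embedding_dg[OF y] by simp
  moreover have "dg y \<in> diag_torus" using y diag_torus_iff by blast
  ultimately show "z \<in> projective_embedding s ` torus_orbit (g <#\<^bsub>SL\<^esub> P0)"
    unfolding torus_orbit_def by blast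
qed

lemma orbit_closure:
  "toric_variety (zariski closure_of (projective_embedding s ` torus_orbit (g <#\<^bsub>SL\<^esub> P0))) \<and>
    projectively_normal (zariski closure_of (projective_embedding s ` torus_orbit (g <#\<^bsub>SL\<^esub> P0)))"
  unfolding image_torus_orbit Y_def[symmetric] projectively_normal_def
  using toric_variety_Y closed_subvariety_Y
    normal_coordinate_ring[OF saturated_degree_bounded[OF L_pos] weight_monoid] by blast

end

theorem theorem5p4:
  fixes lam :: "int ^ 'n::{finite,linorder}"
    and s :: "'m::finite \<Rightarrow> complex ^ 'n::{finite,linorder} ^ 'n::{finite,linorder} \<Rightarrow> complex"
    and x :: "(complex ^ 'n::{finite,linorder} ^ 'n::{finite,linorder}) set"
  assumes "CARD('n) \<ge> 2"
    and "dominant lam"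
    and "torus_eigenbasis lam s"
    and "x \<in> lcosets\<^bsub>SL\<^esub> (parabolic_of lam)"
  shows "toric_variety (zariski closure_of (projective_embedding s ` torus_orbit x)) \<and>
    projectively_normal (zariski closure_of (projective_embedding s ` torus_orbit x))"
proof -
  \<comment> \<open>Exceeds the absolute value of every entry of the weight, so the shifted entries
    are at least 1.\<close>
  define a where "a = 1 + (\<Sum>i\<in>UNIV. \<bar>lam $ i\<bar>)"
  have a: "1 \<le> lam $ i + a" for i using member_le_sum[of i UNIV "\<lambda>i. \<bar>lam $ i\<bar>"] by (simp add: a_def)
  interpret flag "\<lambda>i. nat (lam $ i + a)" lam
  proof
    fix i j :: 'n
    show "i \<le> j \<Longrightarrow> nat (lam $ j + a) \<le> nat (lam $ i + a)"
      using assms(2) by (auto simp: dominant_def intro: nat_mono)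
    show "1 \<le> nat (lam $ i + a)" using a[of i] by simp
  next
    fix t :: "complex^'n::{finite,linorder}^'n::{finite,linorder}" assume t: "t \<in> diag_torus"
    have "t $ i $ i ^ nat (lam $ i + a) = t $ i $ i powi (lam $ i + a)" for i
      using a[of i] by (intro power_nat_eq) simp
    then show "weight_char lam t = (\<Prod>i\<in>UNIV. t $ i $ i ^ nat (lam $ i + a))"
      using weight_char_shift[OF t, of lam a] by (simp add: weight_char_def)
  qed
  from assms(4) obtain g where g: "det g = 1" "x = g <#\<^bsub>SL\<^esub> P0"
    unfolding parabolic_of_eq by (auto simp: LCOSETS_def SL_def)
  interpret flag_point "\<lambda>i. nat (lam $ i + a)" lam s g
    by unfold_locales (use assms(3) g(1) in auto)
  show ?thesis unfolding g(2) by (rule orbit_closure)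
qed

end
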